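(* Let $p$ be an odd prime, $f\ge1$ an integer, and $E$ the elliptic curve $y^2=x(x+1)(x+t)$ over $\mathbb{F}_p(t)$. Suppose that $d=2(p^f-1)$, $u^d=t$, and $q$ is a power of $p$ with $q\equiv1\pmod d$. Let $W_d$ be the subgroup of $E(\mathbb{F}_q(u))$ generated by the points $R_i$, $i=0,\dots,d/2-1$, given by $$R_i=\left((\zeta_d^iu)^{-2},\ (\zeta_d^iu)^{-3}\left((\zeta_d^iu)^2+1\right)^{(p^f+1)/2}\right),$$ where $\zeta_d\in\mathbb{F}_q$ is a fixed primitive $d$-th root of unity. Then $W_d$ is free abelian of rank $d/2$. The natural homomorphism $$E(\mathbb{F}_q(u^2))\oplus W_d\to E(\mathbb{F}_q(u))$$ is injective, and its image has finite index.
   Context: $\mathbb{F}_q(u)$ is the rational function field in $u$, viewed as an extension of $\mathbb{F}_p(t)$ via $t=u^d$; $\mathbb{F}_q(u^2)$ is a subfield of it containing $\mathbb{F}_q(t)$. The natural homomorphism is $(P,Q)\mapsto P+Q$, induced by the inclusions of both groups into $E(\mathbb{F}_q(u))$. *)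

theory Defs
  imports
    "HOL-Computational_Algebra.Polynomial"
    "HOL-Computational_Algebra.Primes"
    "HOL-Computational_Algebra.Fraction_Field"
    "HOL-Library.Cardinality"
    "HOL-Number_Theory.Cong"
    "HOL-Algebra.Generated_Groups"
    "HOL-Algebra.Free_Abelian_Groups"
begin

text \<open>
  The rational function field \<open>k(u)\<close> is the type \<open>'k poly fract\<close>, with the
  embedding of constants and the indeterminate \<open>u\<close> as follows.
\<close>

definition const_rf :: "'k::field \<Rightarrow> 'k poly fract" where
  "const_rf c = Fract [:c:] 1"

definition var_rf :: "'k::field poly fract" where
  "var_rf = Fract [:0, 1:] 1"

text \<open>The subfield \<open>k(s)\<close> of \<open>k(u)\<close> generated over \<open>k\<close> by an element \<open>s\<close>.\<close>

definition adjoin_rf :: "'k::field poly fract \<Rightarrow> 'k poly fract set" where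
  "adjoin_rf s =
     {poly (map_poly const_rf a) s / poly (map_poly const_rf b) s | a b.
        poly (map_poly const_rf b) s \<noteq> 0}"

datatype 'a ec_point = Infinity | Point 'a 'a

text \<open>
  The points of the Legendre curve \<open>y\<^sup>2 = x (x + 1) (x + t)\<close> with coordinates in a
  subfield \<open>L\<close> of the ambient field.
\<close>

definition legendre_points :: "'a::field \<Rightarrow> 'a set \<Rightarrow> 'a ec_point set" where
  "legendre_points t L =
     insert Infinity {Point x y | x y. x \<in> L \<and> y \<in> L \<and> y^2 = x * (x + 1) * (x + t)}"

text \<open>
  Chord-tangent addition in characteristic different from 2.  In expanded form the curve is
  \<open>y\<^sup>2 = x\<^sup>3 + (1 + t) x\<^sup>2 + t x\<close>, so the \<open>x\<close>-coordinates of its three intersections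
  with a line of slope \<open>m\<close> sum to \<open>m\<^sup>2 - (1 + t)\<close>.  Two points of the curve with equal
  \<open>x\<close>-coordinates that are not opposite coincide, so the remaining case
  with \<open>x\<^sub>1 = x\<^sub>2\<close> is the tangent one.
\<close>

fun legendre_add :: "'a::field \<Rightarrow> 'a ec_point \<Rightarrow> 'a ec_point \<Rightarrow> 'a ec_point" where
  "legendre_add t Infinity Q = Q"
| "legendre_add t P Infinity = P"
| "legendre_add t (Point x1 y1) (Point x2 y2) =
     (if x1 = x2 \<and> y1 = - y2 then Infinity
      else
        let m = (if x1 = x2 then (3 * x1^2 + 2 * (1 + t) * x1 + t) / (2 * y1)
                 else (y2 - y1) / (x2 - x1));
            x3 = m^2 - (1 + t) - x1 - x2
        in Point x3 (m * (x1 - x3) - y1))"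

definition legendre_group :: "'a::field \<Rightarrow> 'a set \<Rightarrow> 'a ec_point monoid" where
  "legendre_group t L =
     \<lparr>carrier = legendre_points t L, monoid.mult = legendre_add t, one = Infinity\<rparr>"

definition R_point :: "nat \<Rightarrow> nat \<Rightarrow> 'k::field \<Rightarrow> nat \<Rightarrow> 'k poly fract ec_point" where
  "R_point p f \<zeta> i =
     (let v = const_rf (\<zeta> ^ i) * var_rf
      in Point (v powi (-2)) (v powi (-3) * (v^2 + 1) ^ ((p ^ f + 1) div 2)))"

definition primitive_root_of_unity :: "nat \<Rightarrow> 'a::field \<Rightarrow> bool" where
  "primitive_root_of_unity d \<zeta> \<longleftrightarrow> \<zeta> ^ d = 1 \<and> (\<forall>k. 0 < k \<and> k < d \<longrightarrow> \<zeta> ^ k \<noteq> 1)"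

end

theory Submission
  imports
    Defs
    "HOL-Computational_Algebra.Formal_Laurent_Series"
    "HOL-Computational_Algebra.Polynomial_Factorial"
begin

text \<open>
  Write \<open>Q = p\<^sup>f\<close>, \<open>N = Q - 1 = d / 2\<close> and \<open>s = u\<^sup>2\<close>, so that \<open>t = s\<^sup>N\<close>.  The automorphism
  \<open>\<sigma> : u \<mapsto> -u\<close> of \<open>k(u)\<close> over \<open>k(s)\<close> acts on \<open>E(k(u))\<close>.  Its invariant points are
  \<open>E(k(s))\<close>, and since \<open>2 P = (P + \<sigma> P) + (P - \<sigma> P)\<close>, everything depends on the points with
  \<open>\<sigma> P = - P\<close>.  The substitution \<open>X = u\<^sup>2 x\<close>, \<open>Y = u\<^sup>3 y\<close> identifies these with the
  \<open>k(s)\<close>-points of the twisted curve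
  \<open>C : Y\<^sup>2 = X (X + s) (X + s\<^sup>Q)\<close>,
  and it turns \<open>R\<^sub>i\<close> into a point whose \<open>X\<close>-coordinate is the constant \<open>e\<^sub>i = \<zeta>\<^bsup>-2i\<^esup>\<close>.  Indeed the
  \<open>e\<^sub>i\<close> are the \<open>N\<close>-th roots of unity, that is, the nonzero elements of the field with \<open>Q\<close>
  elements, so \<open>e\<^sub>i + s\<^sup>Q = (e\<^sub>i + s)\<^sup>Q\<close>; and each \<open>e\<^sub>i\<close> is a square in \<open>k\<close>.

  The heart of the proof is a 2-descent on \<open>C\<close>, which here can be carried out completely.  To a
  point one attaches the classes of \<open>X\<close> and \<open>X + s\<close> modulo squares.  The finite places of bad
  reduction are \<open>s = 0\<close> and \<open>s = - e\<^sub>i\<close>, because \<open>s\<^sup>Q - s\<close> is the product of \<open>s\<close> and the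
  \<open>s + e\<^sub>i\<close>.  At \<open>s = 0\<close> the reduction is additive and the four 2-torsion points represent the
  four components, so after adding a 2-torsion point one may assume that \<open>X\<close> does not vanish there.
  Then \<open>X\<close> is a square and \<open>X + s\<close> is a square times \<open>\<Prod>\<^bsub>i \<in> S\<^esub> (s + e\<^sub>i)\<close> for some \<open>S\<close>
  (\<open>component_at_0\<close>, \<open>descent_class_exists\<close>, \<open>exists_torsion_translate_with_class\<close>).  The
  set \<open>S\<close> is additive in the point, it is empty only for doubles of points, and \<open>R\<^sub>i\<close> has \<open>S = {i}\<close>.
  This has two consequences.  First, the \<open>R\<^sub>i\<close> and the 2-torsion generate \<open>C\<close> modulo doubling
  (\<open>exists_rep\<close>).  Second, if a combination of the \<open>R\<^sub>i\<close> is a 2-torsion point, then all its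
  coefficients are even, and halving them repeatedly shows that they vanish
  (\<open>R_comb_torsion_imp_zero\<close>).  Hence the \<open>R\<^sub>i\<close> are independent, and their span meets the
  invariant points only in \<open>0\<close>, since an invariant point of the span is killed by 2.

  For the finite index, measure a point by the degree of its \<open>X\<close>-coordinate.  Doubling multiplies
  this height by about 4, whereas adding a fixed point at most doubles it, up to constants.  By the
  first consequence every point of \<open>C\<close> is, modulo the subgroup generated by 2-torsion and the
  \<open>R\<^sub>i\<close>, twice a point of about half the height.  Iterating, every class is \<open>2\<^sup>m\<close> times a class from
  the finite set of points of small height, for all large \<open>m\<close>, and so there are only finitely
  many classes (\<open>finite_index_by_descent\<close>).  Finally a point \<open>P\<close> of \<open>E(k(u))\<close> is determined, modulo
  invariant points and the span of the \<open>R\<^sub>i\<close>, by finitely many data extracted from \<open>P - \<sigma> P\<close>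
  (\<open>finite_index_invariant_R_span\<close>).

  That chord-tangent addition is associative is proved by attaching to a point its ideal in the
  coordinate ring: addition of points is multiplication of ideal classes, and a point is determined
  by its class together with a degree (\<open>ideal_times_add\<close>, \<open>ideal_times_unique\<close>).
\<close>

section \<open>Chord-tangent addition\<close>

text \<open>
  Allowing both nonzero roots to vary makes the family stable under scaling, so that it contains
  the Legendre curve (\<open>a = 1\<close>, \<open>b = t\<close>) together with its quadratic twists.
\<close>

fun ec_add :: "'a::field \<Rightarrow> 'a \<Rightarrow> 'a ec_point \<Rightarrow> 'a ec_point \<Rightarrow> 'a ec_point" where
  "ec_add a b Infinity Q = Q"
| "ec_add a b P Infinity = P"
| "ec_add a b (Point x1 y1) (Point x2 y2) =
     (if x1 = x2 \<and> y1 = - y2 then Infinity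
      else
        let m = (if x1 = x2 then (3 * x1^2 + 2 * (a + b) * x1 + a * b) / (2 * y1)
                 else (y2 - y1) / (x2 - x1));
            x3 = m^2 - (a + b) - x1 - x2
        in Point x3 (m * (x1 - x3) - y1))"

fun ec_neg :: "'a::field ec_point \<Rightarrow> 'a ec_point" where
  "ec_neg Infinity = Infinity"
| "ec_neg (Point x y) = Point x (- y)"

definition ec_points :: "'a::field \<Rightarrow> 'a \<Rightarrow> 'a ec_point set" where
  "ec_points a b = insert Infinity {Point x y | x y. y^2 = x * (x + a) * (x + b)}"

lemma Infinity_ec_points [simp]: "Infinity \<in> ec_points a b"
  by (simp add: ec_points_def)

lemma Point_ec_points [simp]: "Point x y \<in> ec_points a b \<longleftrightarrow> y^2 = x * (x + a) * (x + b)"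
  by (auto simp: ec_points_def)

locale legendre_curve =
  fixes a b :: "'a::field"
  assumes two_neq_0: "(2::'a) \<noteq> 0" and a_neq_0: "a \<noteq> 0" and b_neq_0: "b \<noteq> 0"
    and a_neq_b: "a \<noteq> b"
begin

lemma ec_neg_closed: "P \<in> ec_points a b \<Longrightarrow> ec_neg P \<in> ec_points a b"
  by (cases P) auto

lemma double_eq_0_iff: "y + y = 0 \<longleftrightarrow> y = (0::'a)"
  using two_neq_0 by (metis add.right_neutral mult_2 mult_eq_0_iff)

text \<open>
  The chord and the tangent case have the same algebraic content: the line of slope \<open>m\<close> through
  the first point meets the cubic in the abscissae \<open>x1\<close>, \<open>x2\<close>, \<open>x3\<close>, counted with
  multiplicity.  Comparing coefficients with \<open>(X - x1) (X - x2) (X - x3)\<close> gives the three symmetric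
  functions below, from which later arguments work without distinguishing the cases.
\<close>

lemma ec_add_line_cases:
  assumes P: "y1^2 = x1 * (x1 + a) * (x1 + b)" and Q: "y2^2 = x2 * (x2 + a) * (x2 + b)"
    and ne: "\<not> (x1 = x2 \<and> y1 = - y2)"
  obtains m x3 y3 where "ec_add a b (Point x1 y1) (Point x2 y2) = Point x3 y3"
    "x1 + x2 + x3 = m^2 - a - b"
    "x1 * x2 + x1 * x3 + x2 * x3 = a * b - 2 * m * (y1 - m * x1)"
    "x1 * x2 * x3 = (y1 - m * x1)^2"
    "y3 = m * (x1 - x3) - y1" "y2 = y1 + m * (x2 - x1)"
    "x1 \<noteq> x2 \<or> (x1 = x2 \<and> y1 = y2 \<and> y1 \<noteq> 0)"
    "x1 \<noteq> x2 \<Longrightarrow> m * (x2 - x1) = y2 - y1"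
    "x1 = x2 \<Longrightarrow> 2 * y1 * m = 3 * x1^2 + 2 * (a + b) * x1 + a * b"
proof (cases "x1 = x2")
  case True
  have "(y1 - y2) * (y1 + y2) = 0" using P Q True by (simp add: algebra_simps power2_eq_square)
  with ne True have y: "y1 = y2" by (auto simp: eq_neg_iff_add_eq_0)
  with ne True have y0: "y1 \<noteq> 0" by auto
  define m where "m = (3 * x1^2 + 2 * (a + b) * x1 + a * b) / (2 * y1)"
  define x3 where "x3 = m^2 - (a + b) - x1 - x2"
  have m: "2 * y1 * m = 3 * x1^2 + 2 * (a + b) * x1 + a * b"
    using y0 two_neq_0 by (simp add: m_def)
  have e: "ec_add a b (Point x1 y1) (Point x2 y2) = Point x3 (m * (x1 - x3) - y1)"
    using ne True by (simp add: m_def x3_def Let_def)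
  show thesis
  proof (rule that[OF e])
    show "x1 + x2 + x3 = m^2 - a - b" by (simp add: x3_def)
    show "x1 * x2 + x1 * x3 + x2 * x3 = a * b - 2 * m * (y1 - m * x1)"
      using m unfolding x3_def True[symmetric] by algebra
    show "x1 * x2 * x3 = (y1 - m * x1)^2"
      using m P unfolding x3_def True[symmetric] by algebra
  qed (use True y y0 m in auto)
next
  case False
  define m where "m = (y2 - y1) / (x2 - x1)"
  define x3 where "x3 = m^2 - (a + b) - x1 - x2"
  have d: "x2 - x1 \<noteq> 0" using False by simp
  have m: "m * (x2 - x1) = y2 - y1" using d by (simp add: m_def)
  have e: "ec_add a b (Point x1 y1) (Point x2 y2) = Point x3 (m * (x1 - x3) - y1)"
    using False by (simp add: m_def x3_def Let_def)
  have e2: "x1 * x2 + x1 * x3 + x2 * x3 = a * b - 2 * m * (y1 - m * x1)"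
  proof -
    have "(x2 - x1) * (x1 * x2 + x1 * x3 + x2 * x3 - (a * b - 2 * m * (y1 - m * x1))) = 0"
      using m P Q unfolding x3_def by algebra
    with d show ?thesis by simp
  qed
  show thesis
  proof (rule that[OF e _ e2])
    show "x1 + x2 + x3 = m^2 - a - b" by (simp add: x3_def)
    show "x1 * x2 * x3 = (y1 - m * x1)^2"
      using e2 P m unfolding x3_def by algebra
  qed (use False m in auto)
qed

lemma ec_add_closed:
  assumes "P \<in> ec_points a b" "Q \<in> ec_points a b"
  shows "ec_add a b P Q \<in> ec_points a b"
proof (cases P; cases Q)
  fix x1 y1 x2 y2 assume PQ: "P = Point x1 y1" "Q = Point x2 y2"
  show ?thesis
  proof (cases "x1 = x2 \<and> y1 = - y2")
    case False
    from assms PQ have "y1^2 = x1 * (x1 + a) * (x1 + b)" "y2^2 = x2 * (x2 + a) * (x2 + b)" by simp_all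
    from ec_add_line_cases[OF this False] obtain m x3 y3 where *: "ec_add a b P Q = Point x3 y3"
      "x1 + x2 + x3 = m^2 - a - b"
      "x1 * x2 + x1 * x3 + x2 * x3 = a * b - 2 * m * (y1 - m * x1)"
      "x1 * x2 * x3 = (y1 - m * x1)^2"
      "y3 = m * (x1 - x3) - y1"
      unfolding PQ by metis
    have "y3^2 = x3 * (x3 + a) * (x3 + b)"
      unfolding *(5) using *(2-4) by algebra
    with *(1) show ?thesis by simp
  qed (use PQ in simp)
qed (use assms in simp_all)

lemma ec_add_commute:
  assumes "P \<in> ec_points a b" "Q \<in> ec_points a b"
  shows "ec_add a b P Q = ec_add a b Q P"
proof (cases P; cases Q)
  fix x1 y1 x2 y2 assume PQ: "P = Point x1 y1" "Q = Point x2 y2"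
  show ?thesis
  proof (cases "x1 = x2")
    case True
    have "(y1 - y2) * (y1 + y2) = 0" using assms PQ True by (simp add: algebra_simps power2_eq_square)
    then show ?thesis using PQ True by (auto simp: Let_def eq_neg_iff_add_eq_0 add.commute)
  next
    case False
    then have m: "(y2 - y1) / (x2 - x1) = (y1 - y2) / (x1 - x2)"
      by (simp add: divide_simps) (simp add: algebra_simps)
    define m where "m = (y1 - y2) / (x1 - x2)"
    have "m * (x1 - x2) = y1 - y2" using False by (simp add: m_def)
    then have "\<And>z. m * (x1 - z) - y1 = m * (x2 - z) - y2" by (simp add: algebra_simps)
    moreover have "m\<^sup>2 - (a + b) - x1 - x2 = m\<^sup>2 - (a + b) - x2 - x1" by simp
    ultimately show ?thesis using PQ False m
      by (simp only: ec_add.simps Let_def m_def[symmetric] if_False simp_thms eq_commute[of x2 x1])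
  qed
qed simp_all

lemma ec_add_neg: "ec_add a b P (ec_neg P) = Infinity" "ec_add a b (ec_neg P) P = Infinity"
  by (cases P; simp)+

end

section \<open>Associativity through ideal classes of the coordinate ring\<close>

text \<open>
  The function field of the curve is realized inside the formal Laurent series in a local
  parameter \<open>z\<close> at infinity, with \<open>X = z\<^bsup>-2\<^esup>\<close> and \<open>Y = z\<^bsup>-3\<^esup> \<surd>((1 + a z\<^sup>2) (1 + b z\<^sup>2))\<close>.
  In this way ring operations are those of a field, and the pole order at infinity is a degree
  function that is multiplicative by construction.
\<close>

locale legendre_function_field = legendre_curve a b for a b :: "'a::field" +
  fixes Y :: "'a fls"
  assumes Y2: "Y^2 = fls_X_inv^2 * (fls_X_inv^2 + fls_const a) * (fls_X_inv^2 + fls_const b)"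
begin

text \<open>
  \<open>cn\<close> is kept distinct from \<open>fls_const\<close>, whose simplification rules collect constants; the proofs
  below need constants to be distributed over sums and products instead.
\<close>

definition cn :: "'a \<Rightarrow> 'a fls" where "cn c = fls_const c"
definition X :: "'a fls" where "X = fls_X_inv^2"
definition ev :: "'a poly \<Rightarrow> 'a fls" where "ev p = poly (map_poly cn p) X"
definition deg :: "'a fls \<Rightarrow> int" where "deg w = - fls_subdegree w"

lemma cn_add: "cn (c + d) = cn c + cn d"
  and cn_diff: "cn (c - d) = cn c - cn d"
  and cn_mult: "cn (c * d) = cn c * cn d"
  and cn_uminus: "cn (- c) = - cn c"
  and cn_power: "cn (c ^ n) = cn c ^ n"
  by (simp_all add: cn_def fls_plus_const fls_minus_const fls_const_power)

lemma cn_0 [simp]: "cn 0 = 0" and cn_1 [simp]: "cn 1 = 1" and cn_numeral: "cn (numeral k) = numeral k"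
  by (simp_all add: cn_def)

lemmas cn_simps = cn_add cn_diff cn_mult cn_uminus cn_power cn_0 cn_1 cn_numeral

lemma cn_eq_0_iff [simp]: "cn c = 0 \<longleftrightarrow> c = 0" by (simp add: cn_def)

lemma cn_inverse: "c \<noteq> 0 \<Longrightarrow> cn (inverse c) * cn c = 1"
  by (simp flip: cn_mult add: cn_1)

lemma Y_squared: "Y^2 = X * (X + cn a) * (X + cn b)" using Y2 by (simp add: X_def cn_def)

lemma deg_mult: "v \<noteq> 0 \<Longrightarrow> w \<noteq> 0 \<Longrightarrow> deg (v * w) = deg v + deg w" by (simp add: deg_def)

lemma deg_add: "v \<noteq> 0 \<Longrightarrow> deg w < deg v \<Longrightarrow> deg (v + w) = deg v \<and> v + w \<noteq> 0"
  unfolding deg_def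
  by (metis add.right_neutral add_eq_0_iff fls_subdegree_add_eq1 fls_uminus_subdegree neg_less_iff_less order_less_irrefl)

lemma deg_X: "X \<noteq> 0" "deg X = 2"
  by (simp_all add: X_def deg_def)

lemma deg_cn: "deg (cn c) = 0" by (simp add: deg_def cn_def)

lemma deg_X_cn: "X + cn c \<noteq> 0" "deg (X + cn c) = 2" 
  using deg_add[of X "cn c"] deg_X deg_cn[of c] by auto

lemma deg_X_minus_cn: "X - cn c \<noteq> 0" "deg (X - cn c) = 2" 
  using deg_X_cn[of "-c"] by (auto simp: cn_uminus)

lemma deg_Y: "Y \<noteq> 0" "deg Y = 3"
proof -
  have "Y^2 \<noteq> 0" by (simp add: Y_squared deg_X deg_X_cn)
  then show Y: "Y \<noteq> 0" by auto
  have "deg (Y * Y) = 6" using Y_squared by (simp add: power2_eq_square deg_mult deg_X deg_X_cn)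
  then show "deg Y = 3" using Y by (simp add: deg_mult)
qed

lemma ev_pCons [simp]: "ev (pCons c p) = cn c + X * ev p"
  by (cases "p = 0 \<and> c = 0") (auto simp: ev_def map_poly_pCons)

lemma ev_0 [simp]: "ev 0 = 0" by (simp add: ev_def)
lemma ev_1 [simp]: "ev 1 = 1" by (simp add: one_pCons del: One_nat_def)

lemma ev_add [simp]: "ev (p + q) = ev p + ev q"
proof (induction p arbitrary: q)
  case (pCons c p)
  then show ?case by (cases q) (simp add: algebra_simps cn_simps)
qed simp

lemma ev_smult [simp]: "ev (smult c p) = cn c * ev p"
  by (induction p) (simp_all add: algebra_simps cn_mult)

lemma ev_minus [simp]: "ev (- p) = - ev p"
  using ev_smult[of "-1" p] by (simp add: cn_simps)

lemma ev_diff [simp]: "ev (p - q) = ev p - ev q"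
  using ev_add[of p "- q"] by simp

lemma ev_mult [simp]: "ev (p * q) = ev p * ev q"
  by (induction p) (simp_all add: algebra_simps)

lemma deg_ev: "p \<noteq> 0 \<Longrightarrow> ev p \<noteq> 0 \<and> deg (ev p) = 2 * int (degree p)"
proof (induction p)
  case (pCons c p)
  show ?case
  proof (cases "p = 0")
    case True then show ?thesis using pCons.hyps by (auto simp: deg_cn)
  next
    case False
    then have "X * ev p \<noteq> 0" "deg (X * ev p) = 2 + 2 * int (degree p)"
      using pCons.IH deg_X by (auto simp: deg_mult)
    then show ?thesis using deg_add[of "X * ev p" "cn c"] False by (auto simp: deg_cn add.commute)
  qed
qed simp

definition coord_ring :: "'a fls set" where "coord_ring = {ev p + ev q * Y | p q. True}"

text \<open>
  The degrees \<open>2 deg p\<close> and \<open>3 + 2 deg q\<close> have different parity, so the leading terms of the two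
  summands cannot cancel.  In particular no function has degree 1, which reflects that the curve is
  not rational.
\<close>

lemma deg_coord_ring:
  assumes "(p, q) \<noteq> (0, 0)"
  shows "ev p + ev q * Y \<noteq> 0" 
    "deg (ev p + ev q * Y) = (if q = 0 then 2 * int (degree p)
       else if p = 0 then 3 + 2 * int (degree q) else max (2 * int (degree p)) (3 + 2 * int (degree q)))"
proof -
  have q: "q \<noteq> 0 \<Longrightarrow> ev q * Y \<noteq> 0 \<and> deg (ev q * Y) = 3 + 2 * int (degree q)"
    using deg_ev[of q] deg_Y by (simp add: deg_mult)
  have "ev p + ev q * Y \<noteq> 0 \<and> 
    deg (ev p + ev q * Y) = (if q = 0 then 2 * int (degree p)
       else if p = 0 then 3 + 2 * int (degree q) else max (2 * int (degree p)) (3 + 2 * int (degree q)))"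
  proof (cases "q = 0 \<or> p = 0")
    case True then show ?thesis using assms q deg_ev[of p] by auto
  next
    case False
    have "2 * int (degree p) < 3 + 2 * int (degree q) \<or> 3 + 2 * int (degree q) < 2 * int (degree p)" by presburger
    then show ?thesis using False q deg_ev[of p] deg_add[of "ev p" "ev q * Y"] deg_add[of "ev q * Y" "ev p"]
      by (elim disjE) (auto simp: add.commute max_def)
  qed
  then show "ev p + ev q * Y \<noteq> 0" 
    "deg (ev p + ev q * Y) = (if q = 0 then 2 * int (degree p)
       else if p = 0 then 3 + 2 * int (degree q) else max (2 * int (degree p)) (3 + 2 * int (degree q)))"
    by auto
qed

lemma coord_ring_unique: "ev p + ev q * Y = ev p' + ev q' * Y \<Longrightarrow> p = p' \<and> q = q'"
  using deg_coord_ring(1)[of "p - p'" "q - q'"] by (auto simp: algebra_simps)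

definition is_module :: "'a fls set \<Rightarrow> bool" where
  "is_module M \<longleftrightarrow> 0 \<in> M \<and> (\<forall>m\<in>M. \<forall>n\<in>M. m + n \<in> M) \<and> (\<forall>r\<in>coord_ring. \<forall>m\<in>M. r * m \<in> M)"

lemma coord_ring_intros: "cn c \<in> coord_ring" "X \<in> coord_ring" "Y \<in> coord_ring" "0 \<in> coord_ring" "1 \<in> coord_ring"
proof -
  show "cn c \<in> coord_ring" unfolding coord_ring_def by (rule CollectI, rule exI[of _ "[:c:]"], rule exI[of _ 0]) simp
  show "X \<in> coord_ring" unfolding coord_ring_def by (rule CollectI, rule exI[of _ "[:0,1:]"], rule exI[of _ 0]) simp
  show "Y \<in> coord_ring" unfolding coord_ring_def by (rule CollectI, rule exI[of _ 0], rule exI[of _ 1]) simp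
  show "0 \<in> coord_ring" unfolding coord_ring_def by (rule CollectI, rule exI[of _ 0], rule exI[of _ 0]) simp
  show "1 \<in> coord_ring" unfolding coord_ring_def by (rule CollectI, rule exI[of _ 1], rule exI[of _ 0]) simp
qed

lemma coord_ring_add: "v \<in> coord_ring \<Longrightarrow> w \<in> coord_ring \<Longrightarrow> v + w \<in> coord_ring"
proof -
  assume "v \<in> coord_ring" "w \<in> coord_ring"
  then obtain p q p' q' where "v = ev p + ev q * Y" "w = ev p' + ev q' * Y" by (auto simp: coord_ring_def)
  then have "v + w = ev (p + p') + ev (q + q') * Y" by (simp add: algebra_simps)
  then show ?thesis unfolding coord_ring_def by blast
qed

lemma coord_ring_mult: "v \<in> coord_ring \<Longrightarrow> w \<in> coord_ring \<Longrightarrow> v * w \<in> coord_ring"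
proof -
  assume "v \<in> coord_ring" "w \<in> coord_ring"
  then obtain p q p' q' where vw: "v = ev p + ev q * Y" "w = ev p' + ev q' * Y" by (auto simp: coord_ring_def)
  have "v * w = ev (p * p' + q * q' * ([:0,1:] * [:a,1:] * [:b,1:])) + ev (p * q' + q * p') * Y"
    using Y_squared unfolding vw ev_add ev_mult ev_pCons cn_simps ev_0 by algebra
  then show ?thesis unfolding coord_ring_def by blast
qed

lemma coord_ring_minus: "v \<in> coord_ring \<Longrightarrow> - v \<in> coord_ring"
  using coord_ring_mult[OF coord_ring_intros(1)[of "-1"], of v] by (simp add: cn_simps)

lemma coord_ring_diff: "v \<in> coord_ring \<Longrightarrow> w \<in> coord_ring \<Longrightarrow> v - w \<in> coord_ring"
  using coord_ring_add[of v "- w"] coord_ring_minus[of w] by simp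

lemma is_module_coord_ring: "is_module coord_ring"
  unfolding is_module_def using coord_ring_intros coord_ring_add coord_ring_mult by auto

lemma is_module_add: "is_module M \<Longrightarrow> m \<in> M \<Longrightarrow> n \<in> M \<Longrightarrow> m + n \<in> M" by (simp add: is_module_def)
lemma is_module_smult: "is_module M \<Longrightarrow> r \<in> coord_ring \<Longrightarrow> m \<in> M \<Longrightarrow> r * m \<in> M" by (simp add: is_module_def)
lemma is_module_0: "is_module M \<Longrightarrow> 0 \<in> M" by (simp add: is_module_def)
lemma is_module_diff: "is_module M \<Longrightarrow> m \<in> M \<Longrightarrow> n \<in> M \<Longrightarrow> m - n \<in> M"
  using is_module_add[of M m "-1 * n"] is_module_smult[of M "-1" n] coord_ring_minus[OF coord_ring_intros(5)] by simp

text \<open>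
  The product of a module with the maximal ideal \<open>(X - x, Y - y)\<close> of a point; the point at
  infinity corresponds to the unit ideal.
\<close>

fun ideal_times :: "'a ec_point \<Rightarrow> 'a fls set \<Rightarrow> 'a fls set" where
  "ideal_times Infinity M = M"
| "ideal_times (Point x y) M = {(X - cn x) * m + (Y - cn y) * n | m n. m \<in> M \<and> n \<in> M}"

lemma is_module_ideal_times: assumes M: "is_module M" shows "is_module (ideal_times P M)"
proof (cases P)
  case (Point x y)
  show ?thesis unfolding is_module_def
  proof (intro conjI ballI)
    show "0 \<in> ideal_times P M" unfolding Point using is_module_0[OF M] by (auto intro!: exI[of _ 0])
    fix v w assume "v \<in> ideal_times P M" "w \<in> ideal_times P M"
    then obtain m n m' n' where *: "v = (X - cn x) * m + (Y - cn y) * n" "w = (X - cn x) * m' + (Y - cn y) * n'"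
       "m \<in> M" "n \<in> M" "m' \<in> M" "n' \<in> M" unfolding Point by auto
    have "v + w = (X - cn x) * (m + m') + (Y - cn y) * (n + n')" by (simp add: * algebra_simps)
    moreover have "m + m' \<in> M" "n + n' \<in> M" using * M by (auto intro: is_module_add)
    ultimately show "v + w \<in> ideal_times P M" unfolding Point by auto
  next
    fix r v assume r: "r \<in> coord_ring" and "v \<in> ideal_times P M"
    then obtain m n where *: "v = (X - cn x) * m + (Y - cn y) * n"
       "m \<in> M" "n \<in> M" unfolding Point by auto
    have "r * v = (X - cn x) * (r * m) + (Y - cn y) * (r * n)" by (simp add: * algebra_simps)
    moreover have "r * m \<in> M" "r * n \<in> M" using * M r by (auto intro: is_module_smult)
    ultimately show "r * v \<in> ideal_times P M" unfolding Point by auto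
  qed
qed (use M in simp)

lemma ideal_times_scale: "ideal_times P ((*) r ` M) = (*) r ` ideal_times P M"
proof (cases P)
  case (Point x y)
  show ?thesis
  proof (intro equalityI subsetI)
    fix w assume "w \<in> ideal_times P ((*) r ` M)"
    then obtain m n where *: "w = (X - cn x) * (r * m) + (Y - cn y) * (r * n)" "m \<in> M" "n \<in> M" unfolding Point by auto
    then have "w = r * ((X - cn x) * m + (Y - cn y) * n)" by (simp add: algebra_simps)
    moreover have "(X - cn x) * m + (Y - cn y) * n \<in> ideal_times P M" using * unfolding Point by auto
    ultimately show "w \<in> (*) r ` ideal_times P M" by blast
  next
    fix w assume "w \<in> (*) r ` ideal_times P M"
    then obtain m n where *: "w = r * ((X - cn x) * m + (Y - cn y) * n)" "m \<in> M" "n \<in> M" unfolding Point by auto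
    then have "w = (X - cn x) * (r * m) + (Y - cn y) * (r * n)" by (simp add: algebra_simps)
    with *(2,3) show "w \<in> ideal_times P ((*) r ` M)" unfolding Point ideal_times.simps by blast
  qed
qed simp

text \<open>
  The degree of the ideal of a point.
\<close>

definition \<delta> :: "'a ec_point \<Rightarrow> int" where "\<delta> P = (if P = Infinity then 0 else 1)"

text \<open>
  The ideals of \<open>P\<close> and \<open>- P\<close> multiply to the principal ideal \<open>(X - x)\<close>.  That \<open>X - x\<close> lies in the
  product uses that the curve is smooth: either \<open>2 y\<close> or the derivative of the cubic is invertible.
\<close>

lemma ideal_times_neg:
  assumes M: "is_module M" and P: "y^2 = x * (x + a) * (x + b)"
  shows "ideal_times (Point x y) (ideal_times (Point x (- y)) M) = (*) (X - cn x) ` M" (is "?L = ?R")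
proof -
  define c where "c = X^2 + (cn x + cn a + cn b) * X + cn x^2 + (cn a + cn b) * cn x + cn a * cn b"
  have y: "cn y ^2 = cn x * (cn x + cn a) * (cn x + cn b)"
    using arg_cong[OF P, of cn] by (simp only: cn_simps)
  have Yc: "Y^2 - cn y^2 = (X - cn x) * c" unfolding y c_def Y_squared by algebra
  have cA: "c \<in> coord_ring" unfolding c_def power2_eq_square by (intro coord_ring_add coord_ring_mult coord_ring_intros)
  show ?thesis
  proof (intro equalityI subsetI)
    fix w assume "w \<in> ?L"
    then obtain m1 m2 m3 m4 where *: "m1 \<in> M" "m2 \<in> M" "m3 \<in> M" "m4 \<in> M"
      and w: "w = (X - cn x) * ((X - cn x) * m1 + (Y - cn (- y)) * m2) + (Y - cn y) * ((X - cn x) * m3 + (Y - cn (-y)) * m4)"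
      by auto
    have "w = (X - cn x) * ((X - cn x) * m1 + (Y + cn y) * m2 + (Y - cn y) * m3 + c * m4)"
      unfolding w using Yc unfolding cn_simps by algebra
    moreover have "(X - cn x) * m1 + (Y + cn y) * m2 + (Y - cn y) * m3 + c * m4 \<in> M"
      using * M cA by (intro is_module_add is_module_smult coord_ring_add coord_ring_diff coord_ring_intros)
    ultimately show "w \<in> ?R" by auto
  next
    fix w assume "w \<in> ?R"
    then obtain m where m: "m \<in> M" and w: "w = (X - cn x) * m" by auto
    show "w \<in> ?L"
    proof (cases "y = 0")
      case False
      then have "2 * y \<noteq> 0" using two_neq_0 by simp
      then have i: "cn (inverse (2*y)) * (2 * cn y) = 1" using cn_inverse[of "2*y"] by (simp add: cn_simps)
      define n where "n = cn (inverse (2*y)) * m"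
      have n: "n \<in> M" unfolding n_def using M m by (intro is_module_smult coord_ring_intros)
      have "w = (X - cn x) * ((X - cn x) * 0 + (Y - cn (- y)) * n) + (Y - cn y) * ((X - cn x) * ((-1) * n) + (Y - cn (-y)) * 0)"
        unfolding w n_def cn_simps using i by algebra
      moreover have "(-1) * n \<in> M" using n M coord_ring_minus[OF coord_ring_intros(5)] by (intro is_module_smult) auto
      ultimately show ?thesis using n is_module_0[OF M] unfolding ideal_times.simps by blast
    next
      case True
      define f' where "f' = 3 * x^2 + 2 * (a+b) * x + a * b"
      have f': "f' \<noteq> 0"
      proof
        assume f0: "f' = 0"
        have "x = 0 \<or> x = -a \<or> x = -b" using P True by (auto simp: eq_neg_iff_add_eq_0)
        then show False using f0 a_neq_0 b_neq_0 a_neq_b unfolding f'_def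
        proof (elim disjE)
          assume x: "x = -a"
          have "a * (a - b) = 0" using f0 unfolding f'_def x by algebra
          then show False using a_neq_0 a_neq_b by simp
        next
          assume x: "x = -b"
          have "b * (b - a) = 0" using f0 unfolding f'_def x by algebra
          then show False using b_neq_0 a_neq_b by simp
        qed auto
      qed
      have Yc': "Y^2 = (X - cn x) * c" using Yc True by simp
      define e where "e = X + 2 * cn x + cn a + cn b"
      have eA: "e \<in> coord_ring" unfolding e_def mult_2 by (intro coord_ring_add coord_ring_mult coord_ring_intros)
      have i: "cn (inverse f') * (3 * cn x^2 + 2 * (cn a + cn b) * cn x + cn a * cn b) = 1"
      proof -
        have "cn (inverse f') * cn f' = 1" using cn_inverse f' by simp
        then show ?thesis by (subst (asm) (2) f'_def) (simp only: cn_simps)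
      qed
      have c: "c = (3 * cn x^2 + 2 * (cn a + cn b) * cn x + cn a * cn b) + (X - cn x) * e"
        unfolding c_def e_def by algebra
      define n where "n = cn (inverse f') * m"
      have n: "n \<in> M" unfolding n_def using M m by (intro is_module_smult coord_ring_intros)
      have "w = (X - cn x) * ((X - cn x) * (- e * n) + (Y - cn (- y)) * 0) + (Y - cn y) * ((X - cn x) * 0 + (Y - cn (-y)) * n)"
        using i Yc' c unfolding w n_def True cn_0 minus_zero diff_0_right mult_zero_right add_0_left add_0_right by algebra
      moreover have "- e * n \<in> M" using n M coord_ring_minus[OF eA] by (intro is_module_smult) auto
      ultimately show ?thesis using n is_module_0[OF M] unfolding ideal_times.simps by blast
    qed
  qed
qed

text \<open>
  If \<open>l\<close> is the line through \<open>P\<close> and \<open>Q\<close> and \<open>v\<close> the vertical line through \<open>R = P + Q\<close>, then the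
  ideals satisfy \<open>v I\<^sub>P I\<^sub>Q = l I\<^sub>R\<close>.  The source of all the identities is
  \<open>v (X - x1) (X - x2) = l (Y + L)\<close>, where \<open>l = Y - L\<close>, which expresses that the norm of \<open>l\<close> is the
  product over the three intersection points.
\<close>

lemma ideal_times_line:
  assumes M: "is_module M"
    and e1: "x1 + x2 + x3 = m^2 - a - b"
    and e2: "x1 * x2 + x1 * x3 + x2 * x3 = a * b - 2 * m * (y1 - m * x1)"
    and e3: "x1 * x2 * x3 = (y1 - m * x1)^2"
    and y3: "y3 = m * (x1 - x3) - y1" and y2: "y2 = y1 + m * (x2 - x1)"
    and ne: "x1 \<noteq> x2 \<or> (x1 = x2 \<and> y1 = y2 \<and> y1 \<noteq> 0)"
  shows "(*) (X - cn x3) ` ideal_times (Point x1 y1) (ideal_times (Point x2 y2) M) = (*) (Y - cn y1 - cn m * (X - cn x1)) ` ideal_times (Point x3 y3) M"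
    (is "?L = ?R")
proof -
  note cs = cn_simps
  define l where "l = Y - cn y1 - cn m * (X - cn x1)"
  define v where "v = X - cn x3"
  define \<mu> where "\<mu> = cn m"
  have \<mu>coord_ring: "\<mu> \<in> coord_ring" by (simp add: \<mu>_def coord_ring_intros)
  have f1: "cn x1 + cn x2 + cn x3 = \<mu>^2 - cn a - cn b" using arg_cong[OF e1, of cn] by (simp only: cn_simps \<mu>_def)
  have f2: "cn x1 * cn x2 + cn x1 * cn x3 + cn x2 * cn x3 = cn a * cn b - 2 * \<mu> * (cn y1 - \<mu> * cn x1)"
    using arg_cong[OF e2, of cn] by (simp only: cn_simps \<mu>_def)
  have f3: "cn x1 * cn x2 * cn x3 = (cn y1 - \<mu> * cn x1)^2" using arg_cong[OF e3, of cn] by (simp only: cn_simps \<mu>_def)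
  have Y2: "cn y2 = cn y1 + \<mu> * (cn x2 - cn x1)" using arg_cong[OF y2, of cn] by (simp only: cn_simps \<mu>_def)
  have Y3: "cn y3 = \<mu> * (cn x1 - cn x3) - cn y1" using arg_cong[OF y3, of cn] by (simp only: cn_simps \<mu>_def)
  have Yl: "Y = l + cn y1 + \<mu> * (X - cn x1)" by (simp add: l_def \<mu>_def)
  have ll: "l = Y - cn y1 - \<mu> * (X - cn x1)" by (simp add: l_def \<mu>_def)
  have N: "v * ((X - cn x1) * (X - cn x2)) = l * ((Y - cn y3) + \<mu> * v)"
    unfolding v_def ll Y3 using f1 f2 f3 Y_squared by algebra
  have lA: "l \<in> coord_ring" unfolding ll using \<mu>coord_ring by (intro coord_ring_diff coord_ring_mult coord_ring_intros)
  have vA: "v \<in> coord_ring" unfolding v_def by (intro coord_ring_diff coord_ring_mult coord_ring_intros)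
  have "?L \<subseteq> ?R"
  proof
    fix w assume "w \<in> ?L"
    then obtain m1 m2 m3 m4 where *: "m1 \<in> M" "m2 \<in> M" "m3 \<in> M" "m4 \<in> M"
      and w: "w = v * ((X - cn x1) * ((X - cn x2) * m1 + (Y - cn y2) * m2) + (Y - cn y1) * ((X - cn x2) * m3 + (Y - cn y2) * m4))"
      by (auto simp: v_def)
    \<comment> \<open>The coefficients come from \<open>Y - y1 = l + \<mu> (X - x1)\<close>, \<open>Y - y2 = l + \<mu> (X - x2)\<close> and \<open>N\<close>.\<close>
    define n where "n = m1 + \<mu> * m2 + \<mu> * m3 + \<mu> * (\<mu> * m4)"
    define k where "k = \<mu> * n + (X - cn x1) * m2 + (X - cn x2) * m3 + (l + \<mu> * (X - cn x1) + \<mu> * (X - cn x2)) * m4"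
    have n: "n \<in> M" unfolding n_def using * M \<mu>coord_ring by (intro is_module_add is_module_smult) auto
    have k: "k \<in> M" unfolding k_def using * n M \<mu>coord_ring lA
      by (intro is_module_add is_module_smult coord_ring_add coord_ring_diff coord_ring_mult coord_ring_intros) auto
    have a1: "Y - cn y2 = l + \<mu> * (X - cn x2)" "Y - cn y1 = l + \<mu> * (X - cn x1)"
      unfolding ll Y2 by (simp_all add: algebra_simps)
    have "w = l * (v * k + (Y - cn y3) * n)"
      unfolding w a1 k_def n_def using N by algebra
    then show "w \<in> ?R" using n k by (auto simp: l_def v_def)
  qed
  moreover have "?R \<subseteq> ?L"
  proof
    \<comment> \<open>The line itself lies in \<open>I\<^sub>P I\<^sub>Q\<close>; this is where the slope must be that of the chord or tangent.\<close>
    have "\<exists>\<alpha>\<in>coord_ring. \<exists>\<beta>\<in>coord_ring. \<exists>\<gamma>\<in>coord_ring. l = (X - cn x1) * ((X - cn x2) * \<alpha> + (Y - cn y2) * \<beta>) + (Y - cn y1) * ((X - cn x2) * (-\<beta>) + (Y - cn y2) * \<gamma>)"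
    proof (cases "x1 = x2")
      case False
      then have "cn (inverse (x2 - x1)) * cn (x2 - x1) = 1" using cn_inverse[of "x2 - x1"] by simp
      then have i: "cn (inverse (x2 - x1)) * (cn x2 - cn x1) = 1" by (simp only: cn_diff)
      have "l = (X - cn x1) * ((X - cn x2) * 0 + (Y - cn y2) * cn (inverse (x2 - x1))) + (Y - cn y1) * ((X - cn x2) * (-cn (inverse (x2 - x1))) + (Y - cn y2) * 0)"
        unfolding ll using i Y2 by algebra
      then show ?thesis using coord_ring_intros by blast
    next
      case True
      then have y: "y1 = y2" "2 * y1 \<noteq> 0" using ne two_neq_0 by auto
      have i: "cn (inverse (2*y1)) * (2 * cn y1) = 1" using cn_inverse[OF y(2)] by (simp only: cn_simps)
      define \<alpha> where "\<alpha> = cn (inverse (2*y1)) * (\<mu> * \<mu> + v)"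
      define \<gamma> where "\<gamma> = - cn (inverse (2*y1))"
      have "\<alpha> \<in> coord_ring" "\<gamma> \<in> coord_ring" unfolding \<alpha>_def \<gamma>_def
        using \<mu>coord_ring vA by (auto intro!: coord_ring_add coord_ring_mult coord_ring_intros coord_ring_minus)
      moreover have "(Y - cn y1)^2 = - (2 * cn y1) * l + (X - cn x1)^2 * (\<mu> * \<mu> + v)"
        unfolding ll using N[unfolded ll Y3] f1 unfolding v_def True[symmetric] y(1)[symmetric] by algebra
      then have "l = (X - cn x1) * ((X - cn x2) * \<alpha> + (Y - cn y2) * 0) + (Y - cn y1) * ((X - cn x2) * (-0) + (Y - cn y2) * \<gamma>)"
        unfolding \<alpha>_def \<gamma>_def True[symmetric] y(1)[symmetric] using i by algebra
      ultimately show ?thesis using coord_ring_intros by blast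
    qed
    then obtain \<alpha> \<beta> \<gamma> where abc: "\<alpha> \<in> coord_ring" "\<beta> \<in> coord_ring" "\<gamma> \<in> coord_ring"
      and l: "l = (X - cn x1) * ((X - cn x2) * \<alpha> + (Y - cn y2) * \<beta>) + (Y - cn y1) * ((X - cn x2) * (-\<beta>) + (Y - cn y2) * \<gamma>)"
      by blast
    fix w assume "w \<in> ?R"
    then obtain k n where kn: "k \<in> M" "n \<in> M" and w: "w = l * (v * k + (Y - cn y3) * n)"
      by (auto simp: l_def v_def)
    define r where "r = k - \<mu> * n"
    have r: "r \<in> M" unfolding r_def using kn M \<mu>coord_ring by (intro is_module_diff is_module_smult)
    have "w = v * (l * r + (X - cn x1) * ((X - cn x2) * n))"
      unfolding w r_def using N by algebra
    also have "\<dots> = v * ((X - cn x1) * ((X - cn x2) * (\<alpha> * r + n) + (Y - cn y2) * (\<beta> * r)) + (Y - cn y1) * ((X - cn x2) * (-\<beta> * r) + (Y - cn y2) * (\<gamma> * r)))"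
      by (subst l) algebra
    finally have "w = v * ((X - cn x1) * ((X - cn x2) * (\<alpha> * r + n) + (Y - cn y2) * (\<beta> * r)) + (Y - cn y1) * ((X - cn x2) * (-\<beta> * r) + (Y - cn y2) * (\<gamma> * r)))" .
    moreover have "\<alpha> * r + n \<in> M" "\<beta> * r \<in> M" "-\<beta> * r \<in> M" "\<gamma> * r \<in> M"
      using abc r M kn coord_ring_minus by (auto intro!: is_module_add is_module_smult simp del: mult_minus_left)
    ultimately show "w \<in> ?L" unfolding v_def ideal_times.simps by blast
  qed
  ultimately show ?thesis by blast
qed

lemma ideal_times_add:
  assumes P: "P \<in> ec_points a b" and Q: "Q \<in> ec_points a b"
  obtains v l where "v \<noteq> 0" "l \<noteq> 0"
    "\<And>M. is_module M \<Longrightarrow> (*) v ` ideal_times P (ideal_times Q M) = (*) l ` ideal_times (ec_add a b P Q) M"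
    "deg v + \<delta> P + \<delta> Q = deg l + \<delta> (ec_add a b P Q)"
proof (cases "P = Infinity \<or> Q = Infinity")
  case True
  then show ?thesis by (cases P; intro that[of 1 1]) (auto simp: \<delta>_def coord_ring_intros)
next
  case False
  then obtain x1 y1 x2 y2 where PQ: "P = Point x1 y1" "Q = Point x2 y2" by (cases P; cases Q) auto
  show ?thesis
  proof (cases "x1 = x2 \<and> y1 = - y2")
    case True
    show ?thesis
    proof (rule that[of 1 "X - cn x1"])
      show "(*) 1 ` ideal_times P (ideal_times Q M) = (*) (X - cn x1) ` ideal_times (ec_add a b P Q) M" if "is_module M" for M
        using ideal_times_neg[OF that, of y1 x1] PQ True P by simp
    qed (use True PQ deg_X_minus_cn in \<open>auto simp: \<delta>_def deg_def coord_ring_intros coord_ring_diff\<close>)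
  next
    case ne: False
    from P Q PQ have "y1^2 = x1 * (x1 + a) * (x1 + b)" "y2^2 = x2 * (x2 + a) * (x2 + b)" by simp_all
    from ec_add_line_cases[OF this ne] obtain m x3 y3 where *: "ec_add a b P Q = Point x3 y3"
      "x1 + x2 + x3 = m^2 - a - b"
      "x1 * x2 + x1 * x3 + x2 * x3 = a * b - 2 * m * (y1 - m * x1)"
      "x1 * x2 * x3 = (y1 - m * x1)^2"
      "y3 = m * (x1 - x3) - y1" "y2 = y1 + m * (x2 - x1)"
      "x1 \<noteq> x2 \<or> (x1 = x2 \<and> y1 = y2 \<and> y1 \<noteq> 0)"
      unfolding PQ by metis
    define l where "l = Y - cn y1 - cn m * (X - cn x1)"
    have l': "l = ev [:m * x1 - y1, - m:] + ev 1 * Y"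
      by (simp add: l_def algebra_simps cn_simps)
    have l: "l \<noteq> 0" "deg l = 3" unfolding l' using deg_coord_ring[of "[:m * x1 - y1, - m:]" 1] by auto
    show ?thesis
    proof (rule that[of "X - cn x3" l])
      show "(*) (X - cn x3) ` ideal_times P (ideal_times Q M) = (*) l ` ideal_times (ec_add a b P Q) M" if "is_module M" for M
        using ideal_times_line[OF that *(2-7)] *(1) PQ unfolding l_def by simp
    qed (use l PQ * deg_X_minus_cn in \<open>auto simp: \<delta>_def coord_ring_intros coord_ring_diff\<close>)
  qed
qed

text \<open>
  Evaluation at the point vanishes on its ideal.
\<close>

lemma ideal_times_eval:
  assumes P: "y^2 = x * (x + a) * (x + b)" and w: "ev p + ev q * Y \<in> ideal_times (Point x y) coord_ring"
  shows "poly p x + poly q x * y = 0"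
proof -
  obtain p1 q1 p2 q2 where w: "ev p + ev q * Y = (X - cn x) * (ev p1 + ev q1 * Y) + (Y - cn y) * (ev p2 + ev q2 * Y)"
    using w by (auto simp: coord_ring_def)
  have "\<dots> = ev ([:-x,1:] * p1 + q2 * ([:0,1:] * [:a,1:] * [:b,1:]) - [:y:] * p2) + ev ([:-x,1:] * q1 + p2 - [:y:] * q2) * Y"
    using Y_squared unfolding ev_add ev_diff ev_mult ev_pCons cn_simps ev_0 by algebra
  with w have "p = [:-x,1:] * p1 + q2 * ([:0,1:] * [:a,1:] * [:b,1:]) - [:y:] * p2" "q = [:-x,1:] * q1 + p2 - [:y:] * q2"
    using coord_ring_unique by metis+
  then have pq: "poly p x = poly ([:-x,1:] * p1 + q2 * ([:0,1:] * [:a,1:] * [:b,1:]) - [:y:] * p2) x"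
    "poly q x = poly ([:-x,1:] * q1 + p2 - [:y:] * q2) x" 
    by blast+
  have pq: "poly p x = poly q2 x * (x * (x + a) * (x + b)) - y * poly p2 x" "poly q x = poly p2 x - y * poly q2 x" 
    unfolding pq by (simp_all add: algebra_simps)
  show ?thesis unfolding pq P[symmetric] by algebra
qed

lemma ideal_times_subset: "ideal_times P coord_ring \<subseteq> coord_ring"
  by (cases P) (auto intro!: coord_ring_add coord_ring_mult coord_ring_diff coord_ring_intros)

text \<open>
  Injectivity of the map from points to ideal classes.  If \<open>g I\<^sub>S = h I\<^sub>T\<close> with matching degrees,
  then \<open>h (X - x2) = g m\<close> for a function \<open>m\<close> in \<open>I\<^sub>S\<close> of degree 2.  Such a function is linear in \<open>X\<close>, hence
  a multiple of \<open>X - x1\<close>, and comparing with \<open>h (Y - y2)\<close> yields \<open>S = T\<close>.  If only one of the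
  points were at infinity, there would be a function of degree 1.
\<close>

lemma ideal_times_unique:
  assumes gh: "g \<noteq> 0" "h \<noteq> 0" and S: "S \<in> ec_points a b" and T: "T \<in> ec_points a b"
    and eq: "(*) g ` ideal_times S coord_ring = (*) h ` ideal_times T coord_ring" and d: "deg g + \<delta> S = deg h + \<delta> T"
  shows "S = T"
proof -
  have no: False if "(*) g ` coord_ring = (*) h ` ideal_times (Point x y) coord_ring" "deg g = deg h + 1" "g \<noteq> 0" "h \<noteq> 0" for g h x y
  proof -
    have "g * 1 \<in> (*) h ` ideal_times (Point x y) coord_ring" using that(1) coord_ring_intros by blast
    then obtain m where m: "g = h * m" "m \<in> coord_ring" using ideal_times_subset[of "Point x y"] by auto
    then have "m \<noteq> 0" using that by auto
    with m that have "deg m = 1" by (simp add: deg_mult)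
    moreover obtain p q where "m = ev p + ev q * Y" using m by (auto simp: coord_ring_def)
    ultimately show False using deg_coord_ring(2)[of p q] \<open>m \<noteq> 0\<close> by (cases "p = 0"; cases "q = 0") (auto, presburger?)
  qed
  show ?thesis
  proof (cases S; cases T)
    fix x y assume "S = Infinity" "T = Point x y"
    then show ?thesis using no[of g h x y] eq d gh by (auto simp: \<delta>_def)
  next
    fix x y assume "T = Infinity" "S = Point x y"
    then show ?thesis using no[of h g x y] eq d gh by (auto simp: \<delta>_def)
  next
    fix x1 y1 x2 y2 assume ST: "S = Point x1 y1" "T = Point x2 y2"
    have "(X - cn x2) * 1 + (Y - cn y2) * 0 \<in> ideal_times T coord_ring" unfolding ST using coord_ring_intros by force
    then have "h * (X - cn x2) \<in> (*) g ` ideal_times S coord_ring" unfolding eq by auto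
    then obtain m where m: "h * (X - cn x2) = g * m" "m \<in> ideal_times S coord_ring" by auto
    have "(X - cn x2) * 0 + (Y - cn y2) * 1 \<in> ideal_times T coord_ring" unfolding ST using coord_ring_intros by force
    then have "h * (Y - cn y2) \<in> (*) g ` ideal_times S coord_ring" unfolding eq by auto
    then obtain n where n: "h * (Y - cn y2) = g * n" "n \<in> ideal_times S coord_ring" by auto
    have m0: "m \<noteq> 0" using m gh deg_X_minus_cn by auto
    have "deg m = 2" using arg_cong[OF m(1), of deg] gh m0 d deg_X_minus_cn ST by (simp add: deg_mult \<delta>_def)
    moreover obtain p q where pq: "m = ev p + ev q * Y" using m ideal_times_subset[of S] by (auto simp: coord_ring_def)
    ultimately have "q = 0" "degree p = 1" using deg_coord_ring(2)[of p q] m0 by (cases "p = 0"; cases "q = 0"; auto)+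
    obtain c0 p0 where p0: "p = pCons c0 p0" by (cases p)
    with \<open>degree p = 1\<close> have "p0 \<noteq> 0" "degree p0 = 0" by (auto split: if_splits)
    then obtain c1 where "p = [:c0, c1:]" "c1 \<noteq> 0" using p0 by (auto elim: degree_eq_zeroE)
    moreover have "poly p x1 + poly q x1 * y1 = 0" using ideal_times_eval[of y1 x1 p q] S ST m pq by auto
    ultimately have p: "p = [:- c1 * x1, c1:]" using \<open>q = 0\<close> by (auto simp: algebra_simps eq_neg_iff_add_eq_0)
    have m': "m = cn c1 * (X - cn x1)" unfolding pq p \<open>q = 0\<close>
      by (simp add: algebra_simps cn_simps)
    obtain p' q' where pq': "n = ev p' + ev q' * Y" using n ideal_times_subset[of S] by (auto simp: coord_ring_def)
    have "g * h * ((X - cn x2) * n) = g * h * (m * (Y - cn y2))" using m(1) n(1) by algebra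
    then have eqn: "(X - cn x2) * n = m * (Y - cn y2)" using gh by simp
    have "ev ([:-x2,1:] * p') + ev ([:-x2,1:] * q') * Y = ev (- smult (c1 * y2) [:-x1,1:]) + ev (smult c1 [:-x1,1:]) * Y"
      using eqn unfolding pq' m' by (simp add: algebra_simps cn_simps)
    then have e: "[:-x2,1:] * p' = - smult (c1 * y2) [:-x1,1:]" "[:-x2,1:] * q' = smult c1 [:-x1,1:]"
      using coord_ring_unique by blast+
    have "poly ([:-x2,1:] * q') x2 = poly (smult c1 [:-x1,1:]) x2" by (simp only: e)
    then have x: "x1 = x2" using \<open>c1 \<noteq> 0\<close> by simp
    have q': "q' = [:c1:]" 
    proof -
      have "[:-x2,1:] * q' = [:-x2,1:] * [:c1:]" unfolding e(2) x by simp
      then show ?thesis by (subst (asm) mult_cancel_left) auto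
    qed
    have p': "p' = [:- c1 * y2:]"
    proof -
      have "[:-x2,1:] * p' = [:-x2,1:] * [:- c1 * y2:]" unfolding e(1) x by simp
      then show ?thesis by (subst (asm) mult_cancel_left) auto
    qed
    have "poly p' x1 + poly q' x1 * y1 = 0" using ideal_times_eval[of y1 x1 p' q'] S ST n pq' by auto
    then have "c1 * (y1 - y2) = 0" unfolding p' q' by (simp add: algebra_simps)
    then show ?thesis using \<open>c1 \<noteq> 0\<close> x ST by simp
  qed auto
qed

text \<open>
  Both ways of adding three points relate the triple product \<open>I\<^sub>P I\<^sub>Q I\<^sub>R\<close> to the ideal of the sum
  by explicit factors whose degrees are known, so the two sums have proportional ideals.
\<close>

lemma ec_add_assoc_aux:
  assumes P: "P \<in> ec_points a b" and Q: "Q \<in> ec_points a b" and R: "R \<in> ec_points a b"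
  shows "ec_add a b (ec_add a b P Q) R = ec_add a b P (ec_add a b Q R)"
proof -
  let ?S = "ec_add a b (ec_add a b P Q) R" and ?T = "ec_add a b P (ec_add a b Q R)"
  obtain v1 l1 where 1: "v1 \<noteq> 0" "l1 \<noteq> 0" "\<And>M. is_module M \<Longrightarrow> (*) v1 ` ideal_times P (ideal_times Q M) = (*) l1 ` ideal_times (ec_add a b P Q) M"
    "deg v1 + \<delta> P + \<delta> Q = deg l1 + \<delta> (ec_add a b P Q)"
    using ideal_times_add[OF P Q] by metis
  obtain v2 l2 where 2: "v2 \<noteq> 0" "l2 \<noteq> 0" "\<And>M. is_module M \<Longrightarrow> (*) v2 ` ideal_times (ec_add a b P Q) (ideal_times R M) = (*) l2 ` ideal_times ?S M"
    "deg v2 + \<delta> (ec_add a b P Q) + \<delta> R = deg l2 + \<delta> ?S"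
    using ideal_times_add[OF ec_add_closed[OF P Q] R] by metis
  obtain v3 l3 where 3: "v3 \<noteq> 0" "l3 \<noteq> 0" "\<And>M. is_module M \<Longrightarrow> (*) v3 ` ideal_times Q (ideal_times R M) = (*) l3 ` ideal_times (ec_add a b Q R) M"
    "deg v3 + \<delta> Q + \<delta> R = deg l3 + \<delta> (ec_add a b Q R)"
    using ideal_times_add[OF Q R] by metis
  obtain v4 l4 where 4: "v4 \<noteq> 0" "l4 \<noteq> 0" "\<And>M. is_module M \<Longrightarrow> (*) v4 ` ideal_times P (ideal_times (ec_add a b Q R) M) = (*) l4 ` ideal_times ?T M"
    "deg v4 + \<delta> P + \<delta> (ec_add a b Q R) = deg l4 + \<delta> ?T"
    using ideal_times_add[OF P ec_add_closed[OF Q R]] by metis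
  have sc: "(*) r ` (*) s ` M = (*) (r * s) ` M" for r s and M :: "'a fls set"
    by (auto simp: image_image mult.assoc)
  let ?I = "ideal_times P (ideal_times Q (ideal_times R coord_ring))"
  have s: "(*) (v2 * v1) ` ?I = (*) (l1 * l2) ` ideal_times ?S coord_ring"
    using 1(3)[OF is_module_ideal_times[OF is_module_coord_ring], of R] 2(3)[OF is_module_coord_ring]
    by (metis sc mult.commute)
  have t: "(*) (v4 * v3) ` ?I = (*) (l3 * l4) ` ideal_times ?T coord_ring"
    using 3(3)[OF is_module_coord_ring] 4(3)[OF is_module_coord_ring] ideal_times_scale
    by (metis sc mult.commute)
  have "(*) (v4 * v3 * (l1 * l2)) ` ideal_times ?S coord_ring = (*) (v2 * v1 * (l3 * l4)) ` ideal_times ?T coord_ring"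
    using s t by (metis sc mult.commute)
  then show ?thesis
  proof (rule ideal_times_unique[rotated -2])
    show "deg (v4 * v3 * (l1 * l2)) + \<delta> ?S = deg (v2 * v1 * (l3 * l4)) + \<delta> ?T"
      using 1 2 3 4 by (simp add: deg_mult)
  qed (use 1 2 3 4 P Q R in \<open>auto intro!: ec_add_closed\<close>)
qed

end

text \<open>
  Comparing coefficients in \<open>s\<^sup>2 = g\<close> with \<open>s\<^sub>0 = 1\<close> determines \<open>2 s\<^sub>n\<close> from earlier coefficients;
  unlike the binomial series this only divides by 2.
\<close>

fun fps_sqrt_coeff :: "'a::field fps \<Rightarrow> nat \<Rightarrow> 'a" where
  "fps_sqrt_coeff g n = (if n = 0 then 1 else
     (fps_nth g n - (\<Sum>i\<in>{1..<n}. fps_sqrt_coeff g i * fps_sqrt_coeff g (n - i))) / 2)"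

declare fps_sqrt_coeff.simps [simp del]

lemma fps_sqrt_exists:
  fixes g :: "'a::field fps"
  assumes "(2::'a) \<noteq> 0" "fps_nth g 0 = 1"
  shows "\<exists>s. s^2 = g"
proof
  let ?c = "fps_sqrt_coeff g"
  show "(Abs_fps ?c)^2 = g"
  proof (rule fps_ext)
    fix n
    have 0: "?c 0 = 1" by (simp add: fps_sqrt_coeff.simps)
    show "fps_nth ((Abs_fps ?c)^2) n = fps_nth g n"
    proof (cases "n = 0")
      case True then show ?thesis using assms 0 by (simp add: power2_eq_square)
    next
      case False
      have "{0..n} = insert 0 (insert n {1..<n})" using False by auto
      then have "fps_nth ((Abs_fps ?c)^2) n = 2 * ?c n + (\<Sum>i\<in>{1..<n}. ?c i * ?c (n - i))"
        using False 0 by (simp add: power2_eq_square fps_mult_nth)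
      also have "\<dots> = fps_nth g n"
        by (subst (1) fps_sqrt_coeff.simps) (use False assms in \<open>simp add: field_simps\<close>)
      finally show ?thesis .
    qed
  qed
qed

context legendre_curve
begin

theorem ec_add_assoc:
  assumes "P \<in> ec_points a b" "Q \<in> ec_points a b" "R \<in> ec_points a b"
  shows "ec_add a b (ec_add a b P Q) R = ec_add a b P (ec_add a b Q R)"
proof -
  define g :: "'a fps" where "g = (1 + fps_const a * fps_X^2) * (1 + fps_const b * fps_X^2)"
  have "fps_nth g 0 = 1" by (simp add: g_def)
  then obtain s where s: "s^2 = g" using fps_sqrt_exists two_neq_0 by blast
  have u: "fls_X_inv^2 * fls_X^2 = (1 :: 'a fls)"
    by (simp flip: power_mult_distrib add: fls_X_inv_times_conv_shift(1))
  have "(fls_X_inv^3 * fps_to_fls s)^2 = fls_X_inv^6 * fps_to_fls (s^2)"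
    by (simp add: power_mult_distrib fps_to_fls_power flip: power_mult)
  also have "\<dots> = fls_X_inv^6 * ((1 + fls_const a * fls_X^2) * (1 + fls_const b * fls_X^2))"
    unfolding s g_def by (simp add: fls_times_fps_to_fls fps_to_fls_power)
  also have "\<dots> = fls_X_inv^2 * (fls_X_inv^2 + fls_const a) * (fls_X_inv^2 + fls_const b)"
    using u by algebra
  finally interpret legendre_function_field a b "fls_X_inv^3 * fps_to_fls s"
    by unfold_locales
  show ?thesis using ec_add_assoc_aux assms .
qed

end

section \<open>Doubling, halving and 2-torsion\<close>

definition ec_group :: "'a::field \<Rightarrow> 'a \<Rightarrow> 'a ec_point monoid" where
  "ec_group a b = \<lparr>carrier = ec_points a b, monoid.mult = ec_add a b, one = Infinity\<rparr>"

lemma ec_group_sel [simp]: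
  "carrier (ec_group a b) = ec_points a b" "P \<otimes>\<^bsub>ec_group a b\<^esub> Q = ec_add a b P Q"
  "\<one>\<^bsub>ec_group a b\<^esub> = Infinity"
  by (simp_all add: ec_group_def)

context legendre_curve
begin

lemma comm_group_ec_group: "comm_group (ec_group a b)"
proof (rule comm_groupI)
  fix P assume "P \<in> carrier (ec_group a b)"
  then show "\<exists>Q\<in>carrier (ec_group a b). Q \<otimes>\<^bsub>ec_group a b\<^esub> P = \<one>\<^bsub>ec_group a b\<^esub>"
    using ec_neg_closed ec_add_neg(2) by auto
qed (auto intro: ec_add_closed ec_add_assoc ec_add_commute)

lemma ec_group_inv: "P \<in> ec_points a b \<Longrightarrow> inv\<^bsub>ec_group a b\<^esub> P = ec_neg P"
  using group.inv_equality[of "ec_group a b" "ec_neg P" P] comm_group_ec_group ec_neg_closed ec_add_neg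
  by (auto simp: comm_group_def)

text \<open>
  Evaluating the line at the abscissae \<open>0\<close> and \<open>- a\<close> of 2-torsion points: this is the reason that
  \<open>X\<close> and \<open>X + a\<close>, taken modulo squares, are homomorphisms.
\<close>

lemma ec_add_coordinate_products:
  assumes P: "Point x1 y1 \<in> ec_points a b" and Q: "Point x2 y2 \<in> ec_points a b"
    and R: "ec_add a b (Point x1 y1) (Point x2 y2) = Point x3 y3"
  obtains c c' where "x1 * x2 * x3 = c^2" "(x1 + a) * (x2 + a) * (x3 + a) = c'^2" 
proof -
  have ne: "\<not> (x1 = x2 \<and> y1 = - y2)" using R by auto
  from P Q have "y1^2 = x1 * (x1 + a) * (x1 + b)" "y2^2 = x2 * (x2 + a) * (x2 + b)" by simp_all
  from ec_add_line_cases[OF this ne] obtain m where *: "x1 + x2 + x3 = m^2 - a - b"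
      "x1 * x2 + x1 * x3 + x2 * x3 = a * b - 2 * m * (y1 - m * x1)"
      "x1 * x2 * x3 = (y1 - m * x1)^2"
    using R by (metis ec_point.inject)
  have "(x1 + a) * (x2 + a) * (x3 + a) = (y1 - m * x1 - m * a)^2"
    using * by algebra
  with *(3) show thesis using that by blast
qed

lemma ec_add_self_eq_Infinity_iff:
  assumes "P \<in> ec_points a b"
  shows "ec_add a b P P = Infinity \<longleftrightarrow> P \<in> {Infinity, Point 0 0, Point (-a) 0, Point (-b) 0}"
proof (cases P)
  case (Point x y)
  have "y = - y \<longleftrightarrow> y = 0" using double_eq_0_iff[of y] by (simp add: eq_neg_iff_add_eq_0)
  with assms show ?thesis unfolding Point by (auto simp: Let_def eq_neg_iff_add_eq_0)
qed simp

text \<open>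
  If all three factors of the cubic are squares, the point is a double.  With the sign of \<open>r1\<close>
  chosen so that \<open>y = r1 r2 r3\<close>, a half is \<open>((r1 + r2) (r1 + r3), (r1 + r2) (r1 + r3) (r2 + r3))\<close>,
  and the tangent there has slope \<open>r1 + r2 + r3\<close>.
\<close>

lemma ec_add_halving:
  assumes P: "Point x y \<in> ec_points a b" and sq: "x = r1^2" "x + a = r2^2" "x + b = r3^2"
  shows "\<exists>x' y'. Point x' y' \<in> ec_points a b \<and> ec_add a b (Point x' y') (Point x' y') = Point x y"
proof -
  have "y^2 = (r1 * r2 * r3)^2" using P sq by (simp add: power_mult_distrib)
  then have "y = r1 * r2 * r3 \<or> y = (-r1) * r2 * r3" by (simp add: power2_eq_iff)
  then obtain s1 where y: "y = s1 * r2 * r3" and s1: "s1^2 = r1^2" by (metis power2_minus)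
  have e: "x = s1^2" "a = r2^2 - s1^2" "b = r3^2 - s1^2" using sq s1 by (simp_all add: algebra_simps flip: sq(1))
  have "a = (r2 - s1) * (s1 + r2)" "b = (r3 - s1) * (s1 + r3)" "a - b = (r2 - r3) * (r2 + r3)"
    unfolding e(2,3) by algebra+
  then have n12: "s1 + r2 \<noteq> 0" and n13: "s1 + r3 \<noteq> 0" and n23: "r2 + r3 \<noteq> 0"
    using a_neq_0 b_neq_0 a_neq_b by auto
  define x' where "x' = (s1 + r2) * (s1 + r3)"
  define y' where "y' = (s1 + r2) * (s1 + r3) * (r2 + r3)"
  have y0: "y' \<noteq> 0" using n12 n13 n23 by (simp add: y'_def)
  have on: "Point x' y' \<in> ec_points a b" unfolding Point_ec_points x'_def y'_def e(2,3) by algebra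
  have ne: "\<not> (x' = x' \<and> y' = - y')" using y0 double_eq_0_iff[of y'] by (simp add: eq_neg_iff_add_eq_0)
  from on have on': "y'^2 = x' * (x' + a) * (x' + b)" by simp
  from ec_add_line_cases[OF on' on' ne] obtain m x3 y3 where *: "ec_add a b (Point x' y') (Point x' y') = Point x3 y3"
      "x' + x' + x3 = m^2 - a - b" "y3 = m * (x' - x3) - y'" "2 * y' * m = 3 * x'^2 + 2 * (a + b) * x' + a * b"
    by metis
  have "2 * y' * (m - (s1 + r2 + r3)) = 0"
    using *(4) unfolding x'_def y'_def e(2,3) by algebra
  then have m: "m = s1 + r2 + r3" using y0 two_neq_0 by simp
  have x3: "x3 = x" using *(2) unfolding m e x'_def by algebra
  have "y3 = y" using *(3) unfolding x3 m y x'_def y'_def e(1) by algebra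
  then show ?thesis using * x3 on by blast
qed

text \<open>
  Translation by a 2-torsion point \<open>(c, 0)\<close> acts on \<open>x - c\<close> by an inversion whose constant is the
  derivative of the cubic at \<open>c\<close>.
\<close>

lemma ec_add_two_torsion:
  assumes P: "Point x y \<in> ec_points a b" and y: "y \<noteq> 0"
  shows "\<exists>x' y'. ec_add a b (Point x y) (Point 0 0) = Point x' y' \<and> x * x' = a * b"
    "\<exists>x' y'. ec_add a b (Point x y) (Point (-a) 0) = Point x' y' \<and> (x + a) * (x' + a) = a * (a - b)"
    "\<exists>x' y'. ec_add a b (Point x y) (Point (-b) 0) = Point x' y' \<and> (x + b) * (x' + b) = b * (b - a)"
proof -
  have P': "y^2 = x * (x + a) * (x + b)" using P by simp
  have x: "x \<noteq> 0" "x \<noteq> -a" "x \<noteq> -b" using P' y by auto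
  { fix e assume e: "0^2 = e * (e + a) * (e + b)" and "x \<noteq> e"
    from ec_add_line_cases[OF P' e] \<open>x \<noteq> e\<close> obtain m x3 y3 where
      *: "ec_add a b (Point x y) (Point e 0) = Point x3 y3"
      "x + e + x3 = m^2 - a - b"
      "x * e + x * x3 + e * x3 = a * b - 2 * m * (y - m * x)"
      "x * e * x3 = (y - m * x)^2" "m * (e - x) = 0 - y" by metis
    have "(x - e) * ((x - e) * (x3 - e) - (3 * e^2 + 2 * (a + b) * e + a * b)) = 0"
      using *(2-5) P' e by algebra
    then have "(x - e) * (x3 - e) = 3 * e^2 + 2 * (a + b) * e + a * b" using \<open>x \<noteq> e\<close> by simp
    with *(1) have "\<exists>x' y'. ec_add a b (Point x y) (Point e 0) = Point x' y' \<and> (x - e) * (x' - e) = 3 * e^2 + 2 * (a + b) * e + a * b"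
      by blast }
  note gen = this
  show "\<exists>x' y'. ec_add a b (Point x y) (Point 0 0) = Point x' y' \<and> x * x' = a * b"
    using gen[of 0] x by simp
  have "3 * (-a)^2 + 2 * (a + b) * (-a) + a * b = a * (a - b)" by algebra
  then show "\<exists>x' y'. ec_add a b (Point x y) (Point (-a) 0) = Point x' y' \<and> (x + a) * (x' + a) = a * (a - b)"
    using gen[of "-a"] x by simp
  have "3 * (-b)^2 + 2 * (a + b) * (-b) + a * b = b * (b - a)" by algebra
  then show "\<exists>x' y'. ec_add a b (Point x y) (Point (-b) 0) = Point x' y' \<and> (x + b) * (x' + b) = b * (b - a)"
    using gen[of "-b"] x by simp
qed

lemma ec_double_x:
  assumes P: "Point x y \<in> ec_points a b" and R: "ec_add a b (Point x y) (Point x y) = Point x3 y3"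
  shows "4 * x * (x + a) * (x + b) * x3 = (x^2 - a * b)^2"
proof -
  have P': "y^2 = x * (x + a) * (x + b)" using P by simp
  have ne: "\<not> (x = x \<and> y = - y)" using R by auto
  from ec_add_line_cases[OF P' P' ne] obtain m where 
      *: "x + x + x3 = m^2 - a - b" "2 * y * m = 3 * x^2 + 2 * (a + b) * x + a * b" using R by (metis ec_point.inject)
  show ?thesis using * P' by algebra
qed

text \<open>
  The coefficients are symmetric under \<open>Q \<mapsto> - Q\<close>, so the roots of this quadratic are the
  abscissae of \<open>P + Q\<close> and \<open>P - Q\<close>.  It bounds the height of a sum without reference to the
  \<open>y\<close>-coordinates.
\<close>

lemma ec_add_x_quadratic:
  assumes P: "Point x1 y1 \<in> ec_points a b" and Q: "Point x2 y2 \<in> ec_points a b" and ne: "x1 \<noteq> x2"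
    and R: "ec_add a b (Point x1 y1) (Point x2 y2) = Point x3 y3"
  shows "(x1 - x2)^2 * x3^2 - 2 * ((x1 + x2) * (x1 * x2 + a * b) + 2 * (a + b) * x1 * x2) * x3 + (x1 * x2 - a * b)^2 = 0"
proof -
  from P Q have PQ: "y1^2 = x1 * (x1 + a) * (x1 + b)" "y2^2 = x2 * (x2 + a) * (x2 + b)" by simp_all
  from ec_add_line_cases[OF PQ] ne obtain m where
      *: "x1 + x2 + x3 = m^2 - a - b" "x1 * x2 + x1 * x3 + x2 * x3 = a * b - 2 * m * (y1 - m * x1)"
      "x1 * x2 * x3 = (y1 - m * x1)^2" "m * (x2 - x1) = y2 - y1" using R by (metis ec_point.inject)
  define n where "n = y1 - m * x1"
  have e: "x1 + x2 + x3 + a + b = m^2" "2 * m * n = a * b - (x1 * x2 + x1 * x3 + x2 * x3)" "n^2 = x1 * x2 * x3"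
    using * by (simp_all add: n_def algebra_simps)
  have "(a * b - (x1 * x2 + x1 * x3 + x2 * x3))^2 = 4 * (x1 + x2 + x3 + a + b) * (x1 * x2 * x3)"
    unfolding e(1) e(2)[symmetric] e(3)[symmetric] by algebra
  then show ?thesis by algebra
qed

end

section \<open>Transport along field homomorphisms and scalings\<close>

locale field_hom =
  fixes \<phi> :: "'a::field \<Rightarrow> 'b::field"
  assumes hom_add: "\<phi> (x + y) = \<phi> x + \<phi> y" and hom_mult: "\<phi> (x * y) = \<phi> x * \<phi> y" and hom_1: "\<phi> 1 = 1"
begin

lemma hom_0: "\<phi> 0 = 0" using hom_add[of 0 0] by (metis add.right_neutral add_left_cancel)
lemma hom_minus: "\<phi> (- x) = - \<phi> x" using hom_add[of x "- x"] by (simp add: hom_0 eq_neg_iff_add_eq_0 add.commute)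
lemma hom_diff: "\<phi> (x - y) = \<phi> x - \<phi> y" using hom_add[of x "- y"] by (simp add: hom_minus)
lemma hom_eq_0: "\<phi> x = 0 \<longleftrightarrow> x = 0"
proof
  assume "\<phi> x = 0"
  show "x = 0"
  proof (rule ccontr)
    assume "x \<noteq> 0"
    then have "\<phi> x * \<phi> (inverse x) = 1" by (simp flip: hom_mult add: hom_1)
    with \<open>\<phi> x = 0\<close> show False by simp
  qed
qed (simp add: hom_0)
lemma hom_eq: "\<phi> x = \<phi> y \<longleftrightarrow> x = y" using hom_eq_0[of "x - y"] by (simp add: hom_diff)
lemma hom_divide: "\<phi> (x / y) = \<phi> x / \<phi> y"
proof (cases "y = 0")
  case False
  then have "\<phi> (x / y) * \<phi> y = \<phi> x" by (simp flip: hom_mult)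
  then show ?thesis using False by (simp add: hom_eq_0 field_simps)
qed (simp add: hom_0)
lemma hom_power: "\<phi> (x ^ n) = \<phi> x ^ n" by (induction n) (simp_all add: hom_1 hom_mult)
lemma hom_of_nat: "\<phi> (of_nat n) = of_nat n" by (induction n) (simp_all add: hom_0 hom_1 hom_add)
lemma hom_numeral: "\<phi> (numeral n) = numeral n" using hom_of_nat[of "numeral n"] by simp

lemmas hom_simps = hom_add hom_mult hom_1 hom_0 hom_minus hom_diff hom_divide hom_power hom_numeral

text \<open>
  A field embedding followed by the isomorphism \<open>(x, y) \<mapsto> (c\<^sup>2 x, c\<^sup>3 y)\<close> onto the curve whose
  parameters are multiplied by \<open>c\<^sup>2\<close>.
\<close>

fun map_scaled :: "'b \<Rightarrow> 'a ec_point \<Rightarrow> 'b ec_point" where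
  "map_scaled c Infinity = Infinity"
| "map_scaled c (Point x y) = Point (c^2 * \<phi> x) (c^3 * \<phi> y)"

lemma map_scaled_closed:
  assumes "P \<in> ec_points a b"
  shows "map_scaled c P \<in> ec_points (c^2 * \<phi> a) (c^2 * \<phi> b)"
proof (cases P)
  case (Point x y)
  then have "\<phi> y ^ 2 = \<phi> x * (\<phi> x + \<phi> a) * (\<phi> x + \<phi> b)"
    using assms by (simp flip: hom_power hom_add hom_mult)
  then show ?thesis unfolding Point by simp algebra
qed simp

lemma map_scaled_add:
  assumes "c \<noteq> 0"
  shows "map_scaled c (ec_add a b P Q) = ec_add (c^2 * \<phi> a) (c^2 * \<phi> b) (map_scaled c P) (map_scaled c Q)"
proof (cases P; cases Q)
  fix x1 y1 x2 y2 assume PQ: "P = Point x1 y1" "Q = Point x2 y2"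
  have x: "c^2 * \<phi> x1 = c^2 * \<phi> x2 \<longleftrightarrow> x1 = x2" using assms by (simp add: hom_eq)
  have y: "c^3 * \<phi> y1 = - (c^3 * \<phi> y2) \<longleftrightarrow> y1 = - y2"
  proof -
    have "- (c^3 * \<phi> y2) = c^3 * \<phi> (- y2)" by (simp add: hom_minus)
    then show ?thesis using assms by (simp add: hom_eq)
  qed
  show ?thesis
  proof (cases "x1 = x2 \<and> y1 = - y2")
    case True then show ?thesis using PQ x y by simp
  next
    case False
    define m where "m = (if x1 = x2 then (3 * x1^2 + 2 * (a + b) * x1 + a * b) / (2 * y1) else (y2 - y1) / (x2 - x1))"
    define m' where "m' = (if c^2 * \<phi> x1 = c^2 * \<phi> x2 then (3 * (c^2 * \<phi> x1)^2 + 2 * (c^2 * \<phi> a + c^2 * \<phi> b) * (c^2 * \<phi> x1) + (c^2 * \<phi> a) * (c^2 * \<phi> b)) / (2 * (c^3 * \<phi> y1)) else ((c^3 * \<phi> y2) - (c^3 * \<phi> y1)) / ((c^2 * \<phi> x2) - (c^2 * \<phi> x1)))"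
    have m': "m' = c * \<phi> m"
    proof (cases "x1 = x2")
      case True
      have "3 * (c^2 * \<phi> x1)^2 + 2 * (c^2 * \<phi> a + c^2 * \<phi> b) * (c^2 * \<phi> x1) + (c^2 * \<phi> a) * (c^2 * \<phi> b)
         = c^3 * (c * (3 * \<phi> x1^2 + 2 * (\<phi> a + \<phi> b) * \<phi> x1 + \<phi> a * \<phi> b))" by algebra
      then show ?thesis using True assms unfolding m_def m'_def
        by (simp add: hom_simps mult.left_commute[of 2])
    next
      case False
      have "(c^3 * \<phi> y2) - (c^3 * \<phi> y1) = c^2 * (c * (\<phi> y2 - \<phi> y1))" "(c^2 * \<phi> x2) - (c^2 * \<phi> x1) = c^2 * (\<phi> x2 - \<phi> x1)"
        by algebra+
      then show ?thesis using False x assms unfolding m_def m'_def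
        by (simp add: hom_simps)
    qed
    define x3 where "x3 = m^2 - (a + b) - x1 - x2"
    have L: "ec_add a b P Q = Point x3 (m * (x1 - x3) - y1)"
      using False PQ by (simp add: Let_def m_def x3_def)
    define x3' where "x3' = m'^2 - (c^2 * \<phi> a + c^2 * \<phi> b) - c^2 * \<phi> x1 - c^2 * \<phi> x2"
    have nf: "\<not> (c^2 * \<phi> x1 = c^2 * \<phi> x2 \<and> c^3 * \<phi> y1 = - (c^3 * \<phi> y2))"
      using False x y by blast
    have R: "ec_add (c^2 * \<phi> a) (c^2 * \<phi> b) (map_scaled c P) (map_scaled c Q) = Point x3' (m' * (c^2 * \<phi> x1 - x3') - c^3 * \<phi> y1)"
      unfolding PQ map_scaled.simps ec_add.simps if_not_P[OF nf] Let_def m'_def[symmetric] x3'_def ..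
    have "x3' = c^2 * \<phi> x3" unfolding x3'_def x3_def m' hom_simps by algebra
    then show ?thesis unfolding L R map_scaled.simps m' hom_simps ec_point.inject by algebra
  qed
qed simp_all

lemma map_scaled_inj: "c \<noteq> 0 \<Longrightarrow> map_scaled c P = map_scaled c Q \<longleftrightarrow> P = Q"
  by (cases P; cases Q) (auto simp: hom_eq)

end

section \<open>Square classes of polynomials and rational functions\<close>

text \<open>
  Coprimality of polynomials over an arbitrary field is expressed below by a Bezout identity
  \<open>u * a + v * b = 1\<close>, which is what the arguments consume.
\<close>

lemma field_poly_bezout:
  fixes a b :: "'k::field poly"
  shows "\<exists>g u v. u * a + v * b = g \<and> g dvd a \<and> g dvd b"
proof (induction "if b = 0 then 0 else Suc (degree b)" arbitrary: a b rule: less_induct)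
  case less
  show ?case
  proof (cases "b = 0")
    case True
    have "1 * a + 0 * b = a \<and> a dvd a \<and> a dvd b" using True by simp
    then show ?thesis by blast
  next
    case False
    have "(if a mod b = 0 then 0 else Suc (degree (a mod b))) < (if b = 0 then 0 else Suc (degree b))"
      using False degree_mod_less[of b a] by auto
    from less[OF this] obtain g u v where g: "u * b + v * (a mod b) = g" "g dvd b" "g dvd a mod b" by blast
    define q where "q = a div b"
    have m: "a mod b = a - b * q" by (simp add: q_def minus_mult_div_eq_mod)
    have "v * a + (u - v * q) * b = g" unfolding g(1)[unfolded m, symmetric] by (simp add: algebra_simps)
    moreover have "g dvd a" using g(2,3) by (simp add: dvd_mod_iff)
    ultimately show ?thesis using g(2) by blast
  qed
qed

lemma Fract_reduced_cases:
  fixes z :: "'k::field poly fract"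
  obtains a b u v where "z = Fract a b" "b \<noteq> 0" "u * a + v * b = 1"
proof -
  obtain a b where z: "z = Fract a b" "b \<noteq> 0" by (cases z)
  obtain g u v where g: "u * a + v * b = g" "g dvd a" "g dvd b" using field_poly_bezout by blast
  then obtain a' b' where ab: "a = g * a'" "b = g * b'" by (auto elim!: dvdE)
  then have "g \<noteq> 0" "b' \<noteq> 0" using z by auto
  moreover have "g * (u * a' + v * b') = g * 1" using g(1) unfolding ab by (simp add: algebra_simps)
  ultimately have "u * a' + v * b' = 1" by (simp only: mult_cancel_left simp_thms)
  moreover have "z = Fract a' b'" unfolding z ab using \<open>g \<noteq> 0\<close> by (simp add: mult_fract_cancel)
  ultimately show thesis using that \<open>b' \<noteq> 0\<close> by blast
qed

lemma bezout_dvd_cancel: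
  fixes a :: "'a::idom"
  assumes "u * a + v * b = 1" "a dvd b * c"
  shows "a dvd c"
proof -
  have "c = a * (u * c) + v * (b * c)" using assms(1) by algebra
  then show ?thesis using assms(2) by (metis dvd_add dvd_mult dvd_triv_left)
qed

lemma bezout_mult:
  fixes a :: "'a::idom"
  assumes "\<exists>u v. u * a + v * b = 1" "\<exists>u v. u * a + v * c = 1"
  shows "\<exists>u v. u * a + v * (b * c) = 1"
proof -
  obtain u v u' v' where "u * a + v * b = 1" "u' * a + v' * c = 1" using assms by blast
  then have "(u * u' * a + u * v' * c + v * b * u') * a + (v * v') * (b * c) = 1" by algebra
  then show ?thesis by blast
qed

lemma bezout_power:
  fixes a :: "'a::idom"
  assumes "\<exists>u v. u * a + v * b = 1"
  shows "\<exists>u v. u * a + v * b ^ n = 1"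
proof (induction n)
  case 0
  have "0 * a + 1 * b ^ 0 = 1" by simp
  then show ?case by blast
next
  case (Suc n)
  then show ?case using bezout_mult[OF assms Suc] by simp
qed

lemma field_poly_irreducible_factor:
  fixes A :: "'k::field poly"
  assumes "degree A > 0"
  shows "\<exists>\<pi>. irreducible \<pi> \<and> \<pi> dvd A"
  using assms
proof (induction "degree A" arbitrary: A rule: less_induct)
  case less
  show ?case
  proof (cases "irreducible A")
    case False
    have "A \<noteq> 0" using less.prems by auto
    then have "\<not> is_unit A" using less.prems by (simp add: is_unit_iff_degree)
    then obtain B C where BC: "A = B * C" "\<not> is_unit B" "\<not> is_unit C" using False \<open>\<not> is_unit A\<close> \<open>A \<noteq> 0\<close> unfolding irreducible_def by blast
    then have "B \<noteq> 0" "C \<noteq> 0" using \<open>A \<noteq> 0\<close> by auto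
    then have "degree B > 0" "degree C > 0" using BC by (auto simp: is_unit_iff_degree)
    then have "degree B < degree A" using BC \<open>B \<noteq> 0\<close> \<open>C \<noteq> 0\<close> by (simp add: degree_mult_eq)
    from less.hyps[OF this \<open>degree B > 0\<close>] show ?thesis using BC by (auto intro: dvd_mult2)
  qed auto
qed

lemma irreducible_degree_pos: "irreducible (\<pi> :: 'k::field poly) \<Longrightarrow> degree \<pi> > 0"
  by (rule ccontr) (auto simp: irreducible_def is_unit_iff_degree)

lemma linear_dvd_of_irreducible_dvd:
  fixes \<pi> :: "'k::field poly"
  assumes "irreducible \<pi>" "\<pi> dvd (\<Prod>r\<in>Z. [:-r,1:])" "finite Z"
  shows "\<exists>r\<in>Z. [:-r,1:] dvd \<pi>"
proof -
  have "prime_elem \<pi>" using assms field_poly_irreducible_imp_prime by blast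
  have "\<exists>r\<in>Z. \<pi> dvd [:-r,1:]" using assms(3,2)
  proof (induction Z)
    case empty
    then show ?case using assms(1) by (auto simp: irreducible_def)
  next
    case (insert r Z)
    then have "\<pi> dvd [:-r,1:] * (\<Prod>r\<in>Z. [:-r,1:])" by simp
    then show ?case using insert.IH prime_elem_dvd_mult_iff[OF \<open>prime_elem \<pi>\<close>] by blast
  qed
  then obtain r where r: "r \<in> Z" "\<pi> dvd [:-r,1:]" by blast
  then obtain k where k: "[:-r,1:] = \<pi> * k" by (auto elim: dvdE)
  then have nz: "\<pi> \<noteq> 0" "k \<noteq> 0" by auto
  have "degree (\<pi> * k) = 1" by (simp flip: k)
  then have "degree k = 0" using irreducible_degree_pos[OF assms(1)] nz by (simp add: degree_mult_eq)
  then have "is_unit k" using nz by (simp add: is_unit_iff_degree)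
  then have "[:-r,1:] dvd \<pi>" unfolding k by (simp add: mult_unit_dvd_iff)
  then show ?thesis using r by blast
qed

text \<open>
  Unique factorization in disguise: a prime dividing \<open>A\<close> but not \<open>B\<close> divides the square \<open>A B\<close>, and
  hence \<open>A\<close>, to an even power.  So up to a constant and squares \<open>A\<close> is a product of those linear
  factors that \<open>A\<close> and \<open>B\<close> may share.  The induction removes either such a linear factor from both
  \<open>A\<close> and \<open>B\<close>, or the square of a prime from \<open>A\<close>.
\<close>

lemma square_factor_decomposition:
  fixes A B C :: "'k::field poly"
  assumes "A * B = C^2" "C \<noteq> 0" "finite Z"
    and "\<And>\<pi>. irreducible \<pi> \<Longrightarrow> \<pi> dvd A \<Longrightarrow> \<pi> dvd B \<Longrightarrow> \<exists>r\<in>Z. [:-r,1:] dvd \<pi>"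
  shows "\<exists>c S D. c \<noteq> 0 \<and> S \<subseteq> Z \<and> A = smult c ((\<Prod>r\<in>S. [:-r,1:]) * D^2)"
  using assms(1,2,4)
proof (induction "degree A" arbitrary: A B C rule: less_induct)
  case less
  have A0: "A \<noteq> 0" "B \<noteq> 0" using less.prems by auto
  show ?case
  proof (cases "degree A = 0")
    case True
    then obtain c where "A = [:c:]" by (auto elim: degree_eq_zeroE)
    then have "c \<noteq> 0 \<and> {} \<subseteq> Z \<and> A = smult c ((\<Prod>r\<in>{}. [:-r,1:]) * 1^2)" using A0 by auto
    then show ?thesis by blast
  next
    case False
    then obtain \<pi> where pi: "irreducible \<pi>" "\<pi> dvd A" using field_poly_irreducible_factor by blast
    have prime: "prime_elem \<pi>" using pi field_poly_irreducible_imp_prime by blast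
    have "\<pi> dvd C^2" using pi less.prems(1) by (metis dvd_mult2)
    then have piC: "\<pi> dvd C" using prime prime_elem_dvd_power by blast
    show ?thesis
    proof (cases "\<pi> dvd B")
      case True
      from less.prems(3)[OF pi True] obtain r where r: "r \<in> Z" "[:-r,1:] dvd \<pi>" by blast
      let ?l = "[:-r,1:]"
      obtain A' B' C' where *: "A = ?l * A'" "B = ?l * B'" "C = ?l * C'"
        using r(2) pi(2) True piC by (metis dvdE dvd_trans)
      have nz: "A' \<noteq> 0" "C' \<noteq> 0" using * A0 less.prems(2) by auto
      have "degree A' < degree A" unfolding * using nz by (subst degree_mult_eq) auto
      moreover have "?l^2 * (A' * B') = ?l^2 * C'^2" using less.prems(1) unfolding * by algebra
      then have "A' * B' = C'^2" by (subst (asm) mult_left_cancel) auto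
      moreover have "\<exists>r\<in>Z. [:-r,1:] dvd \<rho>" if "irreducible \<rho>" "\<rho> dvd A'" "\<rho> dvd B'" for \<rho>
        using less.prems(3)[of \<rho>] that * by (metis dvd_mult)
      ultimately obtain c S D where cSD: "c \<noteq> 0" "S \<subseteq> Z" "A' = smult c ((\<Prod>r\<in>S. [:-r,1:]) * D^2)"
        using less.hyps[of A' B' C'] nz by blast
      have fS: "finite S" using cSD assms(3) finite_subset by blast
      show ?thesis
      proof (cases "r \<in> S")
        case True
        then have "(\<Prod>r\<in>S. [:-r,1:]) = ?l * (\<Prod>r\<in>S-{r}. [:-r,1:])" using fS by (simp add: prod.remove)
        then have "A = smult c ((\<Prod>r\<in>S-{r}. [:-r,1:]) * (?l * D)^2)"
          unfolding * cSD(3) by (simp add: power2_eq_square del: mult_pCons_left mult_pCons_right) (simp only: mult_ac)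
        then show ?thesis using cSD by (metis Diff_subset subset_trans)
      next
        case False
        then have "(\<Prod>r\<in>insert r S. [:-r,1:]) = ?l * (\<Prod>r\<in>S. [:-r,1:])" using fS by simp
        then have "A = smult c ((\<Prod>r\<in>insert r S. [:-r,1:]) * D^2)"
          unfolding * cSD(3) by (simp add: mult_ac del: mult_pCons_left mult_pCons_right)
        then show ?thesis using cSD r by (metis insert_subset)
      qed
    next
      case False
      obtain C' where C': "C = \<pi> * C'" using piC by (auto elim: dvdE)
      have pi0: "\<pi> \<noteq> 0" using pi by auto
      have "\<pi>^2 dvd B * A" using less.prems(1) unfolding C' by (simp add: power_mult_distrib mult.commute)
      moreover obtain u v where "u * \<pi> + v * B = 1"
      proof -
        obtain g u v where g: "u * \<pi> + v * B = g" "g dvd \<pi>" "g dvd B" using field_poly_bezout by blast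
        then obtain k where k: "\<pi> = g * k" by (auto elim: dvdE)
        have "is_unit g"
        proof (rule ccontr)
          assume "\<not> is_unit g"
          then have "is_unit k" using pi(1) k by (auto simp: irreducible_def)
          then have "\<pi> dvd g" unfolding k by (simp add: mult_unit_dvd_iff)
          then show False using g(3) False dvd_trans by blast
        qed
        then obtain h where "1 = g * h" by (auto elim: dvdE)
        then have "(u * h) * \<pi> + (v * h) * B = 1" using g(1) by algebra
        then show thesis using that by blast
      qed
      then obtain u v where "u * \<pi>^2 + v * B = 1"
        using bezout_power[of B \<pi> 2] by (metis add.commute)
      ultimately have "\<pi>^2 dvd A" using bezout_dvd_cancel by blast
      then obtain A' where A': "A = \<pi>^2 * A'" by (auto elim: dvdE)
      have nz: "A' \<noteq> 0" "C' \<noteq> 0" using A' C' A0 less.prems(2) by auto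
      have "degree A' < degree A" unfolding A' power2_eq_square using nz pi0 irreducible_degree_pos[OF pi(1)] by (simp add: degree_mult_eq)
      moreover have "\<pi>^2 * (A' * B) = \<pi>^2 * C'^2" using less.prems(1) unfolding A' C' by algebra
      then have "A' * B = C'^2" using pi0 by simp
      moreover have "\<exists>r\<in>Z. [:-r,1:] dvd \<rho>" if "irreducible \<rho>" "\<rho> dvd A'" "\<rho> dvd B" for \<rho>
        using less.prems(3)[of \<rho>] that A' by (metis dvd_mult)
      ultimately obtain c S D where cSD: "c \<noteq> 0" "S \<subseteq> Z" "A' = smult c ((\<Prod>r\<in>S. [:-r,1:]) * D^2)"
        using less.hyps[of A' B C'] nz by blast
      have "A = smult c ((\<Prod>r\<in>S. [:-r,1:]) * (\<pi> * D)^2)"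
        unfolding A' cSD(3) by (simp add: power_mult_distrib mult_ac)
      then show ?thesis using cSD by blast
    qed
  qed
qed

lemma square_decomposition:
  fixes A B C :: "'k::field poly"
  assumes "A * B = C^2" "C \<noteq> 0"
    and "\<And>\<pi>. irreducible \<pi> \<Longrightarrow> \<pi> dvd A \<Longrightarrow> \<not> \<pi> dvd B"
  shows "\<exists>c D. c \<noteq> 0 \<and> A = smult c (D^2)"
  using square_factor_decomposition[of A B C "{}"] assms by auto

text \<open>
  The polynomial ring is integrally closed.
\<close>

lemma fract_square_integral:
  fixes w :: "'k::field poly fract"
  assumes "w^2 = Fract p 1"
  obtains r where "w = Fract r 1" "r^2 = p"
proof -
  obtain a b u v where w: "w = Fract a b" "b \<noteq> 0" "u * a + v * b = 1" by (rule Fract_reduced_cases)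
  have e: "a^2 = p * b^2" using assms w(2) unfolding w(1) power2_eq_square mult_fract by (subst (asm) eq_fract) (auto simp: mult_ac)
  have "b dvd a"
  proof -
    have "b dvd a * a" using e by (simp add: power2_eq_square)
    then show ?thesis using bezout_dvd_cancel[of v b u a a] w(3) by (metis add.commute)
  qed
  then obtain k where k: "a = b * k" by (auto elim: dvdE)
  have "w = Fract k 1" unfolding w k using w(2) by (simp add: eq_fract)
  moreover have "b^2 * k^2 = b^2 * p" using e k by algebra
  then have "k^2 = p" using w(2) by simp
  ultimately show thesis using that by blast
qed

definition nz_square :: "'a::field \<Rightarrow> bool" where
  "nz_square x \<longleftrightarrow> x \<noteq> 0 \<and> (\<exists>w. x = w^2)"

lemma nz_squareI: "x = w^2 \<Longrightarrow> x \<noteq> 0 \<Longrightarrow> nz_square x" by (auto simp: nz_square_def)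

lemma nz_square_mult: "nz_square x \<Longrightarrow> nz_square y \<Longrightarrow> nz_square (x * y)"
  unfolding nz_square_def by (metis mult_eq_0_iff power_mult_distrib)

lemma nz_square_inverse: "nz_square x \<Longrightarrow> nz_square (inverse x)"
  unfolding nz_square_def by (metis nonzero_imp_inverse_nonzero power_inverse)

lemma nz_square_divide: "nz_square x \<Longrightarrow> nz_square y \<Longrightarrow> nz_square (x / y)"
  by (simp add: divide_inverse nz_square_mult nz_square_inverse)

lemma nz_square_cancel: "nz_square x \<Longrightarrow> nz_square (x * y) \<longleftrightarrow> nz_square y"
proof
  assume "nz_square x" "nz_square (x * y)"
  then have "nz_square (x * y / x)" using nz_square_divide by blast
  then show "nz_square y" using \<open>nz_square x\<close> by (simp add: nz_square_def)
qed (rule nz_square_mult)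

lemma not_nz_square_simple_root:
  fixes p :: "'k::field poly"
  assumes "p = [:-r,1:] * q" "poly q r \<noteq> 0"
  shows "\<not> nz_square (Fract p 1)"
proof
  assume "nz_square (Fract p 1)"
  then obtain w where "w^2 = Fract p 1" unfolding nz_square_def by metis
  then obtain k where k: "k^2 = p" using fract_square_integral by blast
  have "poly k r ^ 2 = poly p r" by (simp flip: k)
  also have "\<dots> = 0" unfolding assms by simp
  finally have "[:-r,1:] dvd k" by (simp add: poly_eq_0_iff_dvd)
  then obtain m where m: "k = [:-r,1:] * m" by (auto elim: dvdE)
  have "[:-r,1:] * ([:-r,1:] * m^2) = [:-r,1:] * q" unfolding assms(1)[symmetric] k[symmetric] m by algebra
  then have "[:-r,1:] * m^2 = q" by (subst (asm) mult_left_cancel) auto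
  then have "poly q r = 0" by (auto simp flip: \<open>[:-r,1:] * m^2 = q\<close>)
  with assms show False by simp
qed

lemma to_fract_square_integral:
  fixes w :: "'k::field poly fract"
  assumes "w^2 = to_fract p"
  obtains r where "w = to_fract r" "r^2 = p"
  using fract_square_integral assms unfolding to_fract_def by metis

lemma const_rf_to_fract: "const_rf c = to_fract [:c:]" by (simp add: const_rf_def to_fract_def)
lemma var_rf_to_fract: "var_rf = to_fract [:0,1:]" by (simp add: var_rf_def to_fract_def)

lemma to_fract_power: "to_fract (p ^ n) = to_fract p ^ n"
  by (induction n) (simp_all add: to_fract_mult)


lemma Fract_conv_divide: "Fract a b = to_fract a / to_fract b"
  by (simp add: to_fract_def divide_fract_def)

lemma const_rf_mult: "const_rf (c * d) = const_rf c * const_rf d"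
  by (simp add: const_rf_to_fract flip: to_fract_mult)
lemma const_rf_power: "const_rf (c ^ n) = const_rf c ^ n"
  by (induction n) (simp_all add: const_rf_mult, simp add: const_rf_to_fract one_pCons[symmetric])
lemma const_rf_eq_0: "const_rf c = 0 \<longleftrightarrow> c = 0"
  by (simp add: const_rf_to_fract)
lemma to_fract_smult: "to_fract (smult c p) = const_rf c * to_fract p"
  by (simp add: const_rf_to_fract flip: to_fract_mult)

section \<open>2-descent on the twisted curve\<close>

text \<open>
  The twisted curve \<open>Y\<^sup>2 = X (X + s) (X + s\<^bsup>N + 1\<^esup>)\<close> over \<open>k(s)\<close>.  The data record what the
  descent needs: the places of bad reduction away from \<open>s = 0\<close> are the rational places
  \<open>s = - e i\<close>, the \<open>e i\<close> are squares, and each of them is the abscissa of a point.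
\<close>

locale twisted_legendre =
  fixes N :: nat and e :: "nat \<Rightarrow> 'k::field" and \<eta> :: "nat \<Rightarrow> 'k poly fract"
  assumes two: "(2::'k) \<noteq> 0" and N2: "N \<ge> 2" and evenN: "even N"
    and e_square: "\<And>i. i < N \<Longrightarrow> nz_square (e i)"
    and e_inj: "inj_on e {..<N}"
    and e_prod: "[:0,1:] ^ N - 1 = (\<Prod>i<N. [:e i, 1:])"
    and R_on_curve: "\<And>i. i < N \<Longrightarrow> Point (const_rf (e i)) (\<eta> i) \<in> ec_points var_rf (var_rf ^ (N + 1))"
begin

abbreviation X :: "'k poly" where "X \<equiv> [:0,1:]"
abbreviation s :: "'k poly fract" where "s \<equiv> var_rf"
text \<open>
  A constant rather than an abbreviation, since the simplifier would unfold the power and destroy the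
  shape of the curve parameters.
\<close>

definition sQ :: "'k poly fract" where "sQ = s ^ (N + 1)"
abbreviation C :: "'k poly fract ec_point set" where "C \<equiv> ec_points s sQ"
abbreviation G :: "'k poly fract ec_point monoid" where "G \<equiv> ec_group s sQ"
abbreviation plus_G (infixl "\<oplus>\<^sub>C" 65) where "P \<oplus>\<^sub>C Q \<equiv> ec_add s sQ P Q"

lemma s_nz: "s \<noteq> 0" by (simp add: var_rf_to_fract)

lemma s_neq_power: "s \<noteq> s ^ (N + 1)"
proof
  assume "s = s ^ (N + 1)"
  then have "X = X ^ (N + 1)" unfolding var_rf_to_fract to_fract_power[symmetric] by (simp only: to_fract_eq_iff)
  then have "degree X = degree (X ^ (N + 1))" by (rule arg_cong)
  then show False using N2 by (simp add: degree_power_eq)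
qed

sublocale legendre_curve s sQ
proof
  have "(2 :: 'k poly fract) = to_fract [:2:]"
    by (metis numeral_poly one_add_one to_fract_1 to_fract_add)
  moreover have "to_fract [:2 :: 'k:] \<noteq> 0" using two by (simp add: to_fract_def Zero_fract_def eq_fract)
  ultimately show "(2 :: 'k poly fract) \<noteq> 0" by metis
qed (use s_nz s_neq_power in \<open>auto simp: sQ_def\<close>)

sublocale G: comm_group G by (rule comm_group_ec_group)

definition R_poly :: "nat set \<Rightarrow> 'k poly" where "R_poly S = (\<Prod>i\<in>S. [:e i, 1:])"


lemma poly_R_poly_0: "S \<subseteq> {..<N} \<Longrightarrow> nz_square (poly (R_poly S) 0)"
proof -
  assume S: "S \<subseteq> {..<N}"
  then have "finite S" using finite_subset by blast
  then have "nz_square (\<Prod>i\<in>S. e i)" using S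
    by (induction S) (auto intro: nz_square_mult e_square nz_squareI[of 1 1])
  then show ?thesis by (simp add: R_poly_def poly_prod)
qed

lemma R_poly_nz: "R_poly S \<noteq> 0" by (cases "finite S") (auto simp: R_poly_def)

lemma R_poly_mult_simple_root:
  assumes S: "S \<subseteq> {..<N}" and i: "i \<in> S" and g: "poly g (- e i) \<noteq> 0"
  shows "\<not> nz_square (to_fract (g * R_poly S))"
proof -
  have fin: "finite S" using S finite_subset by blast
  have "R_poly S = [:e i, 1:] * R_poly (S - {i})" unfolding R_poly_def using fin i by (simp add: prod.remove)
  then have *: "g * R_poly S = [:- (- e i), 1:] * (g * R_poly (S - {i}))" by (simp add: mult.left_commute)
  have "e j - e i \<noteq> 0" if "j \<in> S - {i}" for j
    using e_inj that S i by (auto simp: inj_on_def)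
  then have "poly (g * R_poly (S - {i})) (- e i) \<noteq> 0" using g fin by (simp add: R_poly_def poly_prod)
  from not_nz_square_simple_root[OF * this] show ?thesis by (simp add: to_fract_def)
qed

lemma R_poly_not_square: "S \<subseteq> {..<N} \<Longrightarrow> nz_square (to_fract (R_poly S)) \<Longrightarrow> S = {}"
  using R_poly_mult_simple_root[of S _ 1] by auto

lemma s_R_poly_not_square:
  assumes S: "S \<subseteq> {..<N}"
  shows "\<not> nz_square (to_fract (X * R_poly S))"
  using not_nz_square_simple_root[of "X * R_poly S" 0 "R_poly S"] poly_R_poly_0[OF S]
  by (auto simp: nz_square_def to_fract_def)

lemma minus_s_not_square: "\<not> nz_square (- s)"
  using not_nz_square_simple_root[of "- X" 0 "[:-1:]"] by (simp add: var_rf_def)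

abbreviation sdiff :: "nat set \<Rightarrow> nat set \<Rightarrow> nat set" where "sdiff S S' \<equiv> (S - S') \<union> (S' - S)"

lemma R_poly_sdiff:
  assumes "S \<subseteq> {..<N}" "S' \<subseteq> {..<N}"
  shows "R_poly S * R_poly S' = R_poly (S \<inter> S')^2 * R_poly (sdiff S S')"
proof -
  have fin: "finite S" "finite S'" using assms finite_subset by blast+
  have S: "R_poly S = R_poly (S - S') * R_poly (S \<inter> S')" and S': "R_poly S' = R_poly (S' - S) * R_poly (S \<inter> S')"
    unfolding R_poly_def using fin by (subst prod.union_disjoint[symmetric]; auto intro!: prod.cong)+
  have "R_poly (sdiff S S') = R_poly (S - S') * R_poly (S' - S)"
    unfolding R_poly_def using fin by (subst prod.union_disjoint) auto
  then show ?thesis unfolding S S' by algebra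
qed

text \<open>
  The image of \<open>P\<close> under the descent map is \<open>(1, \<Prod>\<^bsub>i \<in> S\<^esub> (s + e i))\<close>.  Finite sets of indices under
  symmetric difference stand for the group of possible second components modulo squares.
\<close>

definition descent_class :: "nat set \<Rightarrow> 'k poly fract ec_point \<Rightarrow> bool" where
  "descent_class S P \<longleftrightarrow> S \<subseteq> {..<N} \<and> P \<in> C \<and>
    (case P of Infinity \<Rightarrow> S = {} | Point x y \<Rightarrow> nz_square x \<and> nz_square ((x + s) * to_fract (R_poly S)))"

lemma descent_class_Infinity [simp]: "descent_class S Infinity \<longleftrightarrow> S = {}" by (auto simp: descent_class_def)

text \<open>
  The computation with square classes behind additivity: \<open>w\<close> has the class of \<open>z * z'\<close>, and the
  factors common to both products form a square.
\<close>

lemma nz_square_R_poly_sdiff: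
  assumes S: "S \<subseteq> {..<N}" "S' \<subseteq> {..<N}"
    and z: "nz_square (z * to_fract (R_poly S))" and z': "nz_square (z' * to_fract (R_poly S'))"
    and zz: "z * z' * w = c^2" and w: "w \<noteq> 0"
  shows "nz_square (w * to_fract (R_poly (sdiff S S')))"
proof -
  have nz: "z \<noteq> 0" "z' \<noteq> 0" using z z' by (auto simp: nz_square_def)
  have "nz_square (z * z' * w)" unfolding zz by (rule nz_squareI[OF refl]) (use zz w nz in \<open>metis mult_eq_0_iff\<close>)
  then have "nz_square ((z * z' * w) * ((z * to_fract (R_poly S)) * (z' * to_fract (R_poly S'))))"
    using z z' nz_square_mult by blast
  also have "(z * z' * w) * ((z * to_fract (R_poly S)) * (z' * to_fract (R_poly S'))) =
     (z * z' * to_fract (R_poly (S \<inter> S')))^2 * (w * to_fract (R_poly (sdiff S S')))"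
  proof -
    have "to_fract (R_poly S) * to_fract (R_poly S') = to_fract (R_poly (S \<inter> S'))^2 * to_fract (R_poly (sdiff S S'))"
      using R_poly_sdiff[OF S] by (simp flip: to_fract_mult to_fract_power)
    then show ?thesis by algebra
  qed
  finally show ?thesis
    using nz_square_cancel[of "(z * z' * to_fract (R_poly (S \<inter> S')))^2"] nz R_poly_nz by (auto simp: nz_squareI)
qed

text \<open>
  For a sum with affine coordinates this is multiplicativity of the two coordinates of the descent
  map.  It must also be excluded that the sum is a 2-torsion point, where one of these coordinates
  vanishes: in that case \<open>- s\<close>, or \<open>s\<close> times a product of the \<open>s + e i\<close>, would be a square.
\<close>

lemma descent_class_add:
  assumes P: "descent_class S P" and Q: "descent_class S' Q"
  shows "descent_class (sdiff S S') (P \<oplus>\<^sub>C Q)"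
proof (cases P; cases Q)
  fix x1 y1 x2 y2 assume PQ: "P = Point x1 y1" "Q = Point x2 y2"
  have S: "S \<subseteq> {..<N}" "S' \<subseteq> {..<N}" and on: "Point x1 y1 \<in> C" "Point x2 y2 \<in> C"
    and 1: "nz_square x1" "nz_square ((x1 + s) * to_fract (R_poly S))"
    and 2: "nz_square x2" "nz_square ((x2 + s) * to_fract (R_poly S'))"
    using P Q PQ by (auto simp: descent_class_def)
  show ?thesis
  proof (cases "P \<oplus>\<^sub>C Q")
    case Infinity
    then have "x1 = x2" unfolding PQ by (auto simp: Let_def split: if_splits)
    then have "(x1 + s) * (x2 + s) * 1 = (x1 + s)^2" by (simp add: power2_eq_square)
    from nz_square_R_poly_sdiff[OF S 1(2) 2(2) this] have "nz_square (to_fract (R_poly (sdiff S S')))" by simp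
    then have "sdiff S S' = {}" using R_poly_not_square[of "sdiff S S'"] S by blast
    then show ?thesis unfolding Infinity descent_class_Infinity by blast
  next
    case (Point x3 y3)
    obtain c c' where c: "x1 * x2 * x3 = c^2" and c': "(x1 + s) * (x2 + s) * (x3 + s) = c'^2"
      using ec_add_coordinate_products[OF on] Point PQ by metis
    have x3: "x3 \<noteq> 0"
    proof
      assume "x3 = 0"
      from nz_square_R_poly_sdiff[OF S 1(2) 2(2) c'] s_nz this have "nz_square (s * to_fract (R_poly (sdiff S S')))" by simp
      then show False using s_R_poly_not_square[of "sdiff S S'"] S by (auto simp: var_rf_to_fract simp flip: to_fract_mult)
    qed
    have x1x2: "nz_square (x1 * x2)" using 1 2 by (intro nz_square_mult)
    moreover have "nz_square (x1 * x2 * x3)" using c x1x2 x3 by (intro nz_squareI[OF c]) (auto simp: nz_square_def)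
    ultimately have sq3: "nz_square x3" using nz_square_cancel by blast
    have "x3 + s \<noteq> 0"
    proof
      assume "x3 + s = 0"
      then have "x3 = - s" by (simp add: eq_neg_iff_add_eq_0)
      then show False using sq3 minus_s_not_square by simp
    qed
    from nz_square_R_poly_sdiff[OF S 1(2) 2(2) c' this] sq3
    show ?thesis using Point ec_add_closed[OF on] PQ S by (auto simp: descent_class_def)
  qed
qed (use assms in \<open>auto simp: descent_class_def\<close>)

lemma descent_class_neg: "descent_class S P \<Longrightarrow> descent_class S (ec_neg P)"
  by (cases P) (auto simp: descent_class_def)

text \<open>
  If \<open>X\<close> and \<open>X + s\<close> are squares, so is the third factor, because the product of all three is
  \<open>Y\<^sup>2\<close>.
\<close>

lemma descent_class_halving:
  assumes "descent_class {} P"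
  shows "\<exists>P'\<in>C. P' \<oplus>\<^sub>C P' = P"
proof (cases P)
  case Infinity then show ?thesis by (intro bexI[of _ Infinity]) auto
next
  case (Point x y)
  then have on: "Point x y \<in> C" and "nz_square x" "nz_square (x + s)" using assms by (auto simp: descent_class_def R_poly_def)
  then obtain r1 r2 where r: "x = r1^2" "x + s = r2^2" "x \<noteq> 0" "x + s \<noteq> 0" by (auto simp: nz_square_def)
  define b where "b = sQ"
  have "y^2 = x * (x + s) * (x + b)" using on by (simp add: b_def)
  then have "(x + b) * (r1 * r2)^2 = y^2" using r(1,2) by algebra
  moreover have "r1 * r2 \<noteq> 0" using r by auto
  ultimately have "x + b = (y / (r1 * r2))^2" by (simp add: power_divide eq_divide_eq)
  then have "x + sQ = (y / (r1 * r2))^2" by (simp add: b_def)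
  from ec_add_halving[OF on r(1,2) this] show ?thesis unfolding Point by blast
qed

definition two_torsion :: "'k poly fract ec_point set" where
  "two_torsion = {Infinity, Point 0 0, Point (- s) 0, Point (- sQ) 0}"

lemma two_torsion_iff: "P \<in> two_torsion \<longleftrightarrow> P \<in> C \<and> P \<oplus>\<^sub>C P = Infinity"
proof -
  have "two_torsion \<subseteq> C" by (auto simp: two_torsion_def)
  then show ?thesis using ec_add_self_eq_Infinity_iff[of P] by (auto simp: two_torsion_def)
qed

text \<open>
  At a nonzero 2-torsion point \<open>X\<close> is \<open>0\<close>, \<open>- s\<close> or \<open>- s\<^bsup>N + 1\<^esup>\<close>; the last two have odd order at
  \<open>s = 0\<close> because \<open>N\<close> is even.
\<close>

lemma descent_class_two_torsion: assumes "descent_class S P" "P \<in> two_torsion" shows "P = Infinity"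
proof -
  have "\<not> nz_square (- sQ)"
  proof
    assume *: "nz_square (- sQ)"
    have "- sQ = (s ^ (N div 2))^2 * (- s)" using evenN by (simp add: sQ_def flip: power_mult)
    moreover have "nz_square ((s ^ (N div 2))^2)" using s_nz by (intro nz_squareI) auto
    ultimately show False using * nz_square_cancel minus_s_not_square by metis
  qed
  then show ?thesis using assms minus_s_not_square by (auto simp: two_torsion_def descent_class_def nz_square_def)
qed

lemma R_on: "i < N \<Longrightarrow> Point (const_rf (e i)) (\<eta> i) \<in> C"
  unfolding sQ_def by (rule R_on_curve)

lemma descent_class_R: "i < N \<Longrightarrow> descent_class {i} (Point (const_rf (e i)) (\<eta> i))"
proof -
  assume i: "i < N"
  obtain w where w: "e i = w^2" "e i \<noteq> 0" using e_square[OF i] by (auto simp: nz_square_def)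
  have "nz_square (const_rf (e i))"
    by (rule nz_squareI[of _ "const_rf w"]) (use w in \<open>simp_all add: const_rf_power const_rf_eq_0 del: power_eq_0_iff\<close>)
  moreover have "const_rf (e i) + s = to_fract [:e i, 1:]" by (simp add: const_rf_to_fract var_rf_to_fract flip: to_fract_add)
  then have "nz_square ((const_rf (e i) + s) * to_fract (R_poly {i}))"
    by (intro nz_squareI[of _ "to_fract [:e i, 1:]"]) (auto simp: R_poly_def power2_eq_square)
  ultimately show ?thesis using R_on[OF i] i by (simp add: descent_class_def del: Point_ec_points)
qed

text \<open>
  The equation of the curve after clearing denominators, for \<open>X = a / b\<close>.
\<close>

lemma polynomial_equation:
  assumes on: "Point x y \<in> C" and x: "x = to_fract a / to_fract b" "b \<noteq> 0" and y: "y \<noteq> 0"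
  obtains Z where "Z^2 = a * (b * ((a + X * b) * (a + X ^ (N + 1) * b)))" "Z \<noteq> 0"
proof -
  \<comment> \<open>A square root of the right-hand side among rational functions, hence a polynomial.\<close>
  define w where "w = y * to_fract b ^ 2"
  have "to_fract b \<noteq> 0" using x by simp
  then have a: "to_fract a = x * to_fract b" using x by simp
  have "y^2 = x * (x + s) * (x + sQ)" using on by simp
  then have "w^2 = to_fract a * (to_fract b * ((to_fract a + s * to_fract b) * (to_fract a + sQ * to_fract b)))"
    unfolding w_def a by algebra
  also have "\<dots> = to_fract (a * (b * ((a + X * b) * (a + X ^ (N + 1) * b))))"
    unfolding sQ_def var_rf_to_fract to_fract_mult to_fract_add to_fract_power ..
  finally obtain Z where Z: "w = to_fract Z" "Z^2 = a * (b * ((a + X * b) * (a + X ^ (N + 1) * b)))"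
    by (rule to_fract_square_integral)
  have "w \<noteq> 0" using y x by (simp add: w_def)
  then show thesis using Z that by auto
qed

lemma order_X_eqI:
  assumes "X ^ n dvd p" "\<not> X ^ Suc n dvd p"
  shows "Polynomial.order 0 p = n"
proof -
  have "[:- 0, 1:] ^ n dvd p" "\<not> [:- 0, 1:] ^ Suc n dvd p" using assms by simp_all
  then show ?thesis using order_unique_lemma[of 0 n p] by simp
qed

text \<open>
  The local analysis at \<open>s = 0\<close>.  Here \<open>n\<close> is the order of \<open>a\<close>.  If none of the four alternatives
  holds, then \<open>1 \<le> n \<le> N + 1\<close> and the four factors of \<open>Z\<^sup>2\<close> have orders \<open>n\<close>, \<open>0\<close>, \<open>1\<close> and \<open>n\<close>,
  with odd sum.  The alternatives correspond to the four components of the special fibre that are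
  represented by the 2-torsion points.
\<close>

lemma component_at_0:
  assumes Z: "Z^2 = a * (b * ((a + X * b) * (a + X ^ (N + 1) * b)))" "Z \<noteq> 0" and ab: "u * a + v * b = 1"
  shows "poly a 0 \<noteq> 0 \<or> X ^ (N + 2) dvd a \<or> X ^ 2 dvd a + X * b \<or> X ^ (N + 2) dvd a + X ^ (N + 1) * b"
proof (rule ccontr)
  assume "\<not> ?thesis"
  then have a: "poly a 0 = 0" "\<not> X ^ (N + 2) dvd a" and 1: "\<not> X ^ 2 dvd a + X * b"
    and 2: "\<not> X ^ (N + 2) dvd a + X ^ (N + 1) * b" by auto
  have "poly (u * a + v * b) 0 = 1" using ab by simp
  then have b0: "poly b 0 \<noteq> 0" using a by auto
  have nz: "a \<noteq> 0" "b \<noteq> 0" "a + X * b \<noteq> 0" "a + X ^ (N + 1) * b \<noteq> 0" using Z by auto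
  define n where "n = Polynomial.order 0 a"
  have n_dvd: "X ^ n dvd a" using order_1[of 0 a] by (simp add: n_def)
  have n_not: "\<not> X ^ Suc n dvd a" using order_2[OF nz(1), of 0] by (simp add: n_def)
  have "n \<noteq> 0" using a nz order_root[of a 0] by (auto simp: n_def)
  have n_le: "n \<le> N + 1"
  proof (rule ccontr)
    assume "\<not> n \<le> N + 1"
    then have "X ^ (N + 2) dvd X ^ n" by (intro le_imp_power_dvd) auto
    then show False using n_dvd a(2) dvd_trans by blast
  qed
  have ob: "Polynomial.order 0 b = 0" using b0 order_root by blast
  have "X dvd a" using a(1) by (metis poly_eq_0_iff_dvd minus_zero)
  then have "X ^ 1 dvd a + X * b" by (metis dvd_add dvd_triv_left power_one_right)
  then have o1: "Polynomial.order 0 (a + X * b) = 1" using 1 order_X_eqI[of 1 "a + X * b"] by (simp add: numeral_2_eq_2)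
  have o2: "Polynomial.order 0 (a + X ^ (N + 1) * b) = n"
  proof (rule order_X_eqI)
    have "X ^ n dvd X ^ (N + 1)" using n_le by (rule le_imp_power_dvd)
    then show "X ^ n dvd a + X ^ (N + 1) * b" using n_dvd by (intro dvd_add dvd_mult2)
    show "\<not> X ^ Suc n dvd a + X ^ (N + 1) * b"
    proof
      assume *: "X ^ Suc n dvd a + X ^ (N + 1) * b"
      show False
      proof (cases "n = N + 1")
        case True then show ?thesis using * 2 by simp
      next
        case False
        then have "X ^ Suc n dvd X ^ (N + 1)" using n_le by (intro le_imp_power_dvd) simp
        then have "X ^ Suc n dvd X ^ (N + 1) * b" by (rule dvd_mult2)
        then have "X ^ Suc n dvd a" using * dvd_add_left_iff by blast
        then show False using n_not by blast
      qed
    qed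
  qed
  have "Polynomial.order 0 (Z^2) = Polynomial.order 0 a + (Polynomial.order 0 b + (Polynomial.order 0 (a + X * b) + Polynomial.order 0 (a + X ^ (N + 1) * b)))"
    unfolding Z(1) using nz by (simp add: order_mult del: mult_pCons_left power_Suc)
  then have "2 * Polynomial.order 0 Z = 2 * n + 1"
    using Z(2) ob o1 o2 by (simp add: power2_eq_square order_mult n_def)
  then show False by presburger
qed

lemma irreducible_dvd_X_power:
  assumes "irreducible \<pi>" "\<pi> dvd X ^ n * b" "\<not> \<pi> dvd b"
  shows "X dvd \<pi>"
proof -
  have prime: "prime_elem \<pi>" using assms field_poly_irreducible_imp_prime by blast
  then have "\<pi> dvd X ^ n" using assms by (simp add: prime_elem_dvd_mult_iff)
  then have "\<pi> dvd X" using prime prime_elem_dvd_power by blast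
  then show ?thesis using linear_dvd_of_irreducible_dvd[OF assms(1), of "{0}"] by simp
qed

text \<open>
  On the component of the identity at \<open>s = 0\<close> the descent class is of the special form.  Write
  \<open>X = a / b\<close> in lowest terms.  Since \<open>a\<close> does not vanish at \<open>0\<close>, the numerator \<open>a\<close> and the
  denominator \<open>b\<close> share no prime with the other factors of \<open>Z\<^sup>2\<close>, while \<open>a + s b\<close> and
  \<open>a + s\<^bsup>N + 1\<^esup> b\<close> can share only primes dividing \<open>s\<^sup>N - 1\<close>.  This gives all factors up to constants
  \<open>c\<close>, \<open>c'\<close>, \<open>c''\<close>.  Evaluating at \<open>s = 0\<close>, where the three roots of the cubic coincide, shows that
  the three constants agree modulo squares.
\<close>

lemma descent_class_exists:
  assumes on: "Point x y \<in> C" and x: "x = to_fract a' / to_fract b'" "b' \<noteq> 0" and a': "poly a' 0 \<noteq> 0"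
  shows "\<exists>S. descent_class S (Point x y)"
proof -
  obtain a b u v where "x = Fract a b" and b: "b \<noteq> 0" and ab: "u * a + v * b = 1" by (rule Fract_reduced_cases)
  then have xab: "x = to_fract a / to_fract b" by (simp add: Fract_conv_divide)
  have eq: "a' * b = a * b'"
  proof -
    have "to_fract a' * to_fract b = to_fract a * to_fract b'" using x xab b by (simp add: field_simps)
    then show ?thesis by (simp flip: to_fract_mult)
  qed
  have ab0: "poly u 0 * poly a 0 + poly v 0 * poly b 0 = 1" using arg_cong[OF ab, of "\<lambda>p. poly p 0"] by simp
  have a0: "poly a 0 \<noteq> 0"
  proof
    assume 0: "poly a 0 = 0"
    then have "poly b 0 \<noteq> 0" using ab0 by auto
    moreover have "poly a' 0 * poly b 0 = 0" using arg_cong[OF eq, of "\<lambda>p. poly p 0"] 0 by simp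
    ultimately show False using a' by simp
  qed
  then have Xa: "\<not> X dvd a" by (metis poly_eq_0_iff_dvd minus_zero)
  have y0: "y \<noteq> 0"
  proof
    assume "y = 0"
    then have "x = 0 \<or> x + s = 0 \<or> x + sQ = 0" using on by auto
    moreover have "to_fract b \<noteq> 0" using b by simp
    ultimately have "to_fract a = 0 \<or> to_fract a + s * to_fract b = 0 \<or> to_fract a + sQ * to_fract b = 0"
      unfolding xab by (auto simp: field_simps)
    then have "a = 0 \<or> a + X * b = 0 \<or> a + X ^ (N + 1) * b = 0"
      by (simp only: sQ_def var_rf_to_fract flip: to_fract_power to_fract_mult to_fract_add) (simp only: to_fract_eq_0_iff)
    then have "poly a 0 = 0 \<or> poly (a + X * b) 0 = 0 \<or> poly (a + X ^ (N + 1) * b) 0 = 0" by (metis poly_0)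
    then show False using a0 by simp
  qed
  obtain Z where Z: "Z^2 = a * (b * ((a + X * b) * (a + X ^ (N + 1) * b)))" "Z \<noteq> 0"
    using polynomial_equation[OF on xab b y0] by metis
  have unit: "\<not> (\<pi> dvd a \<and> \<pi> dvd b)" if "irreducible \<pi>" for \<pi>
    using that ab by (metis dvd_add dvd_mult irreducible_not_unit)
  have noX: "\<not> (\<pi> dvd a \<and> X dvd \<pi>)" for \<pi> using Xa dvd_trans by blast
  have pr: "\<pi> dvd p * q \<longleftrightarrow> \<pi> dvd p \<or> \<pi> dvd q" if "irreducible \<pi>" for \<pi> p q :: "'k poly"
    using field_poly_irreducible_imp_prime[OF that] prime_elem_dvd_mult_iff by blast
  have shift: "\<not> \<pi> dvd a + X ^ n * b" if pi: "irreducible \<pi>" "\<pi> dvd a" for \<pi> n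
  proof
    assume "\<pi> dvd a + X ^ n * b"
    then have "\<pi> dvd X ^ n * b" using pi(2) dvd_add_right_iff by blast
    then show False using irreducible_dvd_X_power pi unit noX by blast
  qed
  have shift_b: "\<not> \<pi> dvd a + X ^ n * b" if pi: "irreducible \<pi>" "\<pi> dvd b" for \<pi> n
    using unit[OF pi(1)] pi(2) by (metis dvd_add_left_iff dvd_mult)
  have shift1: "a + X * b = a + X ^ 1 * b" by simp
  obtain c A where cA: "c \<noteq> 0" "a = smult c (A^2)"
  proof -
    have "a * (b * ((a + X * b) * (a + X ^ (N + 1) * b))) = Z^2" by (simp add: Z)
    moreover have "\<not> \<pi> dvd b * ((a + X * b) * (a + X ^ (N + 1) * b))" if "irreducible \<pi>" "\<pi> dvd a" for \<pi>
      using that unit shift[OF that] unfolding shift1 pr[OF that(1)] by blast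
    ultimately show thesis using square_decomposition[of a _ Z] Z(2) that by blast
  qed
  obtain c' B where cB: "c' \<noteq> 0" "b = smult c' (B^2)"
  proof -
    have "b * (a * ((a + X * b) * (a + X ^ (N + 1) * b))) = Z^2" unfolding Z by algebra
    moreover have "\<not> \<pi> dvd a * ((a + X * b) * (a + X ^ (N + 1) * b))" if "irreducible \<pi>" "\<pi> dvd b" for \<pi>
      using that unit shift_b[OF that] unfolding shift1 pr[OF that(1)] by blast
    ultimately show thesis using square_decomposition[of b _ Z] Z(2) that by blast
  qed
  let ?R = "(\<lambda>i. - e i) ` {..<N}"
  obtain c'' S0 D where cD: "c'' \<noteq> 0" "S0 \<subseteq> ?R" "a + X * b = smult c'' ((\<Prod>r\<in>S0. [:-r,1:]) * D^2)"
  proof -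
    have eqZ: "(a + X * b) * (a * (b * (a + X ^ (N + 1) * b))) = Z^2" unfolding Z by algebra
    have common: "\<exists>r\<in>?R. [:-r,1:] dvd \<pi>" if pi: "irreducible \<pi>" "\<pi> dvd a + X * b" "\<pi> dvd a * (b * (a + X ^ (N + 1) * b))" for \<pi>
    proof -
      have na: "\<not> \<pi> dvd a" using shift[OF pi(1), of 1] pi(2) by auto
      have nb: "\<not> \<pi> dvd b" using shift_b[OF pi(1), of 1] pi(2) by auto
      have "\<pi> dvd a + X ^ (N + 1) * b" using pi(3) na nb pr[OF pi(1)] by blast
      then have "\<pi> dvd (a + X ^ (N + 1) * b) - (a + X * b)" using pi(2) by (rule dvd_diff)
      also have "\<dots> = X ^ 1 * ((X ^ N - 1) * b)" by (simp only: power_add power_one_right mult_1_left algebra_simps)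
      finally have *: "\<pi> dvd X ^ 1 * ((X ^ N - 1) * b)" .
      have "\<not> X dvd \<pi>"
      proof
        assume "X dvd \<pi>"
        then have "X dvd a + X * b" using pi(2) dvd_trans by blast
        then show False using Xa by (metis dvd_add_left_iff dvd_triv_left)
      qed
      then have "\<pi> dvd (X ^ N - 1) * b" using irreducible_dvd_X_power[OF pi(1) *] by blast
      then have "\<pi> dvd X ^ N - 1" using nb pr[OF pi(1)] by blast
      also have "X ^ N - 1 = (\<Prod>r\<in>?R. [:-r,1:])"
        unfolding e_prod by (subst prod.reindex) (use e_inj in \<open>auto simp: inj_on_def\<close>)
      finally show ?thesis using linear_dvd_of_irreducible_dvd[OF pi(1)] by blast
    qed
    have "finite ?R" by simp
    from square_factor_decomposition[OF eqZ Z(2) this common] show thesis using that by metis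
  qed
  define S where "S = {i\<in>{..<N}. - e i \<in> S0}"
  have S: "S \<subseteq> {..<N}" by (auto simp: S_def)
  have "S0 = (\<lambda>i. - e i) ` S" using cD(2) by (auto simp: S_def)
  then have "(\<Prod>r\<in>S0. [:-r,1:]) = R_poly S"
    unfolding R_poly_def by (subst \<open>S0 = _\<close>, subst prod.reindex) (use e_inj S in \<open>auto simp: inj_on_def\<close>)
  then have cD': "a + X * b = smult c'' (R_poly S * D^2)" using cD by simp
  have "nz_square (c * c')"
  proof -
    have B0: "B \<noteq> 0" using b cB by auto
    \<comment> \<open>Dividing \<open>Z\<^sup>2\<close> by the square factor \<open>B\<^sup>2\<close> of \<open>b\<close> leaves a square that can be evaluated at \<open>0\<close>, even if \<open>b\<close> vanishes there.\<close>
    have "(to_fract Z / to_fract B)^2 = to_fract (smult c' (a * ((a + X * b) * (a + X ^ (N + 1) * b))))"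
    proof -
      have "Z^2 = smult c' (a * ((a + X * b) * (a + X ^ (N + 1) * b))) * B^2"
      proof -
        have "p * (b * q) = smult c' (p * q) * B^2" for p q by (subst cB(2)) (simp add: mult_ac)
        then show ?thesis unfolding Z .
      qed
      then have "to_fract Z^2 = to_fract (smult c' (a * ((a + X * b) * (a + X ^ (N + 1) * b)))) * to_fract B^2"
        by (metis to_fract_mult to_fract_power)
      then show ?thesis using B0 by (simp add: power_divide divide_eq_eq)
    qed
    then obtain W where "W^2 = smult c' (a * ((a + X * b) * (a + X ^ (N + 1) * b)))"
      by (rule to_fract_square_integral)
    from arg_cong[OF this, of "\<lambda>p. poly p 0"] have W: "poly W 0^2 = c' * (poly a 0)^3"
      by (simp add: power3_eq_cube)
    have a0': "poly a 0 = c * poly A 0^2" by (subst cA(2)) simp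
    have "poly A 0 \<noteq> 0" using a0 a0' by auto
    then have nz: "c * poly A 0^3 \<noteq> 0" using cA(1) by simp
    have "(c * c') * (c * poly A 0^3)^2 = poly W 0^2" using W unfolding a0' by algebra
    then have "c * c' = (poly W 0 / (c * poly A 0^3))^2"
      using nz by (simp add: power_divide eq_divide_eq)
    then show ?thesis using cA cB by (intro nz_squareI) auto
  qed
  moreover have "nz_square (c * c'')"
  proof -
    have a0': "poly a 0 = c * poly A 0^2" by (subst cA(2)) simp
    obtain g where g: "poly (R_poly S) 0 = g^2" "g \<noteq> 0" using poly_R_poly_0[OF S] by (auto simp: nz_square_def)
    have "poly a 0 = c'' * (g^2 * poly D 0^2)" using arg_cong[OF cD', of "\<lambda>p. poly p 0"] g by simp
    then have *: "c * poly A 0^2 = c'' * (g^2 * poly D 0^2)" using a0' by simp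
    have A0: "poly A 0 \<noteq> 0" using a0 a0' by auto
    have "c * c'' = (c'' * g * poly D 0 / poly A 0)^2"
      using * A0 by (simp add: power_divide eq_divide_eq power_mult_distrib) algebra
    then show ?thesis using cA cD by (intro nz_squareI) auto
  qed
  ultimately have "nz_square (c * c' * (c * c''))" by (rule nz_square_mult)
  then have "nz_square (c^2 * (c' * c''))" by (simp add: power2_eq_square mult_ac)
  moreover have "nz_square (c^2)" using cA by (intro nz_squareI) auto
  ultimately have cc'': "nz_square (c' * c'')" using nz_square_cancel by blast
  have sq_const: "nz_square (const_rf k)" if "nz_square k" for k :: 'k
    using that by (auto simp: nz_square_def const_rf_power const_rf_eq_0 simp del: power_eq_0_iff)
  have "to_fract b \<noteq> 0" using b by simp
  then have nzb: "to_fract B \<noteq> 0" "const_rf c' \<noteq> 0" using cB by (auto simp: const_rf_eq_0)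
  have fa: "to_fract a = const_rf c * to_fract A^2" using arg_cong[OF cA(2), of to_fract] by (simp add: to_fract_smult to_fract_power)
  have fb: "to_fract b = const_rf c' * to_fract B^2" using arg_cong[OF cB(2), of to_fract] by (simp add: to_fract_smult to_fract_power)
  have nza: "to_fract A \<noteq> 0" using fa a0 by auto
  have "x = const_rf (c * c') * (to_fract A / (const_rf c' * to_fract B))^2"
    unfolding xab fa fb const_rf_mult using nzb by (simp add: power_divide power_mult_distrib field_simps power2_eq_square)
  moreover have "nz_square ((to_fract A / (const_rf c' * to_fract B))^2)" using nza nzb by (intro nz_squareI) auto
  ultimately have sqx: "nz_square x" using sq_const[OF \<open>nz_square (c * c')\<close>] nz_square_mult by metis
  have fd: "to_fract a + s * to_fract b = const_rf c'' * (to_fract (R_poly S) * to_fract D^2)"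
    using arg_cong[OF cD', of to_fract] by (simp only: to_fract_smult to_fract_power to_fract_mult to_fract_add var_rf_to_fract)
  have D0: "D \<noteq> 0"
  proof
    assume "D = 0"
    then have "Z^2 = 0" unfolding Z(1) cD' by simp
    then show False using Z(2) by simp
  qed
  have "x + s = (to_fract a + s * to_fract b) / to_fract b" unfolding xab using \<open>to_fract b \<noteq> 0\<close> by (simp add: field_simps)
  then have xs: "x + s = const_rf c'' * (to_fract (R_poly S) * to_fract D^2) / (const_rf c' * to_fract B^2)" unfolding fd unfolding fb .
  have "(x + s) * to_fract (R_poly S) = const_rf (c' * c'') * (to_fract (R_poly S) * to_fract D / (const_rf c' * to_fract B))^2"
    unfolding xs const_rf_mult using nzb by (simp add: power_divide power_mult_distrib field_simps power2_eq_square)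
  moreover have "nz_square ((to_fract (R_poly S) * to_fract D / (const_rf c' * to_fract B))^2)" using D0 R_poly_nz nzb by (intro nz_squareI) auto
  ultimately have "nz_square ((x + s) * to_fract (R_poly S))" using sq_const[OF cc''] nz_square_mult by metis
  then show ?thesis using sqx on S by (auto simp: descent_class_def)
qed

text \<open>
  Here \<open>- c\<close> is the abscissa of a 2-torsion point and \<open>m * k\<close> the constant of the inversion
  \<open>x + c \<mapsto> x' + c\<close> by which it acts.  If the numerator \<open>a + c b\<close> absorbs the full power \<open>m\<close> of
  \<open>s\<close>, the numerator of the translate no longer vanishes at \<open>s = 0\<close>.
\<close>

lemma translate_has_class:
  assumes on: "Point x' y' \<in> C" and x: "x = to_fract a / to_fract b" and b: "poly b 0 \<noteq> 0"
    and prod: "(x + to_fract c) * (x' + to_fract c) = to_fract (m * k)"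
    and num: "a + c * b = m * a'" "a + c * b \<noteq> 0" and c: "poly c 0 = 0" and k: "poly k 0 \<noteq> 0"
  shows "\<exists>S. descent_class S (Point x' y')"
proof -
  have nz: "m \<noteq> 0" "a' \<noteq> 0" "to_fract b \<noteq> 0" using num b by auto
  have "to_fract a + to_fract c * to_fract b = to_fract m * to_fract a'"
    using arg_cong[OF num(1), of to_fract] by (simp only: to_fract_add to_fract_mult)
  moreover have "x + to_fract c = (to_fract a + to_fract c * to_fract b) / to_fract b"
    unfolding x using nz by (simp add: field_simps)
  ultimately have "to_fract m * (to_fract a' * (x' + to_fract c)) = to_fract m * (to_fract k * to_fract b)"
    using prod nz by (simp add: to_fract_mult field_simps)
  then have "to_fract a' * (x' + to_fract c) = to_fract k * to_fract b" using nz by simp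
  then have x': "x' = to_fract (k * b - c * a') / to_fract a'"
    using nz by (simp add: to_fract_diff to_fract_mult field_simps)
  have "poly (k * b - c * a') 0 \<noteq> 0" using b c k by simp
  from descent_class_exists[OF on x' nz(2) this] show ?thesis .
qed

lemma exists_torsion_translate_with_class:
  assumes P: "P \<in> C"
  shows "\<exists>t\<in>two_torsion. \<exists>S. descent_class S (P \<oplus>\<^sub>C t)"
proof (cases "P \<in> two_torsion")
  case True
  then have "descent_class {} (P \<oplus>\<^sub>C P)" using two_torsion_iff by simp
  then show ?thesis using True by blast
next
  case False
  then obtain x y where Pxy: "P = Point x y" by (cases P) (auto simp: two_torsion_def)
  have on: "Point x y \<in> C" using P Pxy by simp
  have y0: "y \<noteq> 0"
  proof
    assume "y = 0"
    then have "P \<oplus>\<^sub>C P = Infinity" unfolding Pxy by simp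
    then show False using False P two_torsion_iff by blast
  qed
  obtain a b u v where "x = Fract a b" and b: "b \<noteq> 0" and ab: "u * a + v * b = 1" by (rule Fract_reduced_cases)
  then have xab: "x = to_fract a / to_fract b" by (simp add: Fract_conv_divide)
  obtain Z where Z: "Z^2 = a * (b * ((a + X * b) * (a + X ^ (N + 1) * b)))" "Z \<noteq> 0"
    using polynomial_equation[OF on xab b y0] by metis
  then have nz: "a + 0 * b \<noteq> 0" "a + X * b \<noteq> 0" "a + X ^ (N + 1) * b \<noteq> 0" by auto
  have "poly u 0 * poly a 0 + poly v 0 * poly b 0 = 1" using arg_cong[OF ab, of "\<lambda>p. poly p 0"] by simp
  then have b0: "poly a 0 = 0 \<Longrightarrow> poly b 0 \<noteq> 0" by auto
  have TC: "P \<oplus>\<^sub>C t \<in> C" if "t \<in> two_torsion" for t using that two_torsion_iff ec_add_closed[OF P] by blast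
  have s: "s = to_fract X" "sQ = to_fract (X ^ (N + 1))"
    by (simp_all only: sQ_def var_rf_to_fract to_fract_power)
  have "poly (1 - X ^ N) 0 \<noteq> 0" "poly (X ^ N - 1) 0 \<noteq> 0" using N2 by (simp_all add: poly_power power_0_left)
  note k0 = this
  consider "poly a 0 \<noteq> 0" | "poly a 0 = 0" "X ^ (N + 2) dvd a" | "poly a 0 = 0" "X ^ 2 dvd a + X * b"
    | "poly a 0 = 0" "X ^ (N + 2) dvd a + X ^ (N + 1) * b"
    using component_at_0[OF Z ab] by blast
  then show ?thesis
  proof cases
    case 1
    then obtain S where "descent_class S P" using descent_class_exists[OF on xab b] Pxy by blast
    then show ?thesis by (intro bexI[of _ Infinity] exI[of _ S]) (auto simp: two_torsion_def Pxy)
  next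
    case 2
    obtain x' y' where *: "P \<oplus>\<^sub>C Point 0 0 = Point x' y'" "x * x' = s * sQ"
      using ec_add_two_torsion(1)[OF on y0] Pxy by blast
    have t: "Point 0 0 \<in> two_torsion" by (simp add: two_torsion_def)
    obtain a' where a': "a + 0 * b = X ^ (N + 2) * a'" using 2(2) by (metis dvdE add_0_right mult_zero_left)
    have "X * X ^ (N + 1) = X ^ (N + 2) * 1" by simp
    then have "(x + to_fract 0) * (x' + to_fract 0) = to_fract (X ^ (N + 2) * 1)"
      using *(2) unfolding s to_fract_mult[symmetric] to_fract_0 add_0_right by (simp only:)
    from translate_has_class[OF _ xab b0[OF 2(1)] this a' nz(1)] have "\<exists>S. descent_class S (Point x' y')"
      using TC[OF t] * by simp
    then show ?thesis using t * by metis
  next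
    case 3
    obtain x' y' where *: "P \<oplus>\<^sub>C Point (-s) 0 = Point x' y'" "(x + s) * (x' + s) = s * (s - sQ)"
      using ec_add_two_torsion(2)[OF on y0] Pxy by blast
    have t: "Point (-s) 0 \<in> two_torsion" by (simp add: two_torsion_def)
    obtain a' where a': "a + X * b = X ^ 2 * a'" using 3 by (auto elim: dvdE)
    have "X * (X - X ^ (N + 1)) = X ^ 2 * (1 - X ^ N)" unfolding power_add by algebra
    then have "(x + to_fract X) * (x' + to_fract X) = to_fract (X ^ 2 * (1 - X ^ N))"
      using *(2) unfolding s to_fract_mult[symmetric] to_fract_diff[symmetric] by simp
    from translate_has_class[OF _ xab b0[OF 3(1)] this a' nz(2) _ k0(1)] have "\<exists>S. descent_class S (Point x' y')"
      using TC[OF t] * by simp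
    then show ?thesis using t * by metis
  next
    case 4
    obtain x' y' where *: "P \<oplus>\<^sub>C Point (- sQ) 0 = Point x' y'" "(x + sQ) * (x' + sQ) = sQ * (sQ - s)"
      using ec_add_two_torsion(3)[OF on y0] Pxy by blast
    have t: "Point (- sQ) 0 \<in> two_torsion" by (simp add: two_torsion_def)
    obtain a' where a': "a + X ^ (N + 1) * b = X ^ (N + 2) * a'" using 4 by (auto elim: dvdE)
    have "X ^ (N + 1) * (X ^ (N + 1) - X) = X ^ (N + 2) * (X ^ N - 1)" unfolding power_add by algebra
    then have "(x + to_fract (X ^ (N + 1))) * (x' + to_fract (X ^ (N + 1))) = to_fract (X ^ (N + 2) * (X ^ N - 1))"
      using *(2) unfolding s to_fract_mult[symmetric] to_fract_diff[symmetric] by simp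
    from translate_has_class[OF _ xab b0[OF 4(1)] this a' nz(3) _ k0(2)] have "\<exists>S. descent_class S (Point x' y')"
      using TC[OF t] * by simp
    then show ?thesis using t * by metis
  qed
qed

definition R_pt :: "nat \<Rightarrow> 'k poly fract ec_point" where "R_pt i = Point (const_rf (e i)) (\<eta> i)"

definition R_comb :: "(nat \<Rightarrow> int) \<Rightarrow> 'k poly fract ec_point" where
  "R_comb n = finprod G (\<lambda>i. R_pt i [^]\<^bsub>G\<^esub> n i) {..<N}"

lemma R_pt_closed: "i < N \<Longrightarrow> R_pt i \<in> carrier G"
  using R_on by (simp add: R_pt_def)

lemma R_pt_pow_closed: "i < N \<Longrightarrow> R_pt i [^]\<^bsub>G\<^esub> (k::int) \<in> C"
  using G.int_pow_closed[OF R_pt_closed] by simp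

lemma R_comb_closed: "R_comb n \<in> carrier G"
  unfolding R_comb_def by (intro G.finprod_closed) (auto intro: R_pt_pow_closed)

lemma descent_class_R_pow:
  assumes i: "i < N"
  shows "descent_class (if odd k then {i} else {}) (R_pt i [^]\<^bsub>G\<^esub> (k::int))"
proof -
  have nat: "descent_class (if odd m then {i} else {}) (R_pt i [^]\<^bsub>G\<^esub> m)" for m :: nat
  proof (induction m)
    case (Suc m)
    have "descent_class (sdiff (if odd m then {i} else {}) {i}) ((R_pt i [^]\<^bsub>G\<^esub> m) \<oplus>\<^sub>C R_pt i)"
      using Suc descent_class_R[OF i] by (intro descent_class_add) (simp_all add: R_pt_def)
    moreover have "sdiff (if odd m then {i} else {}) {i} = (if odd (Suc m) then {i} else {})" by auto
    ultimately show ?case by simp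
  qed simp
  show ?thesis
  proof (cases "k < 0")
    case True
    then have "(if odd (nat (- k)) then {i} else {}) = (if odd k then {i} else {})" using even_nat_iff[of "- k"] by (auto simp del: even_nat_iff)
    moreover have "R_pt i [^]\<^bsub>G\<^esub> k = ec_neg (R_pt i [^]\<^bsub>G\<^esub> nat (- k))"
    proof -
      have "R_pt i [^]\<^bsub>G\<^esub> nat (- k) \<in> C" using G.nat_pow_closed[OF R_pt_closed[OF i], of "nat (- k)"] by simp
      from ec_group_inv[OF this] show ?thesis unfolding int_pow_def2 if_P[OF True] .
    qed
    ultimately show ?thesis using descent_class_neg[OF nat[of "nat (- k)"]] by (simp only:)
  next
    case False
    then have "even (nat k) \<longleftrightarrow> even k" using even_nat_iff[of k] by linarith
    then have "(if odd (nat k) then {i} else {}) = (if odd k then {i} else {})" by (simp only:)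
    moreover have "R_pt i [^]\<^bsub>G\<^esub> k = R_pt i [^]\<^bsub>G\<^esub> nat k" unfolding int_pow_def2 if_not_P[OF False] ..
    ultimately show ?thesis using nat[of "nat k"] by (simp only:)
  qed
qed

lemma descent_class_R_comb: "descent_class {i\<in>{..<N}. odd (n i)} (R_comb n)"
proof -
  have "descent_class {i\<in>I. odd (n i)} (finprod G (\<lambda>i. R_pt i [^]\<^bsub>G\<^esub> n i) I)" if "finite I" "I \<subseteq> {..<N}" for I
    using that
  proof (induction I)
    case (insert j I)
    then have j: "j < N" by auto
    have "finprod G (\<lambda>i. R_pt i [^]\<^bsub>G\<^esub> n i) (insert j I) = (R_pt j [^]\<^bsub>G\<^esub> n j) \<oplus>\<^sub>C finprod G (\<lambda>i. R_pt i [^]\<^bsub>G\<^esub> n i) I"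
      using insert j by (subst G.finprod_insert) (auto intro: R_pt_pow_closed)
    moreover have "descent_class (sdiff (if odd (n j) then {j} else {}) {i\<in>I. odd (n i)}) ((R_pt j [^]\<^bsub>G\<^esub> n j) \<oplus>\<^sub>C finprod G (\<lambda>i. R_pt i [^]\<^bsub>G\<^esub> n i) I)"
      using insert descent_class_R_pow[OF j] by (intro descent_class_add) auto
    moreover have "sdiff (if odd (n j) then {j} else {}) {i\<in>I. odd (n i)} = {i\<in>insert j I. odd (n i)}"
      using insert by auto
    ultimately show ?case by simp
  qed simp
  from this[of "{..<N}"] show ?thesis unfolding R_comb_def by simp
qed

lemma R_comb_add: "R_comb (\<lambda>i. m i + n i) = R_comb m \<otimes>\<^bsub>G\<^esub> R_comb n"
proof -
  have "R_comb (\<lambda>i. m i + n i) = finprod G (\<lambda>i. (R_pt i [^]\<^bsub>G\<^esub> m i) \<otimes>\<^bsub>G\<^esub> (R_pt i [^]\<^bsub>G\<^esub> n i)) {..<N}"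
    unfolding R_comb_def by (intro G.finprod_cong') (use G.int_pow_mult[OF R_pt_closed] in \<open>auto intro: ec_add_closed R_pt_pow_closed\<close>)
  also have "\<dots> = R_comb m \<otimes>\<^bsub>G\<^esub> R_comb n"
    unfolding R_comb_def by (intro G.finprod_multf) (auto intro: R_pt_pow_closed)
  finally show ?thesis .
qed

text \<open>
  Infinite descent: a combination that is 2-torsion is \<open>0\<close> because it has a descent class, so its
  class is empty and all coefficients are even; halving them gives again a 2-torsion combination.
\<close>

lemma R_comb_torsion_imp_zero:
  assumes "R_comb n \<in> two_torsion" shows "\<forall>i<N. n i = 0"
  using assms
proof (induction "\<Sum>i<N. nat \<bar>n i\<bar>" arbitrary: n rule: less_induct)
  case less
  have "R_comb n = Infinity" using descent_class_two_torsion[OF descent_class_R_comb less.prems] .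
  then have even: "even (n i)" if "i < N" for i using descent_class_R_comb[of n] that by auto
  define m where "m = (\<lambda>i. n i div 2)"
  have n: "n i = m i + m i" if "i < N" for i using even[OF that] by (auto simp: m_def)
  have "R_comb n = R_comb (\<lambda>i. m i + m i)" unfolding R_comb_def using n by (intro G.finprod_cong') (auto intro: R_pt_pow_closed)
  then have "R_comb m \<oplus>\<^sub>C R_comb m = Infinity" using R_comb_add[of m m] \<open>R_comb n = Infinity\<close> by simp
  then have mT: "R_comb m \<in> two_torsion" using R_comb_closed[of m] two_torsion_iff by simp
  show ?case
  proof (rule ccontr)
    assume "\<not> ?thesis"
    then obtain j where j: "j < N" "n j \<noteq> 0" by blast
    have le: "nat \<bar>m i\<bar> \<le> nat \<bar>n i\<bar>" if "i < N" for i using n[OF that] by simp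
    have "nat \<bar>m j\<bar> < nat \<bar>n j\<bar>" using n[OF j(1)] j(2) by linarith
    then have "(\<Sum>i<N. nat \<bar>m i\<bar>) < (\<Sum>i<N. nat \<bar>n i\<bar>)" using le j by (intro sum_strict_mono_ex1) auto
    from less.hyps[OF this mT] show False using n j by auto
  qed
qed

text \<open>
  Representatives of the cosets of the doubles, one for each descent class and 2-torsion point.
\<close>

definition reps :: "'k poly fract ec_point set" where
  "reps = {t \<oplus>\<^sub>C R_comb (\<lambda>i. if i \<in> S then 1 else 0) | t S. t \<in> two_torsion \<and> S \<subseteq> {..<N}}"

lemma finite_reps: "finite reps"
proof -
  have "reps = (\<lambda>(t, S). t \<oplus>\<^sub>C R_comb (\<lambda>i. if i \<in> S then 1 else 0)) ` (two_torsion \<times> Pow {..<N})"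
    by (auto simp: reps_def)
  then show ?thesis by (simp add: two_torsion_def)
qed

lemma reps_closed: "reps \<subseteq> C"
proof -
  have "R_comb n \<in> C" for n using R_comb_closed by simp
  then show ?thesis using two_torsion_iff ec_add_closed unfolding reps_def by blast
qed

lemma exists_rep:
  assumes P: "P \<in> C"
  shows "\<exists>r\<in>reps. \<exists>P'\<in>C. P \<oplus>\<^sub>C r = P' \<oplus>\<^sub>C P'"
proof -
  obtain t S where t: "t \<in> two_torsion" and S: "descent_class S (P \<oplus>\<^sub>C t)" using exists_torsion_translate_with_class[OF P] by blast
  have SN: "S \<subseteq> {..<N}" using S by (simp add: descent_class_def)
  define c where "c = R_comb (\<lambda>i. if i \<in> S then 1 else 0)"
  have "{i\<in>{..<N}. odd (if i \<in> S then 1 else 0 :: int)} = S" using SN by auto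
  then have "descent_class S c" unfolding c_def using descent_class_R_comb[of "\<lambda>i. if i \<in> S then 1 else 0"] by metis
  from descent_class_add[OF S this] have "descent_class {} ((P \<oplus>\<^sub>C t) \<oplus>\<^sub>C c)" by simp
  then obtain P' where "P' \<in> C" "P' \<oplus>\<^sub>C P' = (P \<oplus>\<^sub>C t) \<oplus>\<^sub>C c" using descent_class_halving by blast
  moreover have "t \<in> C" "c \<in> C" using t two_torsion_iff R_comb_closed by (auto simp: c_def)
  ultimately have "P \<oplus>\<^sub>C (t \<oplus>\<^sub>C c) = P' \<oplus>\<^sub>C P'" using ec_add_assoc[OF P] by simp
  moreover have "t \<oplus>\<^sub>C c \<in> reps" unfolding reps_def c_def using t SN by blast
  ultimately show ?thesis using \<open>P' \<in> C\<close> by blast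
qed

end

section \<open>Heights and finiteness of the index\<close>

text \<open>
  If every element is, modulo \<open>H\<close>, the double of an element of about half the height, then for every
  large \<open>m\<close> it is \<open>2\<^sup>m\<close> times an element of height at most \<open>K\<close>.  So finitely many cosets of \<open>H\<close>, for
  which a common \<open>m\<close> exists, are never more than there are elements of height at most \<open>K\<close>.
\<close>

lemma (in comm_group) finite_index_by_descent:
  fixes h :: "nat \<Rightarrow> 'a \<Rightarrow> bool"
  assumes H: "subgroup H G"
    and total: "\<And>P. P \<in> carrier G \<Longrightarrow> \<exists>n. h n P"
    and fin: "finite {P \<in> carrier G. h K P}"
    and mono: "\<And>m n P. h m P \<Longrightarrow> m \<le> n \<Longrightarrow> h n P"
    and descent: "\<And>n P. P \<in> carrier G \<Longrightarrow> h n P \<Longrightarrow>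
      \<exists>P'\<in>carrier G. \<exists>r\<in>H. \<exists>n'. P \<otimes> r = P' \<otimes> P' \<and> h n' P' \<and> 2 * n' \<le> n + K"
  shows "finite (rcosets H)"
proof -
  let ?S = "{P \<in> carrier G. h K P}"
  have HG: "r \<in> carrier G" if "r \<in> H" for r using subgroup.mem_carrier[OF H that] .
  have claim: "\<exists>Q\<in>?S. \<exists>r\<in>H. P \<otimes> r = Q [^] ((2::nat) ^ m)" if "P \<in> carrier G" "h n P" "n \<le> K + m" for m n P
    using that
  proof (induction m arbitrary: n P)
    case 0
    then have "h K P" using mono by auto
    then show ?case using 0 subgroup.one_closed[OF H] by (intro bexI[of _ P] bexI[of _ \<one>]) auto
  next
    case (Suc m)
    obtain P' r n' where *: "P' \<in> carrier G" "r \<in> H" "P \<otimes> r = P' \<otimes> P'" "h n' P'" "2 * n' \<le> n + K"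
      using descent[OF Suc.prems(1,2)] by blast
    then have "n' \<le> K + m" using Suc.prems(3) by linarith
    from Suc.IH[OF *(1,4) this] obtain Q r' where Q: "Q \<in> ?S" "r' \<in> H" "P' \<otimes> r' = Q [^] ((2::nat) ^ m)" by blast
    have "P \<otimes> (r \<otimes> (r' \<otimes> r')) = (P \<otimes> r) \<otimes> (r' \<otimes> r')" by (rule m_assoc[symmetric]) (use Suc.prems(1) HG * Q in auto)
    also have "\<dots> = (P' \<otimes> r') \<otimes> (P' \<otimes> r')" unfolding *(3) using *(1) HG[OF Q(2)] by (simp add: m_ac)
    also have "\<dots> = Q [^] ((2::nat) ^ Suc m)" unfolding Q(3) using Q(1) by (simp add: nat_pow_mult mult_2)
    finally show ?case using Q H * by (meson subgroup.m_closed)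
  qed
  have bound: "card F \<le> card ?S" if F: "F \<subseteq> rcosets H" "finite F" for F
  proof -
    have "\<exists>P n. P \<in> carrier G \<and> c = H #> P \<and> h n P" if "c \<in> F" for c
    proof -
      have "c \<in> rcosets H" using that F by blast
      then obtain P where "P \<in> carrier G" "c = H #> P" unfolding RCOSETS_def by blast
      then show ?thesis using total by blast
    qed
    then obtain P n where Pn: "\<And>c. c \<in> F \<Longrightarrow> P c \<in> carrier G \<and> c = H #> P c \<and> h (n c) (P c)" by metis
    define m where "m = (\<Sum>c\<in>F. n c)"
    have "F \<subseteq> (\<lambda>Q. H #> Q [^] ((2::nat) ^ m)) ` ?S"
    proof
      fix c assume c: "c \<in> F"
      then have "n c \<le> K + m" unfolding m_def using member_le_sum[of c F n] F by auto
      with claim Pn[OF c] obtain Q r where Q: "Q \<in> ?S" "r \<in> H" "P c \<otimes> r = Q [^] ((2::nat) ^ m)" by blast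
      have "H #> Q [^] ((2::nat) ^ m) = H #> (r \<otimes> P c)" using Q Pn[OF c] HG by (simp add: m_comm flip: Q(3))
      also have "\<dots> = (H #> r) #> P c" using Pn[OF c] HG[OF Q(2)] subgroup.subset[OF H] by (simp add: coset_mult_assoc)
      also have "H #> r = H" using Q(2) H HG by (simp add: coset_join2)
      finally show "c \<in> (\<lambda>Q. H #> Q [^] ((2::nat) ^ m)) ` ?S" using Pn[OF c] Q by blast
    qed
    then have "card F \<le> card ((\<lambda>Q. H #> Q [^] ((2::nat) ^ m)) ` ?S)" using fin by (intro card_mono) auto
    also have "\<dots> \<le> card ?S" using fin by (rule card_image_le)
    finally show ?thesis .
  qed
  show ?thesis
  proof (rule ccontr)
    assume "infinite (rcosets H)"
    from infinite_arbitrarily_large[OF this, of "Suc (card ?S)"]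
    obtain F where F: "finite F" "card F = Suc (card ?S)" "F \<subseteq> rcosets H" by metis
    from bound[OF F(3,1)] F(2) show False by simp
  qed
qed

text \<open>
  \<open>ht n z\<close> says that the height of \<open>z\<close> is at most \<open>n\<close>.  With bounds in place of a height function, an upper
  bound needs only some presentation as a quotient, not one in lowest terms.
\<close>

definition ht :: "nat \<Rightarrow> 'k::field poly fract \<Rightarrow> bool" where
  "ht n z \<longleftrightarrow> (\<exists>p q. q \<noteq> 0 \<and> z = to_fract p / to_fract q \<and> degree p \<le> n \<and> degree q \<le> n)"

lemma ht_mono: "ht m z \<Longrightarrow> m \<le> n \<Longrightarrow> ht n z"
proof -
  assume "ht m z" "m \<le> n"
  then obtain p q where "q \<noteq> 0" "z = to_fract p / to_fract q" "degree p \<le> m" "degree q \<le> m"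
    unfolding ht_def by blast
  then show "ht n z" unfolding ht_def using \<open>m \<le> n\<close> by (intro exI[of _ p] exI[of _ q]) auto
qed

lemma ht_exists: "\<exists>n. ht n z"
proof -
  obtain p q where "z = Fract p q" "q \<noteq> 0" by (cases z)
  then have "ht (max (degree p) (degree q)) z" unfolding ht_def Fract_conv_divide
    by (intro exI[of _ p] exI[of _ q]) auto
  then show ?thesis by blast
qed

lemma finite_ht: "finite {z :: 'k::{field,finite} poly fract. ht n z}"
proof -
  let ?P = "{p :: 'k poly. degree p \<le> n}"
  have "?P \<subseteq> Poly ` {xs. set xs \<subseteq> (UNIV :: 'k set) \<and> length xs \<le> n + 1}"
  proof
    fix p :: "'k poly" assume "p \<in> ?P"
    then have "length (coeffs p) \<le> n + 1" by (cases "p = 0") (simp_all add: length_coeffs_degree)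
    then show "p \<in> Poly ` {xs. set xs \<subseteq> (UNIV :: 'k set) \<and> length xs \<le> n + 1}"
      by (intro image_eqI[of _ _ "coeffs p"]) auto
  qed
  moreover have "finite {xs. set xs \<subseteq> (UNIV :: 'k set) \<and> length xs \<le> n + 1}" by (rule finite_lists_length_le) simp
  ultimately have "finite ?P" by (meson finite_imageI finite_subset)
  then have "finite ((\<lambda>(p, q). to_fract p / to_fract q) ` (?P \<times> ?P))" by simp
  then show ?thesis by (rule rev_finite_subset) (auto simp: ht_def)
qed

lemma ht_reduced:
  fixes z :: "'k::field poly fract"
  assumes "ht n z" "z = to_fract p / to_fract q" "q \<noteq> 0" "u * p + v * q = 1"
  shows "degree p \<le> n" "degree q \<le> n"
proof -
  obtain p' q' where *: "q' \<noteq> 0" "z = to_fract p' / to_fract q'" "degree p' \<le> n" "degree q' \<le> n"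
    using assms(1) by (auto simp: ht_def)
  have "to_fract p * to_fract q' = to_fract p' * to_fract q" using * assms(2,3) by (simp add: field_simps)
  then have eq: "p * q' = p' * q" by (simp flip: to_fract_mult)
  have "v * q + u * p = 1" using assms(4) by (simp add: add.commute)
  moreover have "q dvd p * q'" unfolding eq by simp
  ultimately have "q dvd q'" by (rule bezout_dvd_cancel)
  then obtain k where k: "q' = q * k" by (auto elim: dvdE)
  then have "k \<noteq> 0" using * by auto
  have "q * (p * k) = q * p'" using eq k by (simp add: mult_ac)
  then have p': "p' = p * k" using assms(3) by simp
  show "degree q \<le> n" using * k assms(3) \<open>k \<noteq> 0\<close> by (simp add: degree_mult_eq)
  show "degree p \<le> n" using * p' \<open>k \<noteq> 0\<close> by (cases "p = 0") (simp_all add: degree_mult_eq)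
qed

text \<open>
  Gauss's lemma: for a root \<open>p / q\<close> in lowest terms, \<open>q\<close> divides \<open>D\<close> and \<open>p\<close> divides \<open>M\<close>, or \<open>S\<close> in
  case \<open>M = 0\<close>.
\<close>

lemma ht_quadratic:
  fixes z :: "'k::field poly fract"
  assumes eq: "to_fract D * z^2 - to_fract S * z + to_fract M = 0" and D: "D \<noteq> 0"
    and deg: "degree D \<le> n" "degree S \<le> n" "degree M \<le> n"
  shows "ht n z"
proof -
  obtain p q u v where "z = Fract p q" and q: "q \<noteq> 0" and pq: "u * p + v * q = 1" by (rule Fract_reduced_cases)
  then have z: "z = to_fract p / to_fract q" by (simp add: Fract_conv_divide)
  have "to_fract q \<noteq> 0" using q by simp
  then have p: "to_fract p = z * to_fract q" using z by simp
  have "to_fract D * to_fract p^2 - to_fract S * to_fract p * to_fract q + to_fract M * to_fract q^2 = 0"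
    unfolding p using eq by algebra
  then have e: "D * p^2 - S * p * q + M * q^2 = 0"
    by (simp only: flip: to_fract_power to_fract_mult to_fract_diff to_fract_add) (simp only: to_fract_eq_0_iff)
  have qp: "v * q + u * p = 1" using pq by (simp add: add.commute)
  have "p * (p * D) = q * (S * p - M * q)" using e by algebra
  then have "q dvd p * (p * D)" by simp
  then have "q dvd D" using bezout_dvd_cancel[OF qp] by blast
  then have dq: "degree q \<le> n" using D deg dvd_imp_degree_le order_trans by blast
  have "q * (q * M) = p * (S * q - D * p)" using e by algebra
  then have "p dvd q * (q * M)" by simp
  then have pM: "p dvd M" using bezout_dvd_cancel[OF pq] by blast
  have dp: "degree p \<le> n"
  proof (cases "M = 0")
    case False
    then show ?thesis using pM deg dvd_imp_degree_le order_trans by blast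
  next
    case True
    show ?thesis
    proof (cases "p = 0")
      case False
      have "p * (D * p - S * q) = 0" using e True by algebra
      then have DS: "D * p = q * S" using False by (simp add: mult.commute)
      then have "p dvd q * S" by (metis dvd_triv_right)
      then have "p dvd S" using bezout_dvd_cancel[OF pq] by blast
      moreover have "S \<noteq> 0" using DS D False by auto
      ultimately show ?thesis using deg dvd_imp_degree_le order_trans by blast
    qed simp
  qed
  show ?thesis unfolding ht_def using z q dp dq by blast
qed

lemma degree_mult_bound: "degree p \<le> i \<Longrightarrow> degree q \<le> j \<Longrightarrow> i + j \<le> n \<Longrightarrow> degree (p * q) \<le> n"
  using degree_mult_le[of p q] by linarith

lemma degree_numeral_mult: "degree (numeral k * p) \<le> degree p"
  using degree_mult_le[of "numeral k" p] by simp

lemma degree_numeral_bound: "degree p \<le> n \<Longrightarrow> degree (numeral k * p) \<le> n"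
  using degree_numeral_mult[of k p] by linarith

fun point_ht :: "nat \<Rightarrow> 'k::field poly fract ec_point \<Rightarrow> bool" where
  "point_ht n Infinity = True"
| "point_ht n (Point x y) = ht n x"

lemma point_ht_mono: "point_ht m P \<Longrightarrow> m \<le> n \<Longrightarrow> point_ht n P"
  by (cases P) (auto intro: ht_mono)

lemma point_ht_exists: "\<exists>n. point_ht n P"
  by (cases P) (auto intro: ht_exists)

lemma finite_point_ht: "finite {P \<in> ec_points a b. point_ht n (P :: 'k::{field,finite} poly fract ec_point)}"
proof -
  have "finite {y :: 'k poly fract. y^2 = c}" for c
  proof (cases "\<exists>w. w^2 = c")
    case True
    then obtain w where "w^2 = c" by blast
    then have "{y. y^2 = c} \<subseteq> {w, -w}" by (auto simp: power2_eq_iff)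
    then show ?thesis by (rule finite_subset) simp
  qed auto
  then have "finite (insert Infinity (\<Union>x\<in>{z. ht n z}. Point x ` {y :: 'k poly fract. y^2 = x * (x + a) * (x + b)}))"
    using finite_ht by blast
  moreover have "{P \<in> ec_points a b. point_ht n P} \<subseteq>
    insert Infinity (\<Union>x\<in>{z. ht n z}. Point x ` {y. y^2 = x * (x + a) * (x + b)})"
    by (auto simp: ec_points_def)
  ultimately show ?thesis by (rule rev_finite_subset)
qed

locale polynomial_legendre_curve =
  fixes \<alpha> \<beta> :: "'k::field poly"
  assumes curve: "legendre_curve (to_fract \<alpha>) (to_fract \<beta>)"
begin

sublocale legendre_curve "to_fract \<alpha>" "to_fract \<beta>" by (rule curve)

abbreviation PC :: "'k poly fract ec_point set" where "PC \<equiv> ec_points (to_fract \<alpha>) (to_fract \<beta>)"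
abbreviation PCadd (infixl "\<oplus>\<^sub>P" 65) where "P \<oplus>\<^sub>P Q \<equiv> ec_add (to_fract \<alpha>) (to_fract \<beta>) P Q"

text \<open>
  The abscissa of \<open>P + Q\<close> is a root of a quadratic whose coefficients have degree 2 in the abscissa of
  \<open>P\<close>, once denominators are cleared.
\<close>

lemma point_ht_add:
  assumes Q: "Q \<in> PC"
  shows "\<exists>K. \<forall>n P. P \<in> PC \<longrightarrow> point_ht n P \<longrightarrow> point_ht (2 * n + K) (P \<oplus>\<^sub>P Q)"
proof (cases Q)
  case Infinity
  then have "P \<oplus>\<^sub>P Q = P" for P by (cases P) auto
  then show ?thesis by (intro exI[of _ 0] allI impI) (simp, erule point_ht_mono, simp)
next
  case (Point x2 y2)
  obtain m where "ht m x2" using ht_exists by blast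
  then obtain p2 q2 where x2: "q2 \<noteq> 0" "x2 = to_fract p2 / to_fract q2" "degree p2 \<le> m" "degree q2 \<le> m"
    by (auto simp: ht_def)
  obtain j where j: "point_ht j (Q \<oplus>\<^sub>P Q)" using point_ht_exists by blast
  define d where "d = degree \<alpha> + degree \<beta>"
  have da: "degree \<alpha> \<le> d" "degree \<beta> \<le> d" by (simp_all add: d_def)
  define K where "K = 2 * m + 2 * d + j"
  have "point_ht (2 * n + K) (P \<oplus>\<^sub>P Q)" if P: "P \<in> PC" "point_ht n P" for n P
  proof (cases "P = Infinity \<or> P = Q \<or> P \<oplus>\<^sub>P Q = Infinity")
    case True
    have "ht (2 * n + K) x2" using \<open>ht m x2\<close> by (rule ht_mono) (simp add: K_def)
    moreover have "point_ht (2 * n + K) (Q \<oplus>\<^sub>P Q)" using j by (rule point_ht_mono) (simp add: K_def)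
    ultimately show ?thesis using True by (elim disjE) (auto simp: Point)
  next
    case False
    then obtain x1 y1 x3 y3 where Pxy: "P = Point x1 y1" and R: "P \<oplus>\<^sub>P Q = Point x3 y3"
      by (cases P; cases "P \<oplus>\<^sub>P Q") auto
    have ne: "x1 \<noteq> x2"
    proof
      assume eq: "x1 = x2"
      have "(y1 - y2) * (y1 + y2) = 0" using P Q eq Pxy Point by (simp add: algebra_simps power2_eq_square)
      then have "y1 = y2 \<or> y1 = - y2" by (auto simp: eq_neg_iff_add_eq_0)
      then show False using False eq Pxy Point by auto
    qed
    obtain p q where x1: "q \<noteq> 0" "x1 = to_fract p / to_fract q" "degree p \<le> n" "degree q \<le> n"
      using P Pxy by (auto simp: ht_def)
    let ?f = "to_fract :: 'k poly \<Rightarrow> _"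
    have eq: "(x1 - x2)^2 * x3^2 - 2 * ((x1 + x2) * (x1 * x2 + ?f \<alpha> * ?f \<beta>) + 2 * (?f \<alpha> + ?f \<beta>) * x1 * x2) * x3 + (x1 * x2 - ?f \<alpha> * ?f \<beta>)^2 = 0"
      using ec_add_x_quadratic[of x1 y1 x2 y2 x3 y3] P Q ne R Pxy Point by simp
    have f: "?f p = x1 * ?f q" "?f p2 = x2 * ?f q2" using x1 x2 by auto
    define D where "D = (p * q2 - p2 * q)^2"
    define S where "S = 2 * ((p * q2 + p2 * q) * (p * p2 + \<alpha> * \<beta> * (q * q2)) + 2 * ((\<alpha> + \<beta>) * (p * q) * (p2 * q2)))"
    define M where "M = (p * p2 - \<alpha> * \<beta> * (q * q2))^2"
    have fD: "?f D = (?f p * ?f q2 - ?f p2 * ?f q)^2"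
      unfolding D_def to_fract_power to_fract_diff to_fract_mult ..
    have num2: "?f 2 = 2" by (metis one_add_one to_fract_1 to_fract_add)
    have fS: "?f S = 2 * ((?f p * ?f q2 + ?f p2 * ?f q) * (?f p * ?f p2 + ?f \<alpha> * ?f \<beta> * (?f q * ?f q2)) + 2 * ((?f \<alpha> + ?f \<beta>) * (?f p * ?f q) * (?f p2 * ?f q2)))"
      unfolding S_def to_fract_power to_fract_diff to_fract_mult to_fract_add num2 ..
    have fM: "?f M = (?f p * ?f p2 - ?f \<alpha> * ?f \<beta> * (?f q * ?f q2))^2"
      unfolding M_def to_fract_power to_fract_diff to_fract_mult to_fract_add ..
    have "?f D * x3^2 - ?f S * x3 + ?f M = 0"
      unfolding fD fS fM f using eq by algebra
    moreover have "D \<noteq> 0"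
    proof
      assume "D = 0"
      then have "?f D = 0" by simp
      then have "?f q * ?f q2 * (x1 - x2) = 0" unfolding fD f by (simp add: algebra_simps)
      then show False using x1(1) x2(1) ne by simp
    qed
    moreover have "degree D \<le> 2 * n + K"
    proof -
      have dd: "degree (p * q2 - p2 * q) \<le> n + m"
        by (intro degree_diff_le degree_mult_bound[of _ n _ m] degree_mult_bound[of _ m _ n] x1 x2) auto
      show ?thesis unfolding D_def power2_eq_square by (rule degree_mult_bound[OF dd dd]) (simp add: K_def)
    qed
    moreover have dab: "degree (\<alpha> * \<beta>) \<le> d" "degree (\<alpha> + \<beta>) \<le> d"
      using degree_mult_le[of \<alpha> \<beta>] degree_add_le[of \<alpha> d \<beta>] da by (auto simp: d_def)
    have dM: "degree (\<alpha> * \<beta> * (q * q2)) \<le> n + m + d"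
      by (rule degree_mult_bound[OF dab(1) degree_mult_bound[OF x1(4) x2(4) order_refl]]) simp
    have dpp: "degree (p * p2) \<le> n + m + d" by (rule degree_mult_bound[OF x1(3) x2(3)]) simp
    have "degree M \<le> 2 * n + K"
    proof -
      have dd: "degree (p * p2 - \<alpha> * \<beta> * (q * q2)) \<le> n + m + d" using dM dpp by (rule degree_diff_le[rotated])
      show ?thesis unfolding M_def power2_eq_square by (rule degree_mult_bound[OF dd dd]) (simp add: K_def)
    qed
    moreover have "degree S \<le> 2 * n + K"
    proof -
      have 1: "degree (p * q2 + p2 * q) \<le> n + m"
        by (intro degree_add_le degree_mult_bound[of _ n _ m] degree_mult_bound[of _ m _ n] x1 x2) auto
      have 2: "degree (p * p2 + \<alpha> * \<beta> * (q * q2)) \<le> n + m + d" using dpp dM by (rule degree_add_le)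
      have 3: "degree (p * q) \<le> n + n" by (rule degree_mult_bound[OF x1(3,4)]) simp
      have 4: "degree (p2 * q2) \<le> m + m" by (rule degree_mult_bound[OF x2(3,4)]) simp
      have 5: "degree ((\<alpha> + \<beta>) * (p * q) * (p2 * q2)) \<le> 2 * n + K"
        by (rule degree_mult_bound[OF degree_mult_bound[OF dab(2) 3 order_refl] 4]) (simp add: K_def)
      have 6: "degree ((p * q2 + p2 * q) * (p * p2 + \<alpha> * \<beta> * (q * q2))) \<le> 2 * n + K"
        by (rule degree_mult_bound[OF 1 2]) (simp add: K_def)
      show ?thesis unfolding S_def by (intro degree_numeral_bound degree_add_le 5 6)
    qed
    ultimately show ?thesis unfolding R using ht_quadratic by simp
  qed
  then show ?thesis by blast
qed

text \<open>
  The abscissa of \<open>2 P\<close> is a quotient \<open>NN / DD\<close> of forms of degree 4 in the numerator \<open>p\<close> and the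
  denominator \<open>q\<close> of the abscissa of \<open>P\<close>.  The resultant identities \<open>U1 NN + V1 DD = c1 q\<^sup>7\<close> and
  \<open>U2 NN + V2 DD = 4 \<delta> p\<^sup>7\<close> bound the cancellation in this quotient, and they also force \<open>NN\<close> or
  \<open>DD\<close> to have nearly the degree \<open>4 m\<close>, where \<open>m\<close> is the larger degree of \<open>p\<close> and \<open>q\<close>.
\<close>

lemma point_ht_double:
  "\<exists>K. \<forall>n P. P \<in> PC \<longrightarrow> point_ht n (P \<oplus>\<^sub>P P) \<longrightarrow> (\<exists>m. point_ht m P \<and> 4 * m \<le> n + K)"
proof -
  let ?f = "to_fract :: 'k poly \<Rightarrow> _"
  define \<tau> where "\<tau> = \<alpha> * \<beta>"
  define \<sigma> where "\<sigma> = \<alpha> + \<beta>"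
  define \<delta> where "\<delta> = (\<alpha> - \<beta>)^2"
  define d where "d = degree \<tau> + degree \<sigma> + degree \<delta>"
  \<comment> \<open>Up to the factor 4, the discriminant of \<open>x (x + \<alpha>) (x + \<beta>)\<close>.\<close>
  define c1 where "c1 = 4 * \<tau>^2 * \<delta>"
  have nz: "\<tau> \<noteq> 0" "\<delta> \<noteq> 0" using a_neq_0 b_neq_0 a_neq_b by (auto simp: \<tau>_def \<delta>_def)
  have num2: "?f 2 = 2" by (metis one_add_one to_fract_1 to_fract_add)
  have "(2 :: 'k poly) \<noteq> 0" using two_neq_0 num2 by auto
  moreover have "(4 :: 'k poly) = 2 * 2" by simp
  ultimately have four: "(4 :: 'k poly) \<noteq> 0" by (metis mult_eq_0_iff)
  have c1: "c1 \<noteq> 0" using nz four by (simp add: c1_def)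
  have "finite {P \<in> PC. P \<oplus>\<^sub>P P = Infinity}"
    by (rule finite_subset[of _ "{Infinity, Point 0 0, Point (- ?f \<alpha>) 0, Point (- ?f \<beta>) 0}"])
      (use ec_add_self_eq_Infinity_iff in auto)
  then have "\<exists>m. \<forall>P\<in>{P \<in> PC. P \<oplus>\<^sub>P P = Infinity}. point_ht m P"
  proof (induction rule: finite_induct)
    case (insert P F)
    then obtain m where m: "\<forall>P\<in>F. point_ht m P" by blast
    obtain m' where "point_ht m' P" using point_ht_exists by blast
    with m show ?case by (intro exI[of _ "max m m'"]) (auto intro: point_ht_mono)
  qed simp
  then obtain m0 where m0: "\<And>P. P \<in> PC \<Longrightarrow> P \<oplus>\<^sub>P P = Infinity \<Longrightarrow> point_ht m0 P" by blast
  define K where "K = 4 * m0 + 4 * d + degree c1"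
  have "\<exists>m. point_ht m P \<and> 4 * m \<le> n + K" if P: "P \<in> PC" "point_ht n (P \<oplus>\<^sub>P P)" for n P
  proof (cases "P \<oplus>\<^sub>P P = Infinity")
    case True
    then show ?thesis using m0[OF P(1)] by (intro exI[of _ m0]) (simp add: K_def)
  next
    case False
    then obtain x y x3 y3 where Pxy: "P = Point x y" and R: "P \<oplus>\<^sub>P P = Point x3 y3"
      by (cases P; cases "P \<oplus>\<^sub>P P") auto
    obtain p q u v where "x = Fract p q" and q: "q \<noteq> 0" and pq: "u * p + v * q = 1" by (rule Fract_reduced_cases)
    then have x: "x = ?f p / ?f q" by (simp add: Fract_conv_divide)
    obtain p3 q3 u3 v3 where "x3 = Fract p3 q3" and q3: "q3 \<noteq> 0" and pq3: "u3 * p3 + v3 * q3 = 1" by (rule Fract_reduced_cases)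
    then have x3: "x3 = ?f p3 / ?f q3" by (simp add: Fract_conv_divide)
    have "ht n x3" using P(2) R by simp
    from ht_reduced[OF this x3 q3 pq3] have d3: "degree p3 \<le> n" "degree q3 \<le> n" .
    have fp: "?f p = x * ?f q" and fp3: "?f p3 = x3 * ?f q3" using x x3 q q3 by auto
    define NN where "NN = (p^2 - \<tau> * q^2)^2"
    define DD where "DD = 4 * p * q * (p + \<alpha> * q) * (p + \<beta> * q)"
    have num4: "?f 4 = 4" 
    proof -
      have "?f (2 * 2) = 2 * 2" unfolding to_fract_mult num2 ..
      then show ?thesis by simp
    qed
    have dbl: "4 * x * (x + ?f \<alpha>) * (x + ?f \<beta>) * x3 = (x^2 - ?f \<alpha> * ?f \<beta>)^2"
      using ec_double_x[of x y x3 y3] P(1) R Pxy by simp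
    have "?f DD * ?f p3 = ?f NN * ?f q3"
      unfolding DD_def NN_def \<tau>_def to_fract_power to_fract_diff to_fract_mult to_fract_add num4 fp fp3 using dbl by algebra
    then have e: "DD * p3 = NN * q3" by (simp flip: to_fract_mult)
    \<comment> \<open>The common factor by which \<open>NN / DD\<close> fails to be in lowest terms.\<close>
    define g where "g = u3 * NN + v3 * DD"
    have Ng: "NN = g * p3" and Dg: "DD = g * q3"
      using pq3 e unfolding g_def by algebra+
    define U1 where "U1 = 4 * (\<delta> * (p^0 * q^3) - 2 * (\<sigma> * (p^1 * q^2)) - 3 * (1 * (p^2 * q^1)))"
    define V1 where "V1 = 3 * (1 * (p^3 * q^0)) - \<sigma> * (p^2 * q^1) - 5 * (\<tau> * (p^1 * q^2)) + 2 * (\<sigma> * \<tau> * (p^0 * q^3))"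
    define U2 where "U2 = 4 * (\<delta> * (p^3 * q^0) - 2 * (\<sigma> * \<tau> * (p^2 * q^1)) - 3 * (\<tau> * \<tau> * (p^1 * q^2)))"
    define V2 where "V2 = 3 * (\<tau> * \<tau> * \<tau> * (p^0 * q^3)) - \<sigma> * \<tau> * \<tau> * (p^1 * q^2) - 5 * (\<tau> * \<tau> * (p^2 * q^1)) + 2 * (\<sigma> * \<tau> * (p^3 * q^0))"
    have id1: "U1 * NN + V1 * DD = c1 * q^7"
      unfolding NN_def DD_def c1_def U1_def V1_def \<delta>_def \<sigma>_def \<tau>_def by algebra
    have id2: "U2 * NN + V2 * DD = 4 * \<delta> * p^7"
      unfolding NN_def DD_def U2_def V2_def \<delta>_def \<sigma>_def \<tau>_def by algebra
    have "g dvd c1"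
    proof -
      have "c1 * q^7 = g * (U1 * p3 + V1 * q3)" using id1 Ng Dg by algebra
      then have 1: "g dvd c1 * q^7" by simp
      have "c1 * p^7 = g * (\<tau>^2 * (U2 * p3 + V2 * q3))" using id2 Ng Dg unfolding c1_def by algebra
      then have 2: "g dvd c1 * p^7" by simp
      have "\<exists>u v. u * p + v * q^7 = 1" using bezout_power pq by blast
      then have "\<exists>u v. u * q^7 + v * p = 1" by (metis add.commute)
      then obtain u' v' where "u' * q^7 + v' * p^7 = 1" using bezout_power by blast
      then have "c1 = u' * (c1 * q^7) + v' * (c1 * p^7)" by algebra
      then show ?thesis using 1 2 by (metis dvd_add dvd_mult)
    qed
    then have dg: "degree g \<le> degree c1" using c1 by (rule dvd_imp_degree_le)
    define m where "m = max (degree p) (degree q)"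
    have dN: "degree NN \<le> degree c1 + n" "degree DD \<le> degree c1 + n"
      unfolding Ng Dg using dg d3 by (auto intro: degree_mult_bound)
    have mon: "degree (r * (p^i * q^j)) \<le> 3 * d + 3 * m" if "degree r \<le> 3 * d" "i + j = 3" for r i j
    proof (rule degree_mult_bound[OF that(1) degree_mult_bound[OF degree_power_le degree_power_le order_refl]])
      have "degree p * i + degree q * j \<le> m * i + m * j" unfolding m_def by (intro add_mono mult_right_mono) auto
      also have "\<dots> = m * (i + j)" by (simp only: distrib_left)
      also have "\<dots> = 3 * m" using that(2) by simp
      finally show "3 * d + (degree p * i + degree q * j) \<le> 3 * d + 3 * m" by simp
    qed
    have coef: "degree \<tau> \<le> d" "degree \<sigma> \<le> d" "degree \<delta> \<le> d" by (simp_all add: d_def)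
    have coef2: "degree (\<sigma> * \<tau>) \<le> 2 * d" "degree (\<tau> * \<tau>) \<le> 2 * d"
      by (rule degree_mult_bound[OF coef(2) coef(1)], simp) (rule degree_mult_bound[OF coef(1) coef(1)], simp)
    have coef3: "degree (\<sigma> * \<tau> * \<tau>) \<le> 3 * d" "degree (\<tau> * \<tau> * \<tau>) \<le> 3 * d"
      by (rule degree_mult_bound[OF coef2(1) coef(1)], simp) (rule degree_mult_bound[OF coef2(2) coef(1)], simp)
    have UV: "degree U1 \<le> 3 * d + 3 * m" "degree V1 \<le> 3 * d + 3 * m" "degree U2 \<le> 3 * d + 3 * m" "degree V2 \<le> 3 * d + 3 * m"
      unfolding U1_def V1_def U2_def V2_def
      by (intro degree_numeral_bound degree_add_le degree_diff_le mon; use coef coef2 coef3 in simp)+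
    have "degree (U1 * NN + V1 * DD) \<le> 3 * d + 3 * m + (degree c1 + n)"
      by (intro degree_add_le degree_mult_bound[OF UV(1) dN(1)] degree_mult_bound[OF UV(2) dN(2)] order_refl)
    then have "degree c1 + 7 * degree q \<le> 3 * d + 3 * m + (degree c1 + n)"
      unfolding id1 using c1 q by (simp add: degree_mult_eq degree_power_eq)
    moreover have "7 * degree p \<le> 3 * d + 3 * m + (degree c1 + n)"
    proof (cases "p = 0")
      case False
      have "degree (U2 * NN + V2 * DD) \<le> 3 * d + 3 * m + (degree c1 + n)"
        by (intro degree_add_le degree_mult_bound[OF UV(3) dN(1)] degree_mult_bound[OF UV(4) dN(2)] order_refl)
      then show ?thesis unfolding id2 using nz four False by (simp add: degree_mult_eq degree_power_eq)
    qed simp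
    ultimately have "4 * m \<le> n + K" unfolding m_def K_def by linarith
    moreover have "point_ht m P" unfolding Pxy point_ht.simps ht_def
      using x q by (intro exI[of _ p] exI[of _ q]) (simp add: m_def)
    ultimately show ?thesis by blast
  qed
  then show ?thesis by blast
qed

end

context twisted_legendre
begin

definition torsion_R_span :: "'k poly fract ec_point set" where
  "torsion_R_span = {t \<oplus>\<^sub>C R_comb n | t n. t \<in> two_torsion}"

lemma R_comb_zero: "R_comb (\<lambda>i. 0) = Infinity"
proof -
  have "R_comb (\<lambda>i. 0) \<otimes>\<^bsub>G\<^esub> R_comb (\<lambda>i. 0) = R_comb (\<lambda>i. 0)"
    using R_comb_add[of "\<lambda>i. 0" "\<lambda>i. 0"] by simp
  then have "R_comb (\<lambda>i. 0) = \<one>\<^bsub>G\<^esub>" using G.l_cancel_one[OF R_comb_closed R_comb_closed] by blast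
  then show ?thesis by simp
qed

lemma R_comb_minus: "R_comb (\<lambda>i. - n i) = ec_neg (R_comb n)"
proof -
  have "R_comb (\<lambda>i. - n i) \<oplus>\<^sub>C R_comb n = Infinity" using R_comb_add[of "\<lambda>i. - n i" n] R_comb_zero by simp
  then have "inv\<^bsub>G\<^esub> (R_comb n) = R_comb (\<lambda>i. - n i)" using R_comb_closed by (intro G.inv_equality) auto
  then show ?thesis using ec_group_inv[of "R_comb n"] R_comb_closed by simp
qed

lemma R_comb_C: "R_comb n \<in> C" using R_comb_closed by simp

lemma two_torsion_C: "t \<in> two_torsion \<Longrightarrow> t \<in> C" using two_torsion_iff by blast

lemma two_torsion_add: "t \<in> two_torsion \<Longrightarrow> t' \<in> two_torsion \<Longrightarrow> t \<oplus>\<^sub>C t' \<in> two_torsion"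
proof -
  assume t: "t \<in> two_torsion" "t' \<in> two_torsion"
  then have c: "t \<in> carrier G" "t' \<in> carrier G" using two_torsion_C by auto
  have "(t \<otimes>\<^bsub>G\<^esub> t') \<otimes>\<^bsub>G\<^esub> (t \<otimes>\<^bsub>G\<^esub> t') = (t \<otimes>\<^bsub>G\<^esub> t) \<otimes>\<^bsub>G\<^esub> (t' \<otimes>\<^bsub>G\<^esub> t')"
    using c by (simp add: G.m_ac del: ec_group_sel)
  also have "\<dots> = Infinity" using t two_torsion_iff by simp
  finally show ?thesis using c ec_add_closed by (simp add: two_torsion_iff)
qed

lemma two_torsion_neg: "t \<in> two_torsion \<Longrightarrow> ec_neg t = t"
  by (auto simp: two_torsion_def)

lemma subgroup_torsion_R_span: "subgroup torsion_R_span G"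
proof (rule G.subgroupI)
  show "torsion_R_span \<subseteq> carrier G" using two_torsion_C R_comb_C ec_add_closed by (auto simp: torsion_R_span_def)
  show "torsion_R_span \<noteq> {}" by (auto simp: torsion_R_span_def two_torsion_def)
next
  fix P assume "P \<in> torsion_R_span"
  then obtain t n where tn: "t \<in> two_torsion" "P = t \<oplus>\<^sub>C R_comb n" by (auto simp: torsion_R_span_def)
  have "inv\<^bsub>G\<^esub> P = inv\<^bsub>G\<^esub> t \<oplus>\<^sub>C inv\<^bsub>G\<^esub> (R_comb n)"
    using G.inv_mult[of t "R_comb n"] tn two_torsion_C R_comb_C by simp
  also have "\<dots> = t \<oplus>\<^sub>C R_comb (\<lambda>i. - n i)" using ec_group_inv two_torsion_C[OF tn(1)] R_comb_C two_torsion_neg[OF tn(1)] R_comb_minus by simp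
  finally show "inv\<^bsub>G\<^esub> P \<in> torsion_R_span" using tn by (auto simp: torsion_R_span_def)
next
  fix P Q assume "P \<in> torsion_R_span" "Q \<in> torsion_R_span"
  then obtain t n t' n' where tn: "t \<in> two_torsion" "P = t \<oplus>\<^sub>C R_comb n" "t' \<in> two_torsion" "Q = t' \<oplus>\<^sub>C R_comb n'" by (auto simp: torsion_R_span_def)
  then have c: "t \<in> carrier G" "t' \<in> carrier G" using two_torsion_C by auto
  have "(t \<otimes>\<^bsub>G\<^esub> R_comb n) \<otimes>\<^bsub>G\<^esub> (t' \<otimes>\<^bsub>G\<^esub> R_comb n') = (t \<otimes>\<^bsub>G\<^esub> t') \<otimes>\<^bsub>G\<^esub> (R_comb n \<otimes>\<^bsub>G\<^esub> R_comb n')"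
    using c R_comb_closed by (simp add: G.m_ac del: ec_group_sel)
  then have "P \<otimes>\<^bsub>G\<^esub> Q = (t \<oplus>\<^sub>C t') \<oplus>\<^sub>C R_comb (\<lambda>i. n i + n' i)" using tn R_comb_add by simp
  then show "P \<otimes>\<^bsub>G\<^esub> Q \<in> torsion_R_span" using two_torsion_add tn by (auto simp: torsion_R_span_def)
qed

lemma reps_torsion_R_span: "reps \<subseteq> torsion_R_span"
  by (auto simp: reps_def torsion_R_span_def)

end

locale twisted_legendre_finite = twisted_legendre N e \<eta>
  for N :: nat and e :: "nat \<Rightarrow> 'k::{field,finite}" and \<eta> :: "nat \<Rightarrow> 'k poly fract"
begin

lemma sQ_to_fract: "sQ = to_fract (X ^ (N + 1))"
  unfolding sQ_def var_rf_to_fract to_fract_power ..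

sublocale pol: polynomial_legendre_curve X "X ^ (N + 1)"
proof (rule polynomial_legendre_curve.intro)
  have "legendre_curve (to_fract X) sQ" using legendre_curve_axioms by (simp add: var_rf_to_fract)
  then show "legendre_curve (to_fract X) (to_fract (X ^ (N + 1)))" unfolding sQ_to_fract .
qed

text \<open>
  The constants: \<open>P + r = 2 P'\<close> has height at most \<open>2 n + K1\<close>, so \<open>4 m \<le> 2 n + K1 + K2\<close> for the
  height \<open>m\<close> of \<open>P'\<close>.
\<close>

lemma finite_index_torsion_R_span: "finite (rcosets\<^bsub>G\<^esub> torsion_R_span)"
proof -
  have PC: "pol.PC = C" "ec_add (to_fract X) (to_fract (X ^ (N + 1))) = ec_add s sQ"
    by (simp_all only: sQ_to_fract var_rf_to_fract)
  have "\<exists>K. \<forall>r\<in>F. \<forall>n P. P \<in> C \<longrightarrow> point_ht n P \<longrightarrow> point_ht (2 * n + K) (P \<oplus>\<^sub>C r)"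
    if "finite F" "F \<subseteq> C" for F
    using that
  proof (induction F)
    case (insert r F)
    then obtain K where K: "\<forall>r\<in>F. \<forall>n P. P \<in> C \<longrightarrow> point_ht n P \<longrightarrow> point_ht (2 * n + K) (P \<oplus>\<^sub>C r)" by auto
    obtain K' where K': "\<forall>n P. P \<in> C \<longrightarrow> point_ht n P \<longrightarrow> point_ht (2 * n + K') (P \<oplus>\<^sub>C r)"
      using pol.point_ht_add[of r] insert.prems unfolding PC by blast
    have "point_ht (2 * n + (K + K')) (P \<oplus>\<^sub>C r')" if "r' \<in> insert r F" "P \<in> C" "point_ht n P" for r' n P
    proof (cases "r' = r")
      case True
      then have "point_ht (2 * n + K') (P \<oplus>\<^sub>C r')" using K' that by blast
      then show ?thesis by (rule point_ht_mono) simp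
    next
      case False
      then have "point_ht (2 * n + K) (P \<oplus>\<^sub>C r')" using K that by blast
      then show ?thesis by (rule point_ht_mono) simp
    qed
    then show ?case by blast
  qed simp
  from this[OF finite_reps reps_closed] obtain K1 where
    K1: "\<And>r n P. r \<in> reps \<Longrightarrow> P \<in> C \<Longrightarrow> point_ht n P \<Longrightarrow> point_ht (2 * n + K1) (P \<oplus>\<^sub>C r)" by blast
  obtain K2 where K2: "\<And>n P. P \<in> C \<Longrightarrow> point_ht n (P \<oplus>\<^sub>C P) \<Longrightarrow> \<exists>m. point_ht m P \<and> 4 * m \<le> n + K2"
    using pol.point_ht_double unfolding PC by blast
  show ?thesis
  proof (rule G.finite_index_by_descent[OF subgroup_torsion_R_span, where h = point_ht and K = "K1 + K2"])
    show "\<exists>n. point_ht n P" for P :: "'k poly fract ec_point" by (rule point_ht_exists)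
    show "finite {P \<in> carrier G. point_ht (K1 + K2) P}" by (simp add: finite_point_ht)
    show "point_ht n P" if "point_ht m P" "m \<le> n" for m n and P :: "'k poly fract ec_point"
      using that by (rule point_ht_mono)
    fix n P assume P: "P \<in> carrier G" "point_ht n P"
    then have "P \<in> C" by simp
    from exists_rep[OF this] obtain r P' where r: "r \<in> reps" "P' \<in> C" "P \<oplus>\<^sub>C r = P' \<oplus>\<^sub>C P'" by blast
    have "point_ht (2 * n + K1) (P' \<oplus>\<^sub>C P')" using K1[OF r(1) \<open>P \<in> C\<close> P(2)] unfolding r(3) .
    then obtain m where "point_ht m P'" "4 * m \<le> 2 * n + K1 + K2" using K2[OF r(2)] by blast
    then show "\<exists>P'\<in>carrier G. \<exists>r\<in>torsion_R_span. \<exists>n'. P \<otimes>\<^bsub>G\<^esub> r = P' \<otimes>\<^bsub>G\<^esub> P' \<and> point_ht n' P' \<and> 2 * n' \<le> n + (K1 + K2)"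
      using r reps_torsion_R_span by (intro bexI[of _ P'] bexI[of _ r] exI[of _ m]) auto
  qed
qed

end

section \<open>The quadratic extension\<close>

lemma (in comm_group) finite_rcosets_if_classified:
  assumes H: "subgroup H G" and fin: "finite (\<kappa> ` carrier G)"
    and cls: "\<And>P Q. P \<in> carrier G \<Longrightarrow> Q \<in> carrier G \<Longrightarrow> \<kappa> P = \<kappa> Q \<Longrightarrow> P \<otimes> inv Q \<in> H"
  shows "finite (rcosets H)"
proof -
  define g where "g v = (SOME Q. Q \<in> carrier G \<and> \<kappa> Q = v)" for v
  have g: "g (\<kappa> P) \<in> carrier G \<and> \<kappa> (g (\<kappa> P)) = \<kappa> P" if "P \<in> carrier G" for P
    unfolding g_def by (rule someI[of _ P]) (use that in simp)
  have "rcosets H \<subseteq> (\<lambda>v. H #> g v) ` \<kappa> ` carrier G"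
  proof
    fix c assume "c \<in> rcosets H"
    then obtain P where P: "P \<in> carrier G" "c = H #> P" unfolding RCOSETS_def by blast
    let ?Q = "g (\<kappa> P)"
    have Q: "?Q \<in> carrier G" and h: "P \<otimes> inv ?Q \<in> H" using g[OF P(1)] cls P(1) by auto
    have "P = (P \<otimes> inv ?Q) \<otimes> ?Q" using P(1) Q by (simp add: m_assoc)
    then have "H #> P = (H #> (P \<otimes> inv ?Q)) #> ?Q"
      using P(1) Q subgroup.subset[OF H] by (metis coset_mult_assoc inv_closed m_closed)
    also have "H #> (P \<otimes> inv ?Q) = H" using h H P(1) Q by (simp add: coset_join2)
    finally show "c \<in> (\<lambda>v. H #> g v) ` \<kappa> ` carrier G" using P by blast
  qed
  then show ?thesis using fin by (meson finite_imageI finite_subset)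
qed

text \<open>
  Applied with \<open>p' = \<sigma> p\<close> and \<open>q' = \<sigma> q\<close>: if \<open>p - p'\<close> and \<open>q - q'\<close> are, up to the same translation \<open>r\<close>,
  the doubles of \<open>w + m\<close> and \<open>m\<close> with \<open>\<sigma> w = - w\<close>, then \<open>p - q - w\<close> is fixed by \<open>\<sigma>\<close>.
\<close>

lemma (in comm_group) twist_difference:
  assumes c: "p \<in> carrier G" "q \<in> carrier G" "p' \<in> carrier G" "q' \<in> carrier G" "w \<in> carrier G"
      "m \<in> carrier G" "r \<in> carrier G"
    and p: "p \<otimes> inv p' \<otimes> r = (w \<otimes> m) \<otimes> (w \<otimes> m)" and q: "q \<otimes> inv q' \<otimes> r = m \<otimes> m"
  shows "p \<otimes> inv q \<otimes> inv w = p' \<otimes> inv q' \<otimes> w"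
proof -
  have "p \<otimes> inv p' \<otimes> r = (w \<otimes> w) \<otimes> (m \<otimes> m)" unfolding p using c by (simp add: m_ac)
  also have "\<dots> = (w \<otimes> w \<otimes> (q \<otimes> inv q')) \<otimes> r" unfolding q[symmetric] using c by (simp add: m_assoc)
  finally have e: "p \<otimes> inv p' = w \<otimes> w \<otimes> (q \<otimes> inv q')" using c by simp
  have "p \<otimes> inv q \<otimes> inv w = (p \<otimes> inv p') \<otimes> p' \<otimes> inv q \<otimes> inv w"
    using c by (simp add: m_assoc l_inv)
  also have "\<dots> = (p' \<otimes> inv q' \<otimes> w) \<otimes> (w \<otimes> inv w) \<otimes> (q \<otimes> inv q)"
    unfolding e using c by (simp add: m_ac del: l_inv r_inv Units_l_inv Units_r_inv)
  finally show ?thesis using c by simp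
qed

text \<open>
  The presentation as a quotient is arbitrary; when \<open>p\<close> is not constant, composition with \<open>p\<close> keeps
  denominators nonzero, so that the result does not depend on it.
\<close>

definition comp_rf :: "'k::field poly \<Rightarrow> 'k poly fract \<Rightarrow> 'k poly fract" where
  "comp_rf p z = (SOME w. \<exists>a b. b \<noteq> 0 \<and> z = to_fract a / to_fract b \<and>
     w = to_fract (pcompose a p) / to_fract (pcompose b p))"

lemma fract_quotient_cases:
  fixes z :: "'k::field poly fract"
  obtains a b where "z = to_fract a / to_fract b" "b \<noteq> 0"
  by (cases z) (metis Fract_conv_divide)

lemma to_fract_divide_eq_iff:
  "b \<noteq> 0 \<Longrightarrow> d \<noteq> 0 \<Longrightarrow> to_fract a / to_fract b = to_fract c / to_fract d \<longleftrightarrow> a * d = c * b"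
  by (simp add: eq_fract flip: Fract_conv_divide)

lemma comp_rf_quotient:
  assumes p: "degree p > 0" and b: "b \<noteq> 0"
  shows "comp_rf p (to_fract a / to_fract b) = to_fract (pcompose a p) / to_fract (pcompose b p)"
  unfolding comp_rf_def
proof (rule some_equality)
  show "\<exists>a' b'. b' \<noteq> 0 \<and> to_fract a / to_fract b = to_fract a' / to_fract b' \<and>
     to_fract (pcompose a p) / to_fract (pcompose b p) = to_fract (pcompose a' p) / to_fract (pcompose b' p)"
    using b by blast
next
  fix w assume "\<exists>a' b'. b' \<noteq> 0 \<and> to_fract a / to_fract b = to_fract a' / to_fract b' \<and>
     w = to_fract (pcompose a' p) / to_fract (pcompose b' p)"
  then obtain a' b' where *: "b' \<noteq> 0" "to_fract a / to_fract b = to_fract a' / to_fract b'"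
    "w = to_fract (pcompose a' p) / to_fract (pcompose b' p)" by blast
  have "a * b' = a' * b" using * b by (simp add: to_fract_divide_eq_iff)
  then have "pcompose a p * pcompose b' p = pcompose a' p * pcompose b p" by (metis pcompose_mult)
  then show "w = to_fract (pcompose a p) / to_fract (pcompose b p)"
    unfolding *(3) using * b pcompose_eq_0_iff[OF p] by (subst to_fract_divide_eq_iff) auto
qed

lemma comp_rf_to_fract: "degree p > 0 \<Longrightarrow> comp_rf p (to_fract a) = to_fract (pcompose a p)"
  using comp_rf_quotient[of p 1 a] by (simp add: pcompose_1)

lemma field_hom_comp_rf:
  fixes p :: "'k::field poly"
  assumes p: "degree p > 0"
  shows "field_hom (comp_rf p)"
proof
  fix x y :: "'k poly fract"
  obtain a b where x: "x = to_fract a / to_fract b" "b \<noteq> 0" by (rule fract_quotient_cases)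
  obtain c d where y: "y = to_fract c / to_fract d" "d \<noteq> 0" by (rule fract_quotient_cases)
  have nz: "to_fract b \<noteq> 0" "to_fract d \<noteq> 0" "to_fract (pcompose b p) \<noteq> 0" "to_fract (pcompose d p) \<noteq> 0"
    using x y pcompose_eq_0_iff[OF p] by auto
  have bd: "b * d \<noteq> 0" using x y by simp
  have xy: "comp_rf p x = to_fract (pcompose a p) / to_fract (pcompose b p)"
     "comp_rf p y = to_fract (pcompose c p) / to_fract (pcompose d p)"
    using x y comp_rf_quotient[OF p] by auto
  have "x + y = to_fract (a * d + c * b) / to_fract (b * d)"
    unfolding x y to_fract_add to_fract_mult using nz by (simp add: field_simps)
  then have "comp_rf p (x + y) = to_fract (pcompose (a * d + c * b) p) / to_fract (pcompose (b * d) p)"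
    by (simp only: comp_rf_quotient[OF p bd])
  also have "\<dots> = comp_rf p x + comp_rf p y"
    unfolding xy pcompose_add pcompose_mult to_fract_add to_fract_mult using nz by (simp add: field_simps)
  finally show "comp_rf p (x + y) = comp_rf p x + comp_rf p y" .
  have "x * y = to_fract (a * c) / to_fract (b * d)"
    unfolding x y to_fract_mult by simp
  then have "comp_rf p (x * y) = to_fract (pcompose (a * c) p) / to_fract (pcompose (b * d) p)"
    by (simp only: comp_rf_quotient[OF p bd])
  also have "\<dots> = comp_rf p x * comp_rf p y"
    unfolding xy pcompose_mult to_fract_mult by simp
  finally show "comp_rf p (x * y) = comp_rf p x * comp_rf p y" .
  show "comp_rf p 1 = 1" using comp_rf_to_fract[OF p, of 1] by (simp add: pcompose_1)
qed

lemma even_polynomial: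
  fixes p :: "'k::field poly"
  assumes two: "(2::'k) \<noteq> 0" and "pcompose p [:0, -1:] = p"
  shows "\<exists>q. p = pcompose q [:0, 0, 1:]"
  using assms(2)
proof (induction "degree p" arbitrary: p rule: less_induct)
  case less
  obtain c p1 where p: "p = pCons c p1" by (cases p)
  obtain d p2 where p1: "p1 = pCons d p2" by (cases p1)
  have "pcompose p1 [:0, -1:] = - p1"
    using less.prems unfolding p by (simp add: pcompose_pCons) (metis minus_minus)
  then have *: "[:d:] - pCons 0 (pcompose p2 [:0, -1:]) = - pCons d p2"
    unfolding p1 by (simp add: pcompose_pCons)
  then have "d = - d" using arg_cong[OF *, of "\<lambda>q. coeff q 0"] by simp
  then have "2 * d = 0" by (metis add.right_inverse mult_2)
  then have d: "d = 0" using two by simp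
  then have p2: "pcompose p2 [:0, -1:] = p2" using * by simp
  show ?case
  proof (cases "p2 = 0")
    case True
    then show ?thesis unfolding p p1 d by (intro exI[of _ "[:c:]"]) simp
  next
    case False
    then have "degree p2 < degree p" unfolding p p1 by simp
    from less.hyps[OF this p2] obtain q where "p2 = pcompose q [:0, 0, 1:]" by blast
    then show ?thesis unfolding p p1 d by (intro exI[of _ "pCons c q"]) (simp add: pcompose_pCons)
  qed
qed

lemma poly_map_const_rf: "poly (map_poly const_rf a) (to_fract p) = to_fract (pcompose a p)"
proof (induction a)
  case (pCons c a)
  have m: "map_poly const_rf (pCons c a) = pCons (const_rf c) (map_poly const_rf a)"
    using pCons.hyps by (intro map_poly_pCons) (auto simp: const_rf_eq_0)
  show ?case unfolding m poly_pCons pCons.IH pcompose_pCons to_fract_add to_fract_mult by (simp only: const_rf_to_fract[of c])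
qed simp

lemma legendre_add_conv_ec_add: "legendre_add t = ec_add 1 t"
proof (intro ext)
  fix P Q show "legendre_add t P Q = ec_add 1 t P Q" by (cases P; cases Q) (simp_all add: Let_def)
qed

lemma legendre_group_UNIV: "legendre_group t UNIV = ec_group 1 t"
  unfolding legendre_group_def ec_group_def legendre_add_conv_ec_add
  by (simp add: legendre_points_def ec_points_def)

context twisted_legendre_finite
begin

abbreviation u :: "'k poly fract" where "u \<equiv> var_rf"
definition t :: "'k poly fract" where "t = u ^ (2 * N)"
text \<open>
  \<open>\<iota>\<close> embeds \<open>k(s)\<close> into \<open>k(u)\<close> by \<open>s \<mapsto> u\<^sup>2\<close>; both fields are the same type.  The map \<open>\<sigma>\<close> is
  \<open>u \<mapsto> - u\<close>.
\<close>

definition \<iota> :: "'k poly fract \<Rightarrow> 'k poly fract" where "\<iota> = comp_rf [:0,0,1:]"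
definition \<sigma> :: "'k poly fract \<Rightarrow> 'k poly fract" where "\<sigma> = comp_rf [:0,-1:]"

sublocale iota: field_hom \<iota> unfolding \<iota>_def by (rule field_hom_comp_rf) simp
sublocale sigma: field_hom \<sigma> unfolding \<sigma>_def by (rule field_hom_comp_rf) simp

lemma iota_s: "\<iota> s = u^2"
  unfolding \<iota>_def var_rf_to_fract by (simp add: comp_rf_to_fract pcompose_pCons power2_eq_square flip: to_fract_mult)

lemma iota_const: "\<iota> (const_rf c) = const_rf c"
  unfolding \<iota>_def const_rf_to_fract by (simp add: comp_rf_to_fract)

lemma sigma_u: "\<sigma> u = - u"
proof -
  have "\<sigma> u = to_fract (- X)" unfolding \<sigma>_def var_rf_to_fract by (simp add: comp_rf_to_fract pcompose_pCons)
  then show ?thesis by (simp only: to_fract_uminus var_rf_to_fract)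
qed

lemma sigma_t: "\<sigma> t = t"
  unfolding t_def sigma.hom_power sigma_u by (simp add: power_mult)

lemma sigma_iota: "\<sigma> (\<iota> z) = \<iota> z"
proof -
  obtain a b where z: "z = to_fract a / to_fract b" "b \<noteq> 0" by (rule fract_quotient_cases)
  have nz: "pcompose b [:0,0,1:] \<noteq> 0" using z pcompose_eq_0_iff[of "[:0,0,1:]" b] by simp
  have "pcompose (pcompose p [:0,0,1:]) [:0,-1:] = pcompose p [:0,0,1:]" for p :: "'k poly"
    by (simp add: pcompose_pCons flip: pcompose_assoc)
  then show ?thesis unfolding \<sigma>_def \<iota>_def z(1) using nz z by (simp add: comp_rf_quotient)
qed

lemma sigma_sigma: "\<sigma> (\<sigma> z) = z"
proof -
  obtain a b where z: "z = to_fract a / to_fract b" "b \<noteq> 0" by (rule fract_quotient_cases)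
  have nz: "pcompose b [:0,-1:] \<noteq> 0" using z pcompose_eq_0_iff[of "[:0,-1:]" b] by simp
  have "pcompose (pcompose p [:0,-1:]) [:0,-1:] = p" for p :: "'k poly"
    by (simp add: pcompose_pCons flip: pcompose_assoc)
  then show ?thesis unfolding \<sigma>_def z(1) using nz z by (simp add: comp_rf_quotient)
qed

lemma adjoin_rf_square: "adjoin_rf (u^2) = range \<iota>"
proof -
  have u2: "u^2 = to_fract [:0,0,1:]" using iota_s unfolding \<iota>_def var_rf_to_fract
    by (simp add: comp_rf_to_fract pcompose_pCons)
  show ?thesis
  proof (intro equalityI subsetI)
    fix z assume "z \<in> adjoin_rf (u^2)"
    then obtain a b where z: "z = to_fract (pcompose a [:0,0,1:]) / to_fract (pcompose b [:0,0,1:])"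
      "to_fract (pcompose b [:0,0,1:]) \<noteq> 0"
      unfolding adjoin_rf_def u2 poly_map_const_rf by blast
    then have "b \<noteq> 0" by auto
    then have "z = \<iota> (to_fract a / to_fract b)" unfolding z(1) \<iota>_def by (simp add: comp_rf_quotient)
    then show "z \<in> range \<iota>" by blast
  next
    fix z assume "z \<in> range \<iota>"
    then obtain w where "z = \<iota> w" by blast
    obtain a b where w: "w = to_fract a / to_fract b" "b \<noteq> 0" by (rule fract_quotient_cases)
    have "pcompose b [:0,0,1:] \<noteq> 0" using w pcompose_eq_0_iff[of "[:0,0,1:]" b] by simp
    moreover have "z = to_fract (pcompose a [:0,0,1:]) / to_fract (pcompose b [:0,0,1:])"
      unfolding \<open>z = \<iota> w\<close> w(1) \<iota>_def using w by (simp add: comp_rf_quotient)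
    ultimately show "z \<in> adjoin_rf (u^2)"
      unfolding adjoin_rf_def u2 poly_map_const_rf by (simp add: exI) blast
  qed
qed

text \<open>
  Multiplying numerator and denominator by the conjugate of the denominator makes the denominator
  even, and then the numerator of an invariant function is even as well.
\<close>

lemma fixed_imp_range_iota:
  assumes "\<sigma> z = z"
  shows "z \<in> range \<iota>"
proof -
  let ?m = "\<lambda>p :: 'k poly. pcompose p [:0,-1:]"
  obtain a b where z: "z = to_fract a / to_fract b" "b \<noteq> 0" by (rule fract_quotient_cases)
  have mb: "?m b \<noteq> 0" using z pcompose_eq_0_iff[of "[:0,-1:]" b] by simp
  have mm: "?m (?m p) = p" for p by (simp add: pcompose_pCons flip: pcompose_assoc)
  have "to_fract (?m a) / to_fract (?m b) = to_fract a / to_fract b"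
    using assms z unfolding \<sigma>_def by (simp add: comp_rf_quotient)
  then have e: "?m a * b = a * ?m b" using z mb by (simp add: to_fract_divide_eq_iff)
  have "?m (a * ?m b) = a * ?m b" unfolding pcompose_mult mm e ..
  then obtain A where A: "a * ?m b = pcompose A [:0,0,1:]" using even_polynomial two by blast
  have "?m (b * ?m b) = b * ?m b" unfolding pcompose_mult mm by (rule mult.commute)
  then obtain B where B: "b * ?m b = pcompose B [:0,0,1:]" using even_polynomial two by blast
  have nzB: "pcompose B [:0,0,1:] \<noteq> 0" using B z mb by (metis mult_eq_0_iff)
  then have "B \<noteq> 0" by auto
  have "z = to_fract (a * ?m b) / to_fract (b * ?m b)" unfolding z(1) to_fract_mult using mb by simp
  also have "\<dots> = \<iota> (to_fract A / to_fract B)" unfolding A B \<iota>_def using \<open>B \<noteq> 0\<close> by (simp add: comp_rf_quotient)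
  finally show ?thesis by blast
qed

sublocale E: legendre_curve 1 t
proof
  have iQ: "\<iota> sQ = u^2 * t" unfolding sQ_def t_def iota.hom_power iota_s by (simp add: power_mult power_add)
  show "(2 :: 'k poly fract) \<noteq> 0" by (rule two_neq_0)
  show "t \<noteq> 0" using s_nz by (simp add: t_def)
  show "1 \<noteq> t"
  proof
    assume "1 = t"
    then have "\<iota> sQ = \<iota> s" using iQ iota_s by simp
    then show False using iota.hom_eq[of sQ s] a_neq_b by simp
  qed
qed simp

abbreviation EC :: "'k poly fract ec_point set" where "EC \<equiv> ec_points 1 t"
abbreviation EG :: "'k poly fract ec_point monoid" where "EG \<equiv> ec_group 1 t"

sublocale EG: comm_group EG by (rule E.comm_group_ec_group)

text \<open>
  The identification of the twisted curve over \<open>k(s)\<close> with the anti-invariant points of the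
  Legendre curve over \<open>k(u)\<close>; the scaling by \<open>u\<^bsup>-1\<^esup>\<close>, which \<open>\<sigma>\<close> negates, is the reason that \<open>\<sigma>\<close> acts on
  the image by \<open>- 1\<close>.
\<close>

definition \<phi> :: "'k poly fract ec_point \<Rightarrow> 'k poly fract ec_point" where "\<phi> = iota.map_scaled (inverse u)"
definition conj_point :: "'k poly fract ec_point \<Rightarrow> 'k poly fract ec_point" where "conj_point = sigma.map_scaled 1"

lemma phi_curve: "inverse u ^ 2 * \<iota> s = 1" "inverse u ^ 2 * \<iota> sQ = t"
proof -
  have "(u^2) ^ (N + 1) = u^2 * u ^ (2 * N)" by (simp add: power_mult)
  then show "inverse u ^ 2 * \<iota> s = 1" "inverse u ^ 2 * \<iota> sQ = t"
    unfolding sQ_def t_def iota.hom_power iota_s using s_nz by (simp_all flip: mult.assoc power_mult_distrib)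
qed

lemma phi_closed: "P \<in> C \<Longrightarrow> \<phi> P \<in> EC"
  using iota.map_scaled_closed[of P s sQ "inverse u"] by (simp add: phi_curve \<phi>_def)

lemma phi_add: "\<phi> (P \<oplus>\<^sub>C Q) = ec_add 1 t (\<phi> P) (\<phi> Q)"
  using iota.map_scaled_add[of "inverse u" s sQ P Q] s_nz by (simp add: phi_curve \<phi>_def)

lemma phi_eq_iff: "\<phi> P = \<phi> Q \<longleftrightarrow> P = Q"
  using iota.map_scaled_inj[of "inverse u" P Q] s_nz by (simp add: \<phi>_def)

lemma phi_Infinity [simp]: "\<phi> Infinity = Infinity" by (simp add: \<phi>_def)

lemma phi_neg: "\<phi> (ec_neg P) = ec_neg (\<phi> P)"
  by (cases P) (simp_all add: \<phi>_def iota.hom_minus)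

lemma conj_point_closed: "P \<in> EC \<Longrightarrow> conj_point P \<in> EC"
  using sigma.map_scaled_closed[of P 1 t 1] by (simp add: conj_point_def sigma.hom_1 sigma_t)

lemma conj_point_add: "conj_point (ec_add 1 t P Q) = ec_add 1 t (conj_point P) (conj_point Q)"
  using sigma.map_scaled_add[of 1 1 t P Q] by (simp add: conj_point_def sigma.hom_1 sigma_t)

lemma conj_point_conj_point: "conj_point (conj_point P) = P"
  by (cases P) (simp_all add: conj_point_def sigma_sigma)

lemma conj_point_neg: "conj_point (ec_neg P) = ec_neg (conj_point P)"
  by (cases P) (simp_all add: conj_point_def sigma.hom_minus)

lemma conj_point_Infinity [simp]: "conj_point Infinity = Infinity" by (simp add: conj_point_def)

lemma conj_point_phi: "conj_point (\<phi> P) = ec_neg (\<phi> P)"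
proof (cases P)
  case (Point x y)
  have "\<sigma> (inverse u) = - inverse u"
    using sigma.hom_divide[of 1 u] by (simp add: sigma.hom_1 sigma_u divide_inverse)
  then show ?thesis unfolding Point
    by (simp add: conj_point_def \<phi>_def sigma.hom_mult sigma.hom_power sigma_iota power3_eq_cube)
qed simp

lemma anti_invariant_imp_phi:
  assumes P: "P \<in> EC" and anti: "conj_point P = ec_neg P"
  shows "\<exists>M\<in>C. P = \<phi> M"
proof (cases P)
  case (Point x y)
  have "\<sigma> x = x" "\<sigma> y = - y" using anti by (simp_all add: Point conj_point_def)
  then have "\<sigma> (u^2 * x) = u^2 * x" "\<sigma> (u^3 * y) = u^3 * y"
    by (simp_all add: sigma.hom_mult sigma.hom_power sigma_u power3_eq_cube)
  then obtain x0 y0 where x0: "u^2 * x = \<iota> x0" and y0: "u^3 * y = \<iota> y0"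
    using fixed_imp_range_iota by (metis imageE)
  have iQ: "\<iota> sQ = u^2 * t" unfolding sQ_def t_def iota.hom_power iota_s by (simp add: power_mult power_add)
  have "y^2 = x * (x + 1) * (x + t)" using P Point by simp
  then have "(u^3 * y)^2 = (u^2 * x) * (u^2 * x + u^2) * (u^2 * x + u^2 * t)" by algebra
  then have "\<iota> (y0^2) = \<iota> (x0 * (x0 + s) * (x0 + sQ))"
    unfolding iota.hom_power iota.hom_mult iota.hom_add iota_s iQ x0 y0 .
  then have "Point x0 y0 \<in> C" by (simp add: iota.hom_eq)
  moreover have "P = \<phi> (Point x0 y0)"
    using s_nz unfolding Point \<phi>_def iota.map_scaled.simps x0[symmetric] y0[symmetric]
    by (simp flip: mult.assoc power_mult_distrib)
  ultimately show ?thesis by blast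
qed (auto intro: bexI[of _ Infinity])

definition invariant_points :: "'k poly fract ec_point set" where "invariant_points = {P \<in> EC. conj_point P = P}"

lemma legendre_points_adjoin: "legendre_points t (adjoin_rf (u^2)) = invariant_points"
proof -
  have r: "z \<in> adjoin_rf (u^2) \<longleftrightarrow> \<sigma> z = z" for z
    unfolding adjoin_rf_square using fixed_imp_range_iota sigma_iota by auto
  show ?thesis unfolding legendre_points_def invariant_points_def ec_points_def r by (auto simp: conj_point_def)
qed

lemma phi_two_torsion_invariant: "p \<in> two_torsion \<Longrightarrow> \<phi> p \<in> invariant_points"
  using two_torsion_neg[of p] two_torsion_C[of p] phi_closed[of p] conj_point_phi[of p] phi_neg[of p] by (simp add: invariant_points_def)

lemma subgroup_invariant_points: "subgroup invariant_points EG"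
proof (rule EG.subgroupI)
  show "invariant_points \<subseteq> carrier EG" by (auto simp: invariant_points_def)
  show "invariant_points \<noteq> {}" by (auto simp: invariant_points_def intro: exI[of _ Infinity])
  show "inv\<^bsub>EG\<^esub> P \<in> invariant_points" if "P \<in> invariant_points" for P
    using that E.ec_group_inv[of P] E.ec_neg_closed[of P] conj_point_neg[of P] by (simp add: invariant_points_def)
  show "P \<otimes>\<^bsub>EG\<^esub> Q \<in> invariant_points" if "P \<in> invariant_points" "Q \<in> invariant_points" for P Q
    using that E.ec_add_closed[of P Q] conj_point_add[of P Q] by (simp add: invariant_points_def)
qed

definition R_span :: "'k poly fract ec_point set" where "R_span = range (\<lambda>n. \<phi> (R_comb n))"

lemma subgroup_R_span: "subgroup R_span EG"
proof (rule EG.subgroupI)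
  show "R_span \<subseteq> carrier EG" using phi_closed R_comb_C by (auto simp: R_span_def)
  show "R_span \<noteq> {}" by (auto simp: R_span_def)
  show "inv\<^bsub>EG\<^esub> P \<in> R_span" if "P \<in> R_span" for P
  proof -
    from that obtain n where n: "P = \<phi> (R_comb n)" by (auto simp: R_span_def)
    then have "inv\<^bsub>EG\<^esub> P = \<phi> (R_comb (\<lambda>i. - n i))"
      using E.ec_group_inv[OF phi_closed[OF R_comb_C]] by (simp add: R_comb_minus phi_neg)
    then show ?thesis by (simp add: R_span_def)
  qed
  show "P \<otimes>\<^bsub>EG\<^esub> Q \<in> R_span" if "P \<in> R_span" "Q \<in> R_span" for P Q
  proof -
    from that obtain m n where n: "P = \<phi> (R_comb m)" "Q = \<phi> (R_comb n)" by (auto simp: R_span_def)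
    then have "P \<otimes>\<^bsub>EG\<^esub> Q = \<phi> (R_comb (\<lambda>i. m i + n i))" using phi_add R_comb_add by simp
    then show ?thesis by (simp add: R_span_def)
  qed
qed

text \<open>
  A common point satisfies \<open>P = \<sigma> P = - P\<close>, and the span of the \<open>R\<^sub>i\<close> has no 2-torsion.
\<close>

lemma invariant_Int_R_span: "invariant_points \<inter> R_span = {Infinity}"
proof -
  have "P = Infinity" if "P \<in> invariant_points" "P \<in> R_span" for P
  proof -
    from that obtain n where n: "P = \<phi> (R_comb n)" by (auto simp: R_span_def)
    have "\<phi> (R_comb n) = \<phi> (ec_neg (R_comb n))" using that conj_point_phi[of "R_comb n"] n by (simp add: invariant_points_def phi_neg)
    then have "R_comb n = ec_neg (R_comb n)" by (simp add: phi_eq_iff)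
    then have "R_comb n \<oplus>\<^sub>C R_comb n = Infinity" using ec_add_neg(1)[of "R_comb n"] by simp
    then have "R_comb n \<in> two_torsion" using two_torsion_iff R_comb_C by blast
    then have "R_comb n = Infinity" by (rule descent_class_two_torsion[OF descent_class_R_comb])
    then show ?thesis using n by simp
  qed
  moreover have "Infinity \<in> invariant_points" "Infinity \<in> R_span"
    using subgroup.one_closed[OF subgroup_invariant_points] subgroup.one_closed[OF subgroup_R_span] by simp_all
  ultimately show ?thesis by auto
qed

text \<open>
  For every \<open>P\<close> there are \<open>r\<close> in the finite set \<open>reps\<close> and \<open>M\<close> with \<open>P - \<sigma> P + \<phi> r = \<phi> (2 M)\<close>.  Classify \<open>P\<close> by \<open>r\<close> and
  the coset of \<open>M\<close> modulo 2-torsion and the span of the \<open>R\<^sub>i\<close>.  If \<open>P\<close> and \<open>Q\<close> have the same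
  data and \<open>w\<close> is the difference of their points \<open>M\<close>, then \<open>P - Q - \<phi> w\<close> is invariant, and
  \<open>\<phi> w\<close> is the sum of an invariant 2-torsion point and a combination of the \<open>R\<^sub>i\<close>.
\<close>

lemma finite_index_invariant_R_span: "finite (rcosets\<^bsub>EG\<^esub> (invariant_points <#>\<^bsub>EG\<^esub> R_span))"
proof -
  let ?H = "invariant_points <#>\<^bsub>EG\<^esub> R_span"
  have H: "subgroup ?H EG" using EG.mult_subgroups[OF subgroup_invariant_points subgroup_R_span] .
  have GpH: "P \<in> ?H" if "P \<in> invariant_points" for P
    using that subgroup.one_closed[OF subgroup_R_span] EG.r_one[of P] unfolding set_mult_def by (force simp: invariant_points_def)
  have WH: "P \<in> ?H" if "P \<in> R_span" for P
    using that subgroup.one_closed[OF subgroup_invariant_points] EG.l_one[of P] subgroup.subset[OF subgroup_R_span] unfolding set_mult_def by force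
  have TWH: "\<phi> P \<in> ?H" if "P \<in> torsion_R_span" for P
  proof -
    from that obtain p n where "p \<in> two_torsion" "P = p \<oplus>\<^sub>C R_comb n" by (auto simp: torsion_R_span_def)
    then have "\<phi> P = \<phi> p \<otimes>\<^bsub>EG\<^esub> \<phi> (R_comb n)" "\<phi> p \<in> invariant_points" "\<phi> (R_comb n) \<in> R_span"
      using phi_add phi_two_torsion_invariant by (auto simp: R_span_def)
    then show ?thesis unfolding set_mult_def by blast
  qed
  have ex: "\<exists>M. \<exists>r\<in>reps. M \<in> C \<and> ec_add 1 t (ec_add 1 t P (ec_neg (conj_point P))) (\<phi> r) = \<phi> (M \<oplus>\<^sub>C M)" if P: "P \<in> EC" for P
  proof -
    let ?D = "ec_add 1 t P (ec_neg (conj_point P))"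
    have c: "P \<in> carrier EG" "conj_point P \<in> carrier EG" using P conj_point_closed by auto
    have D: "?D \<in> EC" using P conj_point_closed E.ec_neg_closed E.ec_add_closed by blast
    have "conj_point ?D = ec_add 1 t (conj_point P) (ec_neg P)" by (simp add: conj_point_add conj_point_neg conj_point_conj_point)
    also have "\<dots> = inv\<^bsub>EG\<^esub> (P \<otimes>\<^bsub>EG\<^esub> inv\<^bsub>EG\<^esub> (conj_point P))"
      using c EG.inv_mult[of P "inv\<^bsub>EG\<^esub> (conj_point P)"] EG.m_comm[of "conj_point P" "inv\<^bsub>EG\<^esub> P"] E.ec_group_inv[OF P] E.ec_group_inv[OF conj_point_closed[OF P]] EG.inv_inv[of "conj_point P"] EG.inv_closed[of P] EG.inv_closed[of "conj_point P"]
      by simp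
    also have "\<dots> = ec_neg ?D" using E.ec_group_inv[OF D] E.ec_group_inv[OF conj_point_closed[OF P]] by simp
    finally obtain M0 where M0: "M0 \<in> C" "?D = \<phi> M0" using anti_invariant_imp_phi[OF D] by blast
    from exists_rep[OF M0(1)] obtain r M where "r \<in> reps" "M \<in> C" "M0 \<oplus>\<^sub>C r = M \<oplus>\<^sub>C M" by blast
    then show ?thesis using M0 phi_add by metis
  qed
  then obtain M r where Mr: "\<And>P. P \<in> EC \<Longrightarrow> r P \<in> reps \<and> M P \<in> C \<and>
      ec_add 1 t (ec_add 1 t P (ec_neg (conj_point P))) (\<phi> (r P)) = \<phi> (M P \<oplus>\<^sub>C M P)"
    by metis
  define \<kappa> where "\<kappa> P = (r P, torsion_R_span #>\<^bsub>G\<^esub> M P)" for P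
  show ?thesis
  proof (rule EG.finite_rcosets_if_classified[OF H, where \<kappa> = \<kappa>])
    have "\<kappa> ` carrier EG \<subseteq> reps \<times> rcosets\<^bsub>G\<^esub> torsion_R_span" using Mr by (auto simp: \<kappa>_def RCOSETS_def)
    then show "finite (\<kappa> ` carrier EG)" using finite_reps finite_index_torsion_R_span by (meson finite_SigmaI finite_subset)
  next
    fix P Q assume "P \<in> carrier EG" "Q \<in> carrier EG" and k: "\<kappa> P = \<kappa> Q"
    then have PQ: "P \<in> EC" "Q \<in> EC" by auto
    have M: "M P \<in> C" "M Q \<in> C" using Mr PQ by auto
    have "M P \<in> torsion_R_span #>\<^bsub>G\<^esub> M Q" using k G.rcos_self[of "M P" torsion_R_span] M subgroup_torsion_R_span by (simp add: \<kappa>_def)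
    then obtain w where w: "w \<in> torsion_R_span" "M P = w \<oplus>\<^sub>C M Q" by (auto simp: r_coset_def)
    have wC: "w \<in> C" using w subgroup.subset[OF subgroup_torsion_R_span] by auto
    let ?i = "\<lambda>P. inv\<^bsub>EG\<^esub> P" and ?a = "\<lambda>P Q. P \<otimes>\<^bsub>EG\<^esub> Q"
    let ?S = "?a (?a P (?i Q)) (?i (\<phi> w))"
    have c: "P \<in> carrier EG" "Q \<in> carrier EG" "conj_point P \<in> carrier EG" "conj_point Q \<in> carrier EG" "\<phi> w \<in> carrier EG"
      "\<phi> (M Q) \<in> carrier EG" "\<phi> (r Q) \<in> carrier EG"
      using PQ conj_point_closed phi_closed wC M Mr reps_closed by auto
    have sgi: "conj_point (?i P) = ?i (conj_point P)" if "P \<in> EC" for P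
      using E.ec_group_inv[OF that] E.ec_group_inv[OF conj_point_closed[OF that]] conj_point_neg by simp
    have sw: "conj_point (?i (\<phi> w)) = \<phi> w"
    proof -
      have "ec_neg (ec_neg (\<phi> w)) = \<phi> w" by (cases "\<phi> w") auto
      then show ?thesis unfolding E.ec_group_inv[OF phi_closed[OF wC]] conj_point_neg conj_point_phi .
    qed
    have rr: "r P = r Q" using k by (simp add: \<kappa>_def)
    have eP: "?a (?a P (?i (conj_point P))) (\<phi> (r Q)) = ?a (?a (\<phi> w) (\<phi> (M Q))) (?a (\<phi> w) (\<phi> (M Q)))"
      using Mr[OF PQ(1)] E.ec_group_inv[OF conj_point_closed[OF PQ(1)]] rr w phi_add by simp
    have eQ: "?a (?a Q (?i (conj_point Q))) (\<phi> (r Q)) = ?a (\<phi> (M Q)) (\<phi> (M Q))"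
      using Mr[OF PQ(2)] E.ec_group_inv[OF conj_point_closed[OF PQ(2)]] phi_add by simp
    have "?S = ?a (?a (conj_point P) (?i (conj_point Q))) (\<phi> w)"
      using EG.twist_difference[OF c eP eQ] .
    moreover have "conj_point ?S = ?a (?a (conj_point P) (?i (conj_point Q))) (\<phi> w)"
      using conj_point_add sgi[OF PQ(2)] sw by simp
    ultimately have "conj_point ?S = ?S" by simp
    moreover have "?S \<in> EC" using EG.m_closed[OF EG.m_closed[OF c(1) EG.inv_closed[OF c(2)]] EG.inv_closed[OF c(5)]] by simp
    ultimately have "?S \<in> ?H" using GpH by (simp add: invariant_points_def)
    then have "?a ?S (\<phi> w) \<in> ?H" using TWH[OF w(1)] H subgroup.m_closed by metis
    moreover have "?a ?S (\<phi> w) = ?a P (?i Q)" using c by (simp add: EG.m_assoc del: ec_group_sel)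
    ultimately show "?a P (?i Q) \<in> ?H" by simp
  qed
qed

definition unit_vec :: "nat \<Rightarrow> nat \<Rightarrow> int" where "unit_vec i j = (if j = i then 1 else 0)"

lemma R_comb_unit_vec: "i < N \<Longrightarrow> R_comb (unit_vec i) = R_pt i"
proof -
  assume i: "i < N"
  have "R_comb (unit_vec i) = finprod G (\<lambda>j. if j = i then R_pt j else \<one>\<^bsub>G\<^esub>) {..<N}"
    unfolding R_comb_def using R_pt_closed G.int_pow_1[OF R_pt_closed] by (intro G.finprod_cong') (auto simp: unit_vec_def)
  also have "\<dots> = R_pt i" using i R_pt_closed by (intro G.finprod_singleton_swap) auto
  finally show ?thesis .
qed

lemma generate_eq_R_span: "generate EG ((\<lambda>i. \<phi> (R_pt i)) ` {0..<N}) = R_span"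
proof -
  let ?gen = "generate EG ((\<lambda>i. \<phi> (R_pt i)) ` {0..<N})"
  have R: "(\<lambda>i. \<phi> (R_pt i)) ` {0..<N} \<subseteq> R_span"
    unfolding R_span_def using R_comb_unit_vec by (auto simp: image_iff) metis
  have "(\<lambda>i. \<phi> (R_pt i)) ` {0..<N} \<subseteq> carrier EG" using R subgroup.subset[OF subgroup_R_span] by blast
  then have gen: "subgroup ?gen EG" by (rule EG.generate_is_subgroup)
  let ?S = "{P \<in> C. \<phi> P \<in> ?gen}"
  have S: "subgroup ?S G"
  proof (rule G.subgroupI)
    show "?S \<noteq> {}" using subgroup.one_closed[OF gen] by (auto intro: exI[of _ Infinity])
    show "inv\<^bsub>G\<^esub> P \<in> ?S" if "P \<in> ?S" for P
      using that subgroup.m_inv_closed[OF gen, of "\<phi> P"] ec_group_inv[of P] E.ec_group_inv[OF phi_closed[of P]] phi_neg ec_neg_closed[of P]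
      by simp
    show "P \<otimes>\<^bsub>G\<^esub> Q \<in> ?S" if "P \<in> ?S" "Q \<in> ?S" for P Q
      using that subgroup.m_closed[OF gen, of "\<phi> P" "\<phi> Q"] ec_add_closed[of P Q] phi_add by simp
  qed auto
  have RS: "R_pt i \<in> ?S" if "i < N" for i
    using that R_pt_closed generate.incl[of "\<phi> (R_pt i)" "(\<lambda>i. \<phi> (R_pt i)) ` {0..<N}" EG] by auto
  have "finprod G (\<lambda>i. R_pt i [^]\<^bsub>G\<^esub> n i) I \<in> ?S" if "finite I" "I \<subseteq> {..<N}" for I and n :: "nat \<Rightarrow> int"
    using that
  proof (induction I)
    case empty
    then show ?case using subgroup.one_closed[OF S] by simp
  next
    case (insert j I)
    then have "finprod G (\<lambda>i. R_pt i [^]\<^bsub>G\<^esub> n i) (insert j I) = (R_pt j [^]\<^bsub>G\<^esub> n j) \<otimes>\<^bsub>G\<^esub> finprod G (\<lambda>i. R_pt i [^]\<^bsub>G\<^esub> n i) I"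
      by (subst G.finprod_insert) (auto intro: R_pt_pow_closed)
    moreover have "R_pt j [^]\<^bsub>G\<^esub> n j \<in> ?S" using G.subgroup_int_pow_closed[OF S RS[of j]] insert by blast
    moreover have "finprod G (\<lambda>i. R_pt i [^]\<^bsub>G\<^esub> n i) I \<in> ?S" using insert by blast
    ultimately show ?case using subgroup.m_closed[OF S] by (simp only:)
  qed
  from this[of "{..<N}"] have "R_comb n \<in> ?S" for n unfolding R_comb_def by blast
  then have "R_span \<subseteq> ?gen" by (auto simp: R_span_def)
  moreover have "?gen \<subseteq> R_span" using R subgroup_R_span by (rule EG.generate_subgroup_incl)
  ultimately show ?thesis by blast
qed

text \<open>
  Sending a finitely supported integer vector to the combination with these coefficients is injective
  by independence of the \<open>R\<^sub>i\<close>.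
\<close>

lemma R_span_free: "EG\<lparr>carrier := R_span\<rparr> \<cong> free_Abelian_group {0..<N}"
proof -
  define h where "h c = \<phi> (R_comb (Poly_Mapping.lookup c))" for c :: "nat \<Rightarrow>\<^sub>0 int"
  let ?F = "free_Abelian_group {0..<N}"
  have "h \<in> iso ?F (EG\<lparr>carrier := R_span\<rparr>)"
    unfolding iso_iff
  proof (intro conjI)
    show "h \<in> hom ?F (EG\<lparr>carrier := R_span\<rparr>)"
    proof (rule homI)
      show "h c \<in> carrier (EG\<lparr>carrier := R_span\<rparr>)" for c by (simp add: h_def R_span_def)
      fix c c'
      have "h (c + c') = \<phi> (R_comb (\<lambda>i. Poly_Mapping.lookup c i + Poly_Mapping.lookup c' i))"
        unfolding h_def by (simp add: lookup_add[abs_def])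
      then show "h (c \<otimes>\<^bsub>?F\<^esub> c') = h c \<otimes>\<^bsub>EG\<lparr>carrier := R_span\<rparr>\<^esub> h c'"
        using phi_add R_comb_add by (simp add: h_def)
    qed
    show "h ` carrier ?F = carrier (EG\<lparr>carrier := R_span\<rparr>)"
    proof -
      have "\<phi> (R_comb n) \<in> h ` carrier ?F" for n
      proof -
        define m where "m i = (if i < N then n i else 0)" for i
        define c where "c = Poly_Mapping.Abs_poly_mapping m"
        have "finite {i. m i \<noteq> 0}" by (rule finite_subset[of _ "{..<N}"]) (auto simp: m_def)
        then have l: "Poly_Mapping.lookup c = m" unfolding c_def by (simp add: Abs_poly_mapping_inverse)
        have "Poly_Mapping.keys c \<subseteq> {0..<N}" unfolding keys.rep_eq l by (auto simp: m_def split: if_splits)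
        moreover have "R_comb n = R_comb m" unfolding R_comb_def m_def by (intro G.finprod_cong') (auto intro: R_pt_pow_closed)
        ultimately show ?thesis unfolding h_def using l by (intro image_eqI[of _ _ c]) auto
      qed
      then show ?thesis by (auto simp: R_span_def h_def)
    qed
    show "inj_on h (carrier ?F)"
    proof (rule inj_onI)
      fix c c' assume c: "c \<in> carrier ?F" "c' \<in> carrier ?F" and "h c = h c'"
      then have eq: "R_comb (Poly_Mapping.lookup c) = R_comb (Poly_Mapping.lookup c')" by (simp add: h_def phi_eq_iff)
      have "R_comb (\<lambda>i. Poly_Mapping.lookup c i + - Poly_Mapping.lookup c' i) = Infinity"
        using R_comb_add[of "Poly_Mapping.lookup c" "\<lambda>i. - Poly_Mapping.lookup c' i"] ec_add_neg(1) by (simp add: R_comb_minus eq)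
      then have z: "\<forall>i<N. Poly_Mapping.lookup c i + - Poly_Mapping.lookup c' i = 0"
        by (intro R_comb_torsion_imp_zero) (simp add: two_torsion_def)
      show "c = c'"
      proof (rule poly_mapping_eqI)
        fix i
        show "Poly_Mapping.lookup c i = Poly_Mapping.lookup c' i"
        proof (cases "i < N")
          case True then show ?thesis using z by simp
        next
          case False
          then have "i \<notin> Poly_Mapping.keys c" "i \<notin> Poly_Mapping.keys c'" using c by auto
          then show ?thesis by (simp add: in_keys_iff)
        qed
      qed
    qed
  qed
  then have "?F \<cong> EG\<lparr>carrier := R_span\<rparr>" by (rule is_isoI)
  then show ?thesis by (rule group.iso_sym[OF group_free_Abelian_group])
qed

theorem minus_part_decomposition:
  fixes Esq :: "'k poly fract ec_point monoid"
  assumes Esq: "Esq = legendre_group t (adjoin_rf (u ^ 2))"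
    and gen: "V = generate EG ((\<lambda>i. \<phi> (R_pt i)) ` {0..<N})"
  shows "EG\<lparr>carrier := V\<rparr> \<cong> free_Abelian_group {0..<N} \<and>
         (\<lambda>(P, Q). P \<otimes>\<^bsub>EG\<^esub> Q) \<in> mon (Esq \<times>\<times> EG\<lparr>carrier := V\<rparr>) EG \<and>
         finite (rcosets\<^bsub>EG\<^esub> ((\<lambda>(P, Q). P \<otimes>\<^bsub>EG\<^esub> Q) ` carrier (Esq \<times>\<times> EG\<lparr>carrier := V\<rparr>)))"
proof -
  have V: "V = R_span" using gen generate_eq_R_span by simp
  have Esq': "carrier Esq = invariant_points" "P \<otimes>\<^bsub>Esq\<^esub> Q = P \<otimes>\<^bsub>EG\<^esub> Q" for P Q
    unfolding Esq legendre_group_def by (simp_all add: legendre_points_adjoin legendre_add_conv_ec_add)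
  have GpE: "invariant_points \<subseteq> carrier EG" "R_span \<subseteq> carrier EG"
    using subgroup.subset[OF subgroup_invariant_points] subgroup.subset[OF subgroup_R_span] by auto
  have cP: "carrier (Esq \<times>\<times> EG\<lparr>carrier := R_span\<rparr>) = invariant_points \<times> R_span" by (simp add: DirProd_def Esq')
  have img: "(\<lambda>(P, Q). P \<otimes>\<^bsub>EG\<^esub> Q) ` (invariant_points \<times> R_span) = invariant_points <#>\<^bsub>EG\<^esub> R_span"
    by (auto simp: set_mult_def)
  have hom: "(\<lambda>(P, Q). P \<otimes>\<^bsub>EG\<^esub> Q) \<in> hom (Esq \<times>\<times> EG\<lparr>carrier := R_span\<rparr>) EG"
  proof (rule homI)
    fix z assume "z \<in> carrier (Esq \<times>\<times> EG\<lparr>carrier := R_span\<rparr>)"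
    then show "(case z of (P, Q) \<Rightarrow> P \<otimes>\<^bsub>EG\<^esub> Q) \<in> carrier EG"
      unfolding cP using GpE by (auto simp del: ec_group_sel intro!: EG.m_closed)
  next
    fix z z' assume "z \<in> carrier (Esq \<times>\<times> EG\<lparr>carrier := R_span\<rparr>)" "z' \<in> carrier (Esq \<times>\<times> EG\<lparr>carrier := R_span\<rparr>)"
    then obtain P Q P' Q' where z: "z = (P, Q)" "z' = (P', Q')" and m: "P \<in> invariant_points" "Q \<in> R_span" "P' \<in> invariant_points" "Q' \<in> R_span"
      unfolding cP by auto
    then have c: "P \<in> carrier EG" "Q \<in> carrier EG" "P' \<in> carrier EG" "Q' \<in> carrier EG" using GpE by auto
    have "(P \<otimes>\<^bsub>EG\<^esub> P') \<otimes>\<^bsub>EG\<^esub> (Q \<otimes>\<^bsub>EG\<^esub> Q') = (P \<otimes>\<^bsub>EG\<^esub> Q) \<otimes>\<^bsub>EG\<^esub> (P' \<otimes>\<^bsub>EG\<^esub> Q')"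
      using c by (simp add: EG.m_ac del: ec_group_sel)
    then show "(case z \<otimes>\<^bsub>Esq \<times>\<times> EG\<lparr>carrier := R_span\<rparr>\<^esub> z' of (P, Q) \<Rightarrow> P \<otimes>\<^bsub>EG\<^esub> Q) =
       (case z of (P, Q) \<Rightarrow> P \<otimes>\<^bsub>EG\<^esub> Q) \<otimes>\<^bsub>EG\<^esub> (case z' of (P, Q) \<Rightarrow> P \<otimes>\<^bsub>EG\<^esub> Q)"
      unfolding z by (simp add: DirProd_def Esq')
  qed
  have inj: "inj_on (\<lambda>(P, Q). P \<otimes>\<^bsub>EG\<^esub> Q) (invariant_points \<times> R_span)"
  proof (rule inj_onI, clarify)
    fix P Q P' Q' assume m: "P \<in> invariant_points" "Q \<in> R_span" "P' \<in> invariant_points" "Q' \<in> R_span" and eq: "P \<otimes>\<^bsub>EG\<^esub> Q = P' \<otimes>\<^bsub>EG\<^esub> Q'"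
    have c: "P \<in> carrier EG" "Q \<in> carrier EG" "P' \<in> carrier EG" "Q' \<in> carrier EG" using m GpE by auto
    let ?i = "\<lambda>P. inv\<^bsub>EG\<^esub> P"
    have "?i P' \<otimes>\<^bsub>EG\<^esub> (P \<otimes>\<^bsub>EG\<^esub> Q) \<otimes>\<^bsub>EG\<^esub> ?i Q = ?i P' \<otimes>\<^bsub>EG\<^esub> (P' \<otimes>\<^bsub>EG\<^esub> Q') \<otimes>\<^bsub>EG\<^esub> ?i Q"
      by (simp only: eq)
    moreover have "?i P' \<otimes>\<^bsub>EG\<^esub> (P \<otimes>\<^bsub>EG\<^esub> Q) \<otimes>\<^bsub>EG\<^esub> ?i Q = ?i P' \<otimes>\<^bsub>EG\<^esub> P"
      using c by (simp add: EG.m_assoc del: ec_group_sel)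
    moreover have "?i P' \<otimes>\<^bsub>EG\<^esub> (P' \<otimes>\<^bsub>EG\<^esub> Q') \<otimes>\<^bsub>EG\<^esub> ?i Q = Q' \<otimes>\<^bsub>EG\<^esub> ?i Q"
      using c by (simp add: EG.inv_solve_left' EG.m_assoc[symmetric] del: ec_group_sel)
    ultimately have D: "?i P' \<otimes>\<^bsub>EG\<^esub> P = Q' \<otimes>\<^bsub>EG\<^esub> ?i Q" by simp
    have "?i P' \<otimes>\<^bsub>EG\<^esub> P \<in> invariant_points" using m subgroup_invariant_points by (meson subgroup.m_closed subgroup.m_inv_closed)
    moreover have "Q' \<otimes>\<^bsub>EG\<^esub> ?i Q \<in> R_span" using m subgroup_R_span by (meson subgroup.m_closed subgroup.m_inv_closed)
    ultimately have "?i P' \<otimes>\<^bsub>EG\<^esub> P = \<one>\<^bsub>EG\<^esub>" "Q' \<otimes>\<^bsub>EG\<^esub> ?i Q = \<one>\<^bsub>EG\<^esub>"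
      using invariant_Int_R_span D by auto
    then show "P = P' \<and> Q = Q'" using c
      by (metis EG.inv_closed EG.inv_equality EG.inv_inv EG.inv_comm)
  qed
  show ?thesis
    unfolding V mon_def cP img using R_span_free hom inj finite_index_invariant_R_span by blast
qed

end

section \<open>The Legendre curve over a finite field\<close>

text \<open>
  Translation by 1 permutes the field, so the sum of all elements does not change when 1 is added to
  each of them.
\<close>

lemma of_nat_CARD_eq_0: "of_nat (CARD('k)) = (0 :: 'k::{field,finite})"
proof -
  have "(\<Sum>x\<in>(UNIV :: 'k set). x + 1) = (\<Sum>x\<in>(UNIV :: 'k set). x)"
    by (rule sum.reindex_bij_witness[of _ "\<lambda>x. x - 1" "\<lambda>x. x + 1"]) auto
  then show ?thesis by (simp add: sum.distrib)
qed

lemma char_rational_functions: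
  assumes "prime p" "CARD('k::{field,finite}) = p ^ n"
  shows "CHAR('k poly fract) = p"
proof -
  have "of_nat (p ^ n) = (0 :: 'k)" using of_nat_CARD_eq_0[where 'k = 'k] assms by simp
  then have "of_nat p = (0 :: 'k)" by (simp add: of_nat_power)
  moreover have "of_nat m = const_rf (of_nat m :: 'k)" for m
    by (induction m) (simp_all add: const_rf_to_fract one_pCons flip: to_fract_add to_fract_1)
  ultimately have "of_nat p = (0 :: 'k poly fract)" by (metis const_rf_eq_0)
  then have "CHAR('k poly fract) dvd p" by (simp add: of_nat_eq_0_iff_char_dvd)
  then have "CHAR('k poly fract) = 1 \<or> CHAR('k poly fract) = p" using assms(1) prime_nat_iff by blast
  then show ?thesis by auto
qed

lemma primitive_root_power_eq:
  assumes "primitive_root_of_unity d (z::'k::field)" "z ^ i = z ^ j" "i < d" "j < d"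
  shows "i = j"
proof -
  have z0: "z \<noteq> 0" using assms(1,3) by (auto simp: primitive_root_of_unity_def power_0_left split: if_splits)
  have *: "i = j" if "z ^ i = z ^ j" "i \<le> j" "j < d" for i j
  proof -
    have "z ^ j = z ^ i * z ^ (j - i)" unfolding power_add[symmetric] using that(2) by simp
    then have "z ^ (j - i) = 1" using that(1) z0 by simp
    moreover have "j - i < d" using that(3) by (rule less_imp_diff_less)
    moreover have "0 < j - i \<and> j - i < d \<longrightarrow> z ^ (j - i) \<noteq> 1"
      using assms(1) unfolding primitive_root_of_unity_def by (elim conjE allE)
    ultimately have "\<not> 0 < j - i" by simp
    then show ?thesis using that(2) by simp
  qed
  show ?thesis using *[of i j] *[of j i] assms(2-4) by (metis nat_le_linear)
qed

lemma const_rf_inverse: "const_rf (inverse c) = inverse (const_rf c)"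
proof (cases "c = 0")
  case False
  then have "const_rf c * const_rf (inverse c) = 1"
    by (simp add: const_rf_def One_fract_def one_pCons flip: const_rf_mult)
  then show ?thesis by (metis inverse_unique)
qed (simp add: const_rf_to_fract)

theorem theorem6p1:
  fixes p f d q n :: nat
    and \<zeta> :: "'k::{field,finite}"
    and u t :: "'k poly fract"
    and E Esq :: "'k poly fract ec_point monoid"
    and W :: "'k poly fract ec_point set"
  assumes "prime p" and "odd p" and "f \<ge> 1"
    and "d = 2 * (p ^ f - 1)"
    and "q = p ^ n" and "[q = 1] (mod d)"
    and "CARD('k) = q"
    and "primitive_root_of_unity d \<zeta>"
    and "u = var_rf" and "t = u ^ d"
    and "E = legendre_group t UNIV"
    and "Esq = legendre_group t (adjoin_rf (u ^ 2))"
    and "W = generate E (R_point p f \<zeta> ` {0..<d div 2})"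
  shows "E\<lparr>carrier := W\<rparr> \<cong> free_Abelian_group {0..<d div 2} \<and>
         (\<lambda>(P, Q). P \<otimes>\<^bsub>E\<^esub> Q) \<in> mon (Esq \<times>\<times> E\<lparr>carrier := W\<rparr>) E \<and>
         finite (rcosets\<^bsub>E\<^esub> ((\<lambda>(P, Q). P \<otimes>\<^bsub>E\<^esub> Q) ` carrier (Esq \<times>\<times> E\<lparr>carrier := W\<rparr>)))"
proof -
  define N where "N = p ^ f - 1"
  have "3 \<le> p" using assms(1,2) prime_ge_2_nat[of p] by (cases "p = 2") auto
  then have "3 ^ 1 \<le> p ^ f" using assms(3) by (meson order_trans power_increasing power_mono le_trans one_le_numeral zero_le)
  then have N2: "N \<ge> 2" and pf: "p ^ f = N + 1" by (auto simp: N_def)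
  have evenN: "even N" using assms(2) pf by (metis even_Suc even_power Suc_eq_plus1)
  have d: "d = 2 * N" and dN: "d div 2 = N" using assms(4) by (auto simp: N_def)
  have prim: "\<zeta> ^ (2 * N) = 1" and prim_less: "\<And>k. 0 < k \<Longrightarrow> k < 2 * N \<Longrightarrow> \<zeta> ^ k \<noteq> 1"
    using assms(8) d by (auto simp: primitive_root_of_unity_def)
  have z0: "\<zeta> \<noteq> 0" using prim N2 by (auto simp: power_0_left)
  have two: "(2::'k) \<noteq> 0"
  proof
    assume 2: "(2::'k) = 0"
    \<comment> \<open>In characteristic 2 the element \<open>\<zeta>\<^sup>N\<close>, whose square is 1, would be 1.\<close>
    have "(\<zeta> ^ N - 1)^2 = \<zeta> ^ (2 * N) + 1 - 2 * \<zeta> ^ N"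
      by (simp add: power2_eq_square algebra_simps flip: power_add mult_2)
    also have "\<dots> = 0" using prim 2 by simp
    finally show False using prim_less[of N] N2 by simp
  qed
  \<comment> \<open>The coordinates of \<open>R\<^sub>i\<close> on the twisted curve, before scaling by \<open>u\<^bsup>-1\<^esup>\<close>.\<close>
  define e where "e i = inverse (\<zeta> ^ i) ^ 2" for i
  define \<eta> where "\<eta> i = const_rf (inverse (\<zeta> ^ i) ^ 3) * (1 + const_rf ((\<zeta> ^ i)^2) * var_rf) ^ ((p ^ f + 1) div 2)" for i
  have e0: "e i \<noteq> 0" for i using z0 by (simp add: e_def)
  have e_inj: "inj_on e {..<N}"
  proof (rule inj_onI)
    fix i j assume ij: "i \<in> {..<N}" "j \<in> {..<N}" and "e i = e j"
    then have "\<zeta> ^ (2 * i) = \<zeta> ^ (2 * j)" unfolding e_def by (simp add: power_inverse flip: power_mult) (simp add: mult.commute)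
    then have "2 * i = 2 * j" using primitive_root_power_eq[OF assms(8), of "2 * i" "2 * j"] ij d by auto
    then show "i = j" by simp
  qed
  have eN: "e i ^ N = 1" for i
  proof -
    have "e i ^ N = inverse ((\<zeta> ^ (2 * N)) ^ i)" unfolding e_def by (simp add: power_inverse mult_ac flip: power_mult)
    then show ?thesis using prim by simp
  qed
  \<comment> \<open>Both sides are monic of degree \<open>N\<close> and vanish at the \<open>N\<close> distinct points \<open>- e i\<close>.\<close>
  have e_prod: "[:0,1:] ^ N - 1 = (\<Prod>i<N. [:e i, 1:])"
  proof (rule ccontr)
    let ?p = "[:0,1:] ^ N - 1 :: 'k poly" and ?q = "\<Prod>i<N. [:e i, 1:]"
    assume "?p \<noteq> ?q"
    then have nz: "?p - ?q \<noteq> 0" by simp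
    have dX: "degree ([:0,1:] ^ N :: 'k poly) = N" by (simp add: degree_power_eq)
    have dq: "degree ?q = N" by (subst degree_prod_eq_sum_degree) auto
    have "lead_coeff ?q = 1" by (simp add: lead_coeff_prod)
    then have cq: "coeff ?q N = 1" using dq by simp
    have "lead_coeff ([:0,1:] ^ N :: 'k poly) = 1" by (simp add: lead_coeff_power)
    then have "coeff ([:0,1:] ^ N :: 'k poly) N = 1" unfolding dX .
    then have c: "coeff (?p - ?q) N = 0" using cq N2 by simp
    have "degree (?p - ?q) \<le> N" by (intro degree_diff_le) (auto simp: dX dq)
    then have less: "degree (?p - ?q) < N" using c nz by (metis le_neq_implies_less leading_coeff_0_iff)
    have "poly (?p - ?q) (- e i) = 0" if "i < N" for i
    proof -
      have "poly ?p (- e i) = 0" using eN[of i] evenN by (simp add: poly_power power_minus_even)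
      moreover have "poly ?q (- e i) = 0" using that by (simp add: poly_prod prod_zero_iff) auto
      ultimately show ?thesis by simp
    qed
    then have "(\<lambda>i. - e i) ` {..<N} \<subseteq> {x. poly (?p - ?q) x = 0}" by auto
    then have "card ((\<lambda>i. - e i) ` {..<N}) \<le> card {x. poly (?p - ?q) x = 0}" by (intro card_mono) auto
    also have "\<dots> \<le> degree (?p - ?q)" using nz by (rule card_poly_roots_bound)
    also have "card ((\<lambda>i. - e i) ` {..<N}) = N" using e_inj by (subst card_image) (auto simp: inj_on_def)
    finally show False using less by simp
  qed
  have char: "CHAR('k poly fract) = p" using char_rational_functions assms(1,5,7) by metis
  have on_curve: "Point (const_rf (e i)) (\<eta> i) \<in> ec_points var_rf (var_rf ^ (N + 1))" for i
  proof -
    let ?z = "const_rf ((\<zeta> ^ i)^2)" and ?s = "var_rf :: 'k poly fract" and ?w = "const_rf (inverse (\<zeta> ^ i))"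
    have zz: "((\<zeta> ^ i)^2) ^ (N + 1) = (\<zeta> ^ i)^2"
    proof -
      have "((\<zeta> ^ i)^2) ^ N = (\<zeta> ^ (2 * N)) ^ i" by (simp add: mult_ac flip: power_mult)
      then show ?thesis using prim by simp
    qed
    have "(1 + ?z * ?s) ^ (p ^ f) = 1 ^ (p ^ f) + (?z * ?s) ^ (p ^ f)"
      by (rule freshmans_dream'[of _ f]) (use char assms(1) in auto)
    then have frob: "(1 + ?z * ?s) ^ (N + 1) = 1 + ?z * ?s ^ (N + 1)"
      unfolding pf power_mult_distrib const_rf_power[symmetric] zz by simp
    have "even (p ^ f + 1)" using assms(2) by simp
    then have "2 * ((p ^ f + 1) div 2) = N + 2" using pf by simp
    then have "((1 + ?z * ?s) ^ ((p ^ f + 1) div 2))^2 = (1 + ?z * ?s) * (1 + ?z * ?s) ^ (N + 1)"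
      by (simp flip: power_mult power_Suc add: mult.commute)
    then have sq: "((1 + ?z * ?s) ^ ((p ^ f + 1) div 2))^2 = (1 + ?z * ?s) * (1 + ?z * ?s ^ (N + 1))"
      unfolding frob .
    have "?w ^ 2 * ?z = 1" 
      using z0 unfolding const_rf_power[symmetric] const_rf_mult[symmetric] 
      by (simp add: power_inverse const_rf_def One_fract_def one_pCons)
    moreover have "(w ^ 3 * B)^2 = w^2 * (w^2 + s) * (w^2 + b)"
      if "w^2 * z = 1" "B^2 = (1 + z * s) * (1 + z * b)" for w z s b B :: "'k poly fract"
      using that by algebra
    ultimately show ?thesis
      using sq unfolding Point_ec_points \<eta>_def e_def const_rf_power by blast
  qed
  interpret tl: twisted_legendre_finite N e \<eta>
  proof (unfold_locales)
    show "nz_square (e i)" if "i < N" for i unfolding e_def using z0 by (intro nz_squareI[OF refl]) simp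
  qed (use two N2 evenN e_inj e_prod on_curve in auto)
  have t: "t = tl.t" using assms(9,10) d by (simp add: tl.t_def)
  have R: "R_point p f \<zeta> i = tl.\<phi> (tl.R_pt i)" for i
  proof -
    define v where "v = const_rf (\<zeta> ^ i) * var_rf"
    have v2: "v^2 = const_rf ((\<zeta> ^ i)^2) * var_rf^2" by (simp add: v_def power_mult_distrib const_rf_power)
    have iv: "inverse v = const_rf (inverse (\<zeta> ^ i)) * inverse var_rf" by (simp add: v_def const_rf_inverse)
    have "R_point p f \<zeta> i = Point (inverse v ^ 2) (inverse v ^ 3 * (v^2 + 1) ^ ((p ^ f + 1) div 2))"
      by (simp add: R_point_def v_def[symmetric] Let_def power_int_def)
    also have "\<dots> = Point (inverse var_rf ^ 2 * const_rf (e i))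
        (inverse var_rf ^ 3 * (const_rf (inverse (\<zeta> ^ i) ^ 3) * (1 + const_rf ((\<zeta> ^ i)^2) * var_rf^2) ^ ((p ^ f + 1) div 2)))"
      unfolding iv v2 e_def power_mult_distrib const_rf_power[symmetric] by (simp add: mult_ac add.commute)
    also have "\<dots> = tl.\<phi> (tl.R_pt i)"
      unfolding tl.\<phi>_def tl.R_pt_def tl.iota.map_scaled.simps tl.iota_const \<eta>_def
        tl.iota.hom_mult tl.iota.hom_power tl.iota.hom_add tl.iota.hom_1 tl.iota_s ..
    finally show ?thesis .
  qed
  have E: "E = ec_group 1 tl.t" using assms(11) unfolding t legendre_group_UNIV .
  show ?thesis
    using tl.minus_part_decomposition[of Esq W] assms(9,12,13) unfolding dN E t R by simp
qed

end
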